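(* Let $d\ge 2$, let $z=z(t)$, $t\ge 0$, be a real-valued function of time, and let $g_2,\dots,g_d:[0,\infty)\to[0,\infty)$ each satisfy Conditions (A), (B) and (C). Suppose that $$\sup_{t\ge 0}\mathbb{E}_{\{g_i\}}[N_t]<\infty .$$ (i) If $d\ge 4$, then $$\lim_{t\to\infty}\mathcal{E}_t(\{g_i\},z)=\lim_{t\to\infty}\big(\mathcal{S}_t(\{g_i\},z)+\mathcal{C}_t(\{g_i\},z)\big)=0. \qquad ( * )$$ (ii) If $d\in\{2,3\}$ and in addition, as $t\to\infty$, $$E_0\big[G(\zeta_{t/d}-z)1(\zeta_{t/d}>z)\big]=\begin{cases} o\big((\log t)^{-1/2}\big) & \text{if } d=3,\\ o\big(t^{-1/4}\big) & \text{if } d=2,\end{cases}$$ then $( * )$ holds.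
   Context: Exclusion process. $\{\eta_t\}_{t\ge0}$ is the symmetric simple exclusion process on $\mathbb{Z}^d$: the Markov process on $\{0,1\}^{\mathbb{Z}^d}$ with generator $\mathcal{L}_d f(\eta)=\frac{1}{2d}\sum_{x\in\mathbb{Z}^d}\sum_{|y-x|=1}\eta(x)(1-\eta(y))(f(\eta^{x,y})-f(\eta))$ for local functions $f$, where $\eta^{x,y}$ is $\eta$ with the values at $x$ and $y$ exchanged. $\mathbb{P}_\eta,\mathbb{E}_\eta$ denote law and expectation when $\eta_0=\eta$ (and $\mathrm{Cov}_\eta$ the covariance). Initial profiles. For $g_2,\dots,g_d:[0,\infty)\to[0,\infty)$, let $\mathcal{R}_{\{g_i\}}=\{x\in\mathbb{Z}^d: x_1\le 0,\ |x_i|\le g_i(-x_1)\text{ for } i=2,\dots,d\}$ and $\eta_{\{g_i\}}(x)=1(x\in\mathcal{R}_{\{g_i\}})$; $\mathbb{P}_{\{g_i\}},\mathbb{E}_{\{g_i\}}$ denote law and expectation started from $\eta_{\{g_i\}}$. Quantities. $N_t=\sum_{x\in\mathbb{Z}^d,\,x_1>z}\eta_t(x)$ with $z=z(t)$. With $A=\{x\in\mathbb{Z}^d:x_1>z\}$ and $\eta=\eta_{\{g_i\}}$: $\mathcal{S}_t(\{g_i\},z)=\sum_{x\in A}(\mathbb{E}_\eta[\eta_t(x)])^2$, $\mathcal{C}_t(\{g_i\},z)=-2\sum_{\{x,y\}\subset A}\mathrm{Cov}_\eta(\eta_t(x),\eta_t(y))$ (sum over unordered pairs of distinct sites), and $\mathcal{E}_t=\mathcal{S}_t+\mathcal{C}_t$.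 Conditions on $g:[0,\infty)\to[0,\infty)$. (A) $g$ is nondecreasing. (B) $g$ is continuously differentiable and $\sup_{m\in\Delta(g)}\frac{|g(m)-g(m-1)|}{g'(m)}<\infty$, where $\Delta(g)=\{m\in\{1,2,\dots\}:g(m)\ne g(m-1)\}$ (in particular $g'(m)\neq 0$ for $m\in\Delta(g)$ is required; the condition is vacuous if $\Delta(g)=\varnothing$). (C) $g$ is continuously differentiable with $\lim_{u\to\infty}g'(u)/g(u)=0$. $G(u)=\prod_{i=2}^d(2g_i(u)+1)$. $\zeta_t$ is the continuous-time simple symmetric random walk on $\mathbb{Z}$ with jump rate $1$; $P_j,E_j$ denote law and expectation with $\zeta_0=j$. *)

theory Defs
  imports "HOL-Probability.Probability" "HOL-Library.Landau_Symbols"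
begin

section \<open>The symmetric simple exclusion process\<close>

text \<open>
  The lattice \<open>\<int>\<^sup>d\<close> is \<^typ>\<open>int ^ 'd\<close> with \<open>d = CARD('d)\<close>.  A configuration is a function to
  \<^typ>\<open>bool\<close> (discrete topology); the function space carries the product topology of
  \<open>HOL-Analysis.Function_Topology\<close> and its Borel sets, which here are the product sets.
\<close>

type_synonym 'd site = "int ^ 'd"
type_synonym 'd config = "int ^ 'd \<Rightarrow> bool"

text \<open>For integer points, Euclidean distance 1 and \<open>\<ell>\<^sup>1\<close> distance 1 are the same.\<close>

definition nbrs :: "'d::finite site \<Rightarrow> 'd site set" where
  "nbrs x = {y. (\<Sum>i\<in>UNIV. \<bar>y $ i - x $ i\<bar>) = 1}"

definition exchange :: "'d::finite config \<Rightarrow> 'd site \<Rightarrow> 'd site \<Rightarrow> 'd config" where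
  "exchange \<eta> x y = \<eta>(x := \<eta> y, y := \<eta> x)"

definition local_function :: "('d::finite config \<Rightarrow> real) \<Rightarrow> bool" where
  "local_function f \<longleftrightarrow>
     (\<exists>B. finite B \<and> (\<forall>\<eta> \<xi>. (\<forall>x\<in>B. \<eta> x = \<xi> x) \<longrightarrow> f \<eta> = f \<xi>))"

text \<open>For a local function only finitely many \<open>x\<close> contribute to the outer sum.\<close>

definition exclusion_generator :: "('d::finite config \<Rightarrow> real) \<Rightarrow> 'd config \<Rightarrow> real" where
  "exclusion_generator f \<eta> =
     1 / (2 * real CARD('d)) *
       (\<Sum>\<^sub>\<infinity>x\<in>UNIV. \<Sum>y\<in>nbrs x.
          of_bool (\<eta> x) * (1 - of_bool (\<eta> y)) * (f (exchange \<eta> x y) - f \<eta>))"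

definition history :: "'w measure \<Rightarrow> (real \<Rightarrow> 'w \<Rightarrow> 'd::finite config) \<Rightarrow> real \<Rightarrow> 'w measure" where
  "history M X s =
     sigma (space M) {X r -` B \<inter> space M | r B. 0 \<le> r \<and> r \<le> s \<and> B \<in> sets borel}"

text \<open>
  The Feller Markov process with cadlag paths whose infinitesimal generator (with respect to
  uniform convergence) is \<open>exclusion_generator\<close> on local functions; \<open>Pr \<eta>\<close> is the law under
  which the process \<open>X\<close> starts from \<open>\<eta>\<close>.  Local functions form a core, so these conditions
  determine the laws of \<open>X\<close>.
\<close>

definition symmetric_exclusion ::
  "('d::finite config \<Rightarrow> 'w measure) \<Rightarrow> (real \<Rightarrow> 'w \<Rightarrow> 'd config) \<Rightarrow> bool" where
  "symmetric_exclusion Pr X \<longleftrightarrow>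
     (\<forall>\<eta>. prob_space (Pr \<eta>)) \<and>
     (\<forall>\<eta> \<xi>. sets (Pr \<eta>) = sets (Pr \<xi>)) \<and>
     (\<forall>\<eta>. \<forall>t\<ge>0. X t \<in> borel_measurable (Pr \<eta>)) \<and>
     (\<forall>\<eta>. AE \<omega> in Pr \<eta>. X 0 \<omega> = \<eta>) \<and>
     (\<forall>\<eta>. \<forall>\<omega>\<in>space (Pr \<eta>).
        (\<forall>t\<ge>0. ((\<lambda>s. X s \<omega>) \<longlongrightarrow> X t \<omega>) (at_right t)) \<and>
        (\<forall>t>0. \<exists>\<xi>. ((\<lambda>s. X s \<omega>) \<longlongrightarrow> \<xi>) (at_left t))) \<and>
     (\<forall>f::'d config \<Rightarrow> real. continuous_on UNIV f \<longrightarrow>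
        (\<forall>t\<ge>0. continuous_on UNIV (\<lambda>\<eta>. \<integral>\<omega>. f (X t \<omega>) \<partial>Pr \<eta>)) \<and>
        (\<forall>\<eta>. \<forall>s\<ge>0. \<forall>t\<ge>0. AE \<omega> in Pr \<eta>.
           real_cond_exp (Pr \<eta>) (history (Pr \<eta>) X s) (\<lambda>\<omega>. f (X (s + t) \<omega>)) \<omega> =
           (\<integral>\<omega>'. f (X t \<omega>') \<partial>Pr (X s \<omega>)))) \<and>
     (\<forall>f. local_function f \<longrightarrow>
        uniform_limit UNIV (\<lambda>t \<eta>. ((\<integral>\<omega>. f (X t \<omega>) \<partial>Pr \<eta>) - f \<eta>) / t)
          (exclusion_generator f) (at_right 0))"

section \<open>Initial profiles and the quantities attached to the half-space\<close>

text \<open>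
  The parameter \<open>e\<close> is the index of the first coordinate; the remaining indices play the role of
  \<open>2, \<dots>, d\<close>, and \<open>g e\<close> is never used.
\<close>

definition profile_region :: "'d::finite \<Rightarrow> ('d \<Rightarrow> real \<Rightarrow> real) \<Rightarrow> 'd site set" where
  "profile_region e g =
     {x. x $ e \<le> 0 \<and> (\<forall>i. i \<noteq> e \<longrightarrow> \<bar>real_of_int (x $ i)\<bar> \<le> g i (- real_of_int (x $ e)))}"

definition profile :: "'d::finite \<Rightarrow> ('d \<Rightarrow> real \<Rightarrow> real) \<Rightarrow> 'd config" where
  "profile e g = (\<lambda>x. x \<in> profile_region e g)"

definition half_space :: "'d::finite \<Rightarrow> real \<Rightarrow> 'd site set" where
  "half_space e a = {x. real_of_int (x $ e) > a}"

definition particle_count :: "'d::finite \<Rightarrow> real \<Rightarrow> 'd config \<Rightarrow> ennreal" where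
  "particle_count e a \<eta> = (\<Sum>\<^sub>\<infinity>x\<in>half_space e a. of_bool (\<eta> x))"

definition covariance :: "'w measure \<Rightarrow> ('w \<Rightarrow> real) \<Rightarrow> ('w \<Rightarrow> real) \<Rightarrow> real" where
  "covariance M U V =
     (\<integral>\<omega>. (U \<omega> - (\<integral>\<omega>'. U \<omega>' \<partial>M)) * (V \<omega> - (\<integral>\<omega>'. V \<omega>' \<partial>M)) \<partial>M)"

text \<open>
  In the next two definitions \<open>M\<close> is the law of the process and \<open>Y = X t\<close> its state at time \<open>t\<close>.
  Both series converge absolutely when the expected particle count of the half-space is finite
  (for the second one because occupation variables are negatively correlated).
  The factor 2 over unordered pairs is written as a sum over ordered pairs of distinct sites.
\<close>

definition square_sum :: "'d::finite \<Rightarrow> real \<Rightarrow> 'w measure \<Rightarrow> ('w \<Rightarrow> 'd config) \<Rightarrow> real" where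
  "square_sum e a M Y = (\<Sum>\<^sub>\<infinity>x\<in>half_space e a. (\<integral>\<omega>. of_bool (Y \<omega> x) \<partial>M)\<^sup>2)"

definition cov_sum :: "'d::finite \<Rightarrow> real \<Rightarrow> 'w measure \<Rightarrow> ('w \<Rightarrow> 'd config) \<Rightarrow> real" where
  "cov_sum e a M Y =
     - (\<Sum>\<^sub>\<infinity>(x, y)\<in>{(x, y). x \<in> half_space e a \<and> y \<in> half_space e a \<and> x \<noteq> y}.
          covariance M (\<lambda>\<omega>. of_bool (Y \<omega> x)) (\<lambda>\<omega>. of_bool (Y \<omega> y)))"

section \<open>Conditions on the profile functions\<close>

definition C1_with_deriv :: "(real \<Rightarrow> real) \<Rightarrow> (real \<Rightarrow> real) \<Rightarrow> bool" where
  "C1_with_deriv g g' \<longleftrightarrow>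
     (\<forall>u\<ge>0. (g has_real_derivative g' u) (at u within {0..})) \<and> continuous_on {0..} g'"

definition cond_A :: "(real \<Rightarrow> real) \<Rightarrow> bool" where
  "cond_A g \<longleftrightarrow> mono_on {0..} g"

definition jump_set :: "(real \<Rightarrow> real) \<Rightarrow> nat set" where
  "jump_set g = {m. m \<ge> 1 \<and> g (real m) \<noteq> g (real m - 1)}"

definition cond_B :: "(real \<Rightarrow> real) \<Rightarrow> bool" where
  "cond_B g \<longleftrightarrow>
     (\<exists>g'. C1_with_deriv g g' \<and> (\<forall>m\<in>jump_set g. g' (real m) \<noteq> 0) \<and>
           bdd_above ((\<lambda>m. \<bar>g (real m) - g (real m - 1)\<bar> / g' (real m)) ` jump_set g))"

text \<open>
  Since \<open>0 / 0 = 0\<close> in HOL, the zero function satisfies \<open>cond_C\<close>; a nonnegative nondecreasing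
  function that is not identically zero on \<open>[0, \<infinity>)\<close> is eventually positive, so there the
  quotient is unambiguous.
\<close>

definition cond_C :: "(real \<Rightarrow> real) \<Rightarrow> bool" where
  "cond_C g \<longleftrightarrow> (\<exists>g'. C1_with_deriv g g' \<and> ((\<lambda>u. g' u / g u) \<longlongrightarrow> 0) at_top)"

definition cross_section :: "'d::finite \<Rightarrow> ('d \<Rightarrow> real \<Rightarrow> real) \<Rightarrow> real \<Rightarrow> real" where
  "cross_section e g u = (\<Prod>i\<in>UNIV - {e}. 2 * g i u + 1)"

section \<open>Continuous-time simple symmetric random walk on the integers\<close>

primrec srw_pmf :: "int \<Rightarrow> nat \<Rightarrow> int pmf" where
  "srw_pmf j 0 = return_pmf j"
| "srw_pmf j (Suc n) = bind_pmf (srw_pmf j n) (\<lambda>k. pmf_of_set {k - 1, k + 1})"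

text \<open>
  Law at time \<open>t \<ge> 0\<close> of the walk with jump rate 1 started at \<open>j\<close>: the number of jumps up to time
  \<open>t\<close> is Poisson with mean \<open>t\<close>.  (\<^const>\<open>poisson_pmf\<close> is only meaningful for positive rates.)
\<close>

definition ctrw_pmf :: "int \<Rightarrow> real \<Rightarrow> int pmf" where
  "ctrw_pmf j t = (if t > 0 then bind_pmf (poisson_pmf t) (srw_pmf j) else return_pmf j)"

text \<open>
  \<open>E\<^sub>0[G(\<zeta>\<^sub>t - a) 1(\<zeta>\<^sub>t > a)]\<close>.  If all the \<open>g i\<close> satisfy \<^const>\<open>cond_A\<close> and \<^const>\<open>cond_C\<close>, then \<open>G\<close>
  grows slower than every exponential and the integrand is integrable.
\<close>

definition walk_tail_moment ::
  "'d::finite \<Rightarrow> ('d \<Rightarrow> real \<Rightarrow> real) \<Rightarrow> real \<Rightarrow> real \<Rightarrow> real" where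
  "walk_tail_moment e g a t =
     measure_pmf.expectation (ctrw_pmf 0 t)
       (\<lambda>k. cross_section e g (real_of_int k - a) * of_bool (real_of_int k > a))"

end

theory Submission
  imports Defs "HOL-Real_Asymp.Real_Asymp"
begin

text \<open>
  Write \<open>\<rho>\<close> and \<open>q\<close> for the one- and two-point functions of the process,
  \<open>\<alpha>\<^sub>s(u)\<close> for the probability that a single walk from \<open>u\<close> is in the half-space \<open>A\<close> at time \<open>s\<close>, and
  \<open>\<Psi>(r) = \<Sum>\<^bsub>u \<noteq> v\<^esub> \<alpha>\<^bsub>t-r\<^esub>(u) \<alpha>\<^bsub>t-r\<^esub>(v) q\<^sub>r(u, v)\<close>.  The exclusion rule makes \<open>\<Psi>\<close> decrease
  exactly at rate \<open>1/(2d) \<Sum>\<^bsub>u \<sim> v\<^esub> q\<^sub>r(u, v) (\<alpha>\<^bsub>t-r\<^esub>(u) - \<alpha>\<^bsub>t-r\<^esub>(v))\<^sup>2\<close>, so that the energy is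
  \<open>\<Sum>\<^bsub>u occupied\<^esub> \<alpha>\<^sub>t(u)\<^sup>2 + \<Psi>(0) - \<Psi>(t)\<close>.  Negative correlation, \<open>q\<^sub>r(u, v) \<le> \<rho>\<^sub>r(u) \<rho>\<^sub>r(v)\<close>, follows
  from a maximum principle.  Only steps in the first coordinate contribute to the dissipation, and
  there \<open>\<rho>\<^sub>r\<close> is at most \<open>O(r\<^bsup>-(d-1)/2\<^esup>)\<close> times the mass of its layer; Chapman-Kolmogorov then gives
  \<open>\<Psi>(0) - \<Psi>(t) \<le> R\<^sub>t(k) R\<^sub>t(k-1) \<integral>\<^sub>0\<^sup>t O((1+r)\<^bsup>-(d-1)/2\<^esup>) dr\<close>, where \<open>R\<^sub>t(k)\<close> is the expected number of
  particles in the first layer of \<open>A\<close>.  The slow growth of the profile forces \<open>R\<^sub>t(k) \<rightarrow> 0\<close> once the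
  expected particle count of \<open>A\<close> is bounded, and \<open>R\<^sub>t(k)\<close> is bounded by the tail moment of the walk.
  The integral is bounded for \<open>d \<ge> 4\<close>, logarithmic for \<open>d = 3\<close> and of order \<open>\<surd>t\<close> for \<open>d = 2\<close>.
  The sums are handled for finite truncations of the profile; the Feller property gives the limit.
\<close>

section \<open>A maximum principle and termwise differentiation\<close>

text \<open>Because \<open>q\<close> vanishes on the diagonal, squares and negated covariances form
  one family \<open>\<rho> \<rho> - q\<close> over all ordered pairs in \<open>A\<close>. Its terms
  are nonnegative, so only an upper bound is at stake. The expected count in \<open>A\<close> can be
  computed at time \<open>t\<close> or from the initial sites; its square is therefore both the
  energy plus the final pair functional and the sum of squared reaching probabilities plus the
  initial one. In the dissipation each bond carries two one-point factors and two kernel factors.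
  One product of each kind is estimated pointwise, the other is summed; this gives a product of two
  layer masses, essentially the square of the front density. The squares of
  \<open>(log t)^(-1/2)\<close> and \<open>t^(-1/4)\<close> are the reciprocals of the growth of the
  time integral in dimensions 3 and 2. Two obstacles shape the argument. A sum over infinitely many
  pairs is differentiated in time, which asks for a summable majorant uniform in time. And layer
  \<open>k - 1\<close> lies outside \<open>A\<close>, so the bounded count says nothing about it;
  but a particle from depth \<open>m + 1\<close> that ends there has the same displacement as one
  from depth \<open>m\<close> that ends in layer \<open>k\<close>, so comparing sizes of consecutive
  layers suffices.\<close>

lemma nondecreasing_from_derivative:
  fixes f :: "real \<Rightarrow> real"
  assumes "0 \<le> t" "t \<le> T"
    and "\<And>r. 0 \<le> r \<Longrightarrow> r \<le> T \<Longrightarrow> (f has_real_derivative f' r) (at r within {0..T})"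
    and "\<And>r. 0 \<le> r \<Longrightarrow> r \<le> T \<Longrightarrow> 0 \<le> f' r"
  shows "f 0 \<le> f t"
proof (rule DERIV_nonneg_imp_increasing_open[OF assms(1)])
  fix r assume r: "0 < r" "r < t"
  have "(f has_real_derivative f' r) (at r within {0..T})"
    using assms(3)[of r] r assms(2) by simp
  moreover have "at r within {0..T} = at r"
    using r assms(2) by (intro at_within_interior) auto
  ultimately show "\<exists>y. (f has_real_derivative y) (at r) \<and> 0 \<le> y"
    using assms(4)[of r] r assms(2) by auto
next
  show "continuous_on {0..t} f"
  proof (rule continuous_on_subset[where s="{0..T}"])
    show "continuous_on {0..T} f"
      using assms(3) by (auto simp: continuous_on_eq_continuous_within intro!: DERIV_continuous)
  qed (use assms in auto)
qed

text \<open>With infinitely many indices a minimum need not be attained, so the argument at a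
  minimum point is replaced by an iteration: a common lower bound for all
  \<open>exp (\<kappa> * r) * D r j\<close> is fed into the equation and integrated, which gains a
  factor \<open>\<kappa> * r / n\<close>. Boundedness of \<open>D\<close> starts the iteration, and
  the factorial sends the bound to 0.\<close>

lemma maximum_principle:
  fixes D s :: "real \<Rightarrow> 'i \<Rightarrow> real"
  assumes deriv: "\<And>i t. i \<in> I \<Longrightarrow> 0 \<le> t \<Longrightarrow> t \<le> T \<Longrightarrow>
        ((\<lambda>t. D t i) has_real_derivative (c * (\<Sum>j\<in>N i. D t j - D t i) + s t i)) (at t within {0..T})"
    and N: "\<And>i. i \<in> I \<Longrightarrow> N i \<subseteq> I" "\<And>i. i \<in> I \<Longrightarrow> card (N i) \<le> m"
    and c: "0 \<le> c"
    and s: "\<And>i t. i \<in> I \<Longrightarrow> 0 \<le> t \<Longrightarrow> t \<le> T \<Longrightarrow> 0 \<le> s t i"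
    and bnd: "\<And>i t. i \<in> I \<Longrightarrow> 0 \<le> t \<Longrightarrow> t \<le> T \<Longrightarrow> \<bar>D t i\<bar> \<le> M"
    and init: "\<And>i. i \<in> I \<Longrightarrow> 0 \<le> D 0 i"
    and it: "i \<in> I" "0 \<le> t" "t \<le> T"
  shows "0 \<le> D t i"
proof -
  \<comment> \<open>\<open>\<kappa>\<close> dominates the total rate \<open>c * card (N i)\<close>
    out of any index, so the integrating factor leaves a nonnegative coefficient in front of every
    value of \<open>D\<close>.\<close>
  define \<kappa> where "\<kappa> = c * real m"
  have \<kappa>: "0 \<le> \<kappa>" using c by (simp add: \<kappa>_def)
  define K where "K = M * exp (\<kappa> * T)"
  have M0: "0 \<le> M" using bnd[OF it] by linarith
  have K0: "0 \<le> K" unfolding K_def using M0 by simp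
  have *: "- (K * (\<kappa> * r) ^ n / fact n) \<le> exp (\<kappa> * r) * D r i"
    if "i \<in> I" "0 \<le> r" "r \<le> T" for n r i
    using that
  proof (induction n arbitrary: i r)
    case 0
    have "exp (\<kappa> * r) * (- D r i) \<le> exp (\<kappa> * r) * M"
      using bnd[OF 0] by (intro mult_left_mono) (auto simp: abs_le_iff)
    also have "\<dots> \<le> exp (\<kappa> * T) * M"
      using 0 \<kappa> M0 by (intro mult_right_mono) (auto simp: mult_left_mono)
    finally show ?case by (simp add: K_def algebra_simps)
  next
    case (Suc n)
    define F where "F = (\<lambda>r. exp (\<kappa> * r) * D r i + K * (\<kappa> * r) ^ Suc n / fact (Suc n))"
    define F' where "F' = (\<lambda>r. exp (\<kappa> * r) * \<kappa> * D r i + exp (\<kappa> * r) * (c * (\<Sum>j\<in>N i. D r j - D r i) + s r i)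
            + K * \<kappa> * (\<kappa> * r) ^ n / fact n)"
    have d: "(F has_real_derivative F' r) (at r within {0..T})" if "0 \<le> r" "r \<le> T" for r
    proof -
      have "((\<lambda>r. K * (\<kappa> * r) ^ Suc n / fact (Suc n)) has_real_derivative K * \<kappa> * (\<kappa> * r) ^ n / fact n)
             (at r within {0..T})"
      proof -
        have "((\<lambda>r. K * (\<kappa> * r) ^ Suc n / fact (Suc n)) has_real_derivative
              K * (real (Suc n) * (\<kappa> * r) ^ n * \<kappa>) / fact (Suc n)) (at r within {0..T})"
          by (rule derivative_eq_intros refl | simp)+
        moreover have "K * (real (Suc n) * (\<kappa> * r) ^ n * \<kappa>) / fact (Suc n) = K * \<kappa> * (\<kappa> * r) ^ n / fact n"
          by (simp add: field_simps del: of_nat_Suc)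
        ultimately show ?thesis by (simp only:)
      qed
      moreover have "((\<lambda>r. exp (\<kappa> * r) * D r i) has_real_derivative
          exp (\<kappa> * r) * \<kappa> * D r i + exp (\<kappa> * r) * (c * (\<Sum>j\<in>N i. D r j - D r i) + s r i)) (at r within {0..T})"
        by (rule derivative_eq_intros deriv[OF Suc.prems(1) that] refl | simp)+
      ultimately show ?thesis unfolding F_def F'_def by (rule DERIV_add[rotated])
    qed
    have nonneg: "0 \<le> F' r" if r: "0 \<le> r" "r \<le> T" for r
    proof -
      define b where "b = K * (\<kappa> * r) ^ n / fact n"
      have b0: "0 \<le> b" unfolding b_def using K0 \<kappa> r by simp
      have lower: "- b \<le> exp (\<kappa> * r) * D r j" if "j \<in> I" for j
        unfolding b_def by (rule Suc.IH[OF that r])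
      define k where "k = card (N i)"
      have km: "k \<le> m" unfolding k_def using N(2)[OF Suc.prems(1)] .
      have eq: "F' r = (\<kappa> - c * k) * (exp (\<kappa> * r) * D r i) + c * (\<Sum>j\<in>N i. exp (\<kappa> * r) * D r j)
          + exp (\<kappa> * r) * s r i + \<kappa> * b"
        unfolding F'_def b_def k_def
        by (simp add: sum_subtractf algebra_simps sum_distrib_left)
      have "(\<kappa> - c * k) * (exp (\<kappa> * r) * D r i) \<ge> (\<kappa> - c * k) * (- b)"
      proof (rule mult_left_mono)
        show "0 \<le> \<kappa> - c * real k" unfolding \<kappa>_def using km c by (simp add: mult_left_mono)
      qed (use lower Suc.prems in auto)
      moreover have "c * (\<Sum>j\<in>N i. exp (\<kappa> * r) * D r j) \<ge> c * (\<Sum>j\<in>N i. - b)"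
        using lower N(1)[OF Suc.prems(1)] c by (intro mult_left_mono sum_mono) auto
      moreover have "exp (\<kappa> * r) * s r i \<ge> 0" using s[OF Suc.prems(1) r] by simp
      ultimately show ?thesis unfolding eq k_def by (simp add: algebra_simps)
    qed
    have "F 0 \<le> F r"
      by (rule nondecreasing_from_derivative[OF _ _ d nonneg]) (use Suc.prems in auto)
    moreover have "0 \<le> F 0" unfolding F_def using init[OF Suc.prems(1)] by simp
    ultimately show ?case unfolding F_def by linarith
  qed
  have "(\<lambda>n. - (K * ((\<kappa> * t) ^ n / fact n))) \<longlonglongrightarrow> - (K * 0)"
    using summable_LIMSEQ_zero[OF summable_exp[of "\<kappa> * t"]]
    by (intro tendsto_intros) (simp add: field_simps)
  then have "0 \<le> exp (\<kappa> * t) * D t i"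
    using *[OF it] by (intro LIMSEQ_le_const2[of "\<lambda>n. - (K * ((\<kappa> * t) ^ n / fact n))" 0]) auto
  then show ?thesis by (simp add: zero_le_mult_iff)
qed

text \<open>The index type is enumerated by a bijection with \<open>nat\<close> (hence the
  infinitude assumption), which turns unordered sums into series and makes the Weierstrass test
  available.\<close>

lemma has_real_derivative_infsum:
  fixes f f' :: "'i::countable \<Rightarrow> real \<Rightarrow> real"
  assumes inf: "infinite (UNIV :: 'i set)"
    and S: "convex S" "r \<in> S"
    and deriv: "\<And>i r. r \<in> S \<Longrightarrow> (f i has_real_derivative f' i r) (at r within S)"
    and f: "\<And>r. r \<in> S \<Longrightarrow> (\<lambda>i. f i r) summable_on UNIV"
    and M: "M summable_on UNIV" "\<And>i r. r \<in> S \<Longrightarrow> \<bar>f' i r\<bar> \<le> M i"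
  shows "((\<lambda>r. \<Sum>\<^sub>\<infinity>i. f i r) has_real_derivative (\<Sum>\<^sub>\<infinity>i. f' i r)) (at r within S)"
proof -
  define e where "e = (from_nat_into UNIV :: nat \<Rightarrow> 'i)"
  have e: "bij_betw e UNIV UNIV"
    unfolding e_def using inf by (intro bij_betw_from_nat_into) auto
  have sums: "(\<lambda>n. g (e n)) sums (\<Sum>\<^sub>\<infinity>i. g i)" if "g summable_on UNIV" for g :: "'i \<Rightarrow> real"
  proof -
    have "(g has_sum (\<Sum>\<^sub>\<infinity>i. g i)) UNIV" using that by (rule has_sum_infsum)
    then have "((\<lambda>n. g (e n)) has_sum (\<Sum>\<^sub>\<infinity>i. g i)) UNIV"
      using has_sum_reindex_bij_betw[OF e, of g] by simp
    then show ?thesis by (rule has_sum_imp_sums)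
  qed
  have Me: "summable (\<lambda>n. M (e n))" using sums[OF M(1)] by (rule sums_summable)
  have sf': "(\<lambda>i. f' i r) summable_on UNIV" if "r \<in> S" for r
    by (rule abs_summable_summable, rule Infinite_Sum.abs_summable_on_comparison_test'[OF M(1)])
      (use M(2)[OF that] in auto)
  have "uniform_limit S (\<lambda>n r. \<Sum>k<n. f' (e k) r) (\<lambda>r. \<Sum>k. f' (e k) r) sequentially"
    using M(2) Me by (intro Weierstrass_m_test) auto
  from has_field_derivative_series[where f="\<lambda>n. f (e n)" and f'="\<lambda>n. f' (e n)", OF S(1) deriv this S(2)]
    sums[OF f[OF S(2)]]
  obtain g where g: "\<And>x. x \<in> S \<Longrightarrow> (\<lambda>n. f (e n) x) sums g x"
     "\<And>x. x \<in> S \<Longrightarrow> (g has_real_derivative (\<Sum>k. f' (e k) x)) (at x within S)"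
    by (metis sums_summable)
  have 1: "(\<Sum>\<^sub>\<infinity>i. f i x) = g x" if "x \<in> S" for x
    using sums[OF f[OF that]] g(1)[OF that] by (rule sums_unique2)
  have 2: "(\<Sum>k. f' (e k) r) = (\<Sum>\<^sub>\<infinity>i. f' i r)"
    using sums[OF sf'[OF S(2)]] by (rule sums_unique[symmetric])
  show ?thesis
    using g(2)[OF S(2)] unfolding 2
    by (rule has_field_derivative_transform_within[OF _ zero_less_one S(2)]) (use 1 in auto)
qed

section \<open>Correlation functions of the exclusion process\<close>

lemma nbrs_eq: "nbrs (x::'d::finite site) = (\<lambda>(i, s). x + axis i s) ` (UNIV \<times> {1, -1})"
proof (intro set_eqI iffI)
  fix y assume "y \<in> nbrs x"
  then have s: "(\<Sum>i\<in>UNIV. \<bar>y $ i - x $ i\<bar>) = 1" by (simp add: nbrs_def)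
  then obtain i where i: "y $ i - x $ i \<noteq> 0"
    by (metis (mono_tags, lifting) abs_zero sum.neutral zero_neq_one)
  have "(\<Sum>i\<in>UNIV. \<bar>y $ i - x $ i\<bar>) = \<bar>y $ i - x $ i\<bar> + (\<Sum>j\<in>UNIV - {i}. \<bar>y $ j - x $ j\<bar>)"
    by (simp add: sum.remove)
  moreover have "0 \<le> (\<Sum>j\<in>UNIV - {i}. \<bar>y $ j - x $ j\<bar>)" by (intro sum_nonneg) auto
  ultimately have a: "\<bar>y $ i - x $ i\<bar> = 1" "(\<Sum>j\<in>UNIV - {i}. \<bar>y $ j - x $ j\<bar>) = 0"
    using s i by linarith+
  from a(2) have "\<forall>j\<in>UNIV - {i}. \<bar>y $ j - x $ j\<bar> = 0"
    by (subst (asm) sum_nonneg_eq_0_iff) auto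
  then have "y = x + axis i (y $ i - x $ i)"
    by (auto simp: vec_eq_iff axis_def)
  moreover have "y $ i - x $ i \<in> {1, -1}" using a(1) by (auto simp: abs_if split: if_splits)
  ultimately show "y \<in> (\<lambda>(i, s). x + axis i s) ` (UNIV \<times> {1, -1})" by force
next
  fix y assume "y \<in> (\<lambda>(i, s). x + axis i s) ` (UNIV \<times> {1, -1})"
  then obtain i s where y: "y = x + axis i s" and s: "s = 1 \<or> s = -1" by auto
  have "(\<Sum>j\<in>UNIV. \<bar>y $ j - x $ j\<bar>) = (\<Sum>j\<in>UNIV. if j = i then \<bar>s\<bar> else 0)"
    unfolding y by (intro sum.cong) (auto simp: axis_def)
  then show "y \<in> nbrs x" using s by (auto simp: nbrs_def)
qed

lemma inj_nbrs: "inj_on (\<lambda>(i, s). (x::'d::finite site) + axis i s) (UNIV \<times> {1, -1})"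
  by (auto simp: inj_on_def axis_eq_axis)

lemma sum_nbrs:
  fixes x :: "'d::finite site" and f :: "'d site \<Rightarrow> 'a::comm_monoid_add"
  shows "(\<Sum>y\<in>nbrs x. f y) = (\<Sum>i\<in>UNIV. f (x + axis i 1) + f (x - axis i 1))"
proof -
  have neg: "axis i (- 1) = - (axis i 1 :: 'd site)" for i by (auto simp: vec_eq_iff axis_def)
  have "(\<Sum>y\<in>nbrs x. f y) = (\<Sum>(i, s)\<in>UNIV \<times> {1, -1}. f (x + axis i s))"
    unfolding nbrs_eq by (subst sum.reindex[OF inj_nbrs]) (simp add: o_def case_prod_unfold)
  also have "\<dots> = (\<Sum>i\<in>UNIV. \<Sum>s\<in>{1, -1}. f (x + axis i s))"
    by (rule sum.cartesian_product[symmetric])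
  finally show ?thesis by (simp add: neg)
qed

lemma finite_nbrs [simp]: "finite (nbrs (x::'d::finite site))"
  by (simp add: nbrs_eq)

lemma card_nbrs: "card (nbrs (x::'d::finite site)) = 2 * CARD('d)"
  unfolding nbrs_eq by (subst card_image[OF inj_nbrs]) (simp add: card_cartesian_product)

lemma nbrs_sym: "y \<in> nbrs x \<longleftrightarrow> x \<in> nbrs y"
  by (simp add: nbrs_def abs_minus_commute)

lemma not_self_nbr [simp]: "x \<notin> nbrs x"
  by (simp add: nbrs_def)

section \<open>The generator on indicators of fully occupied finite sets\<close>

definition occupied :: "'d::finite site set \<Rightarrow> 'd config \<Rightarrow> real" where
  "occupied B \<eta> = of_bool (\<forall>x\<in>B. \<eta> x)"

lemma occupied_bounds: "0 \<le> occupied B \<eta>" "occupied B \<eta> \<le> 1" "\<bar>occupied B \<eta>\<bar> \<le> 1"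
  by (auto simp: occupied_def)

lemma local_occupied: "finite B \<Longrightarrow> local_function (occupied B)"
  unfolding local_function_def occupied_def by (intro exI[of _ B]) auto

lemma continuous_occupied: "finite B \<Longrightarrow> continuous_on UNIV (occupied (B::'d::finite site set))"
proof -
  assume B: "finite B"
  have c: "continuous_on UNIV (\<lambda>\<eta>::'d config. of_bool (\<eta> x) :: real)" for x
    by (rule continuous_on_compose2[of UNIV of_bool])
       (auto intro!: continuous_on_product_coordinates)
  have "occupied B = (\<lambda>\<eta>. \<Prod>x\<in>B. of_bool (\<eta> x))"
    using B by (induction B) (auto simp: occupied_def fun_eq_iff)
  then show ?thesis by (simp only:) (intro continuous_on_prod c)
qed

text \<open>This is self-duality: the indicator that \<open>B\<close> is full changes as if the set
  \<open>B\<close> itself performed an exclusion process. Loss comes from a particle leaving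
  \<open>B\<close>, gain from a particle outside filling the only vacancy in \<open>B\<close>.
  Exchanging the roles of source and target in the gain makes both range over the same
  pairs.\<close>

lemma generator_occupied:
  fixes B :: "'d::finite site set"
  assumes B: "finite B"
  shows "exclusion_generator (occupied B) \<eta> =
    1 / (2 * real CARD('d)) *
      (\<Sum>x\<in>B. \<Sum>y\<in>nbrs x - B. occupied (insert y (B - {x})) \<eta> - occupied B \<eta>)"
proof -
  define f where "f x y = of_bool (\<eta> x) * (1 - of_bool (\<eta> y)) *
     (occupied B (exchange \<eta> x y) - occupied B \<eta>)" for x y
  \<comment> \<open>A site outside \<open>S\<close> neither lies in \<open>B\<close> nor has a
    neighbour in \<open>B\<close>, so the infinite sum reduces to the finite set
    \<open>S\<close>.\<close>
  define S where "S = B \<union> (\<Union>x\<in>B. nbrs x)"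
  have S: "finite S" "B \<subseteq> S" using B by (auto simp: S_def)
  let ?a = "\<lambda>x y. of_bool (\<eta> x \<and> \<not> \<eta> y) * occupied B \<eta>"
  let ?b = "\<lambda>x y. of_bool (\<eta> x \<and> \<not> \<eta> y) * occupied (insert x (B - {y})) \<eta>"
  have f: "f x y = (if y \<notin> B then (if x \<in> B then - (?a x y) else 0) else 0)
        + (if y \<in> B then (if x \<notin> B then ?b x y else 0) else 0)"
    if "y \<in> nbrs x" for x y
  proof -
    have "x \<noteq> y" using that by auto
    then show ?thesis
      unfolding f_def by (auto simp: occupied_def exchange_def)
  qed
  have "(\<Sum>\<^sub>\<infinity>x\<in>UNIV. \<Sum>y\<in>nbrs x. f x y) = (\<Sum>\<^sub>\<infinity>x\<in>S. \<Sum>y\<in>nbrs x. f x y)"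
  proof (rule infsum_cong_neutral)
    fix x assume "x \<in> UNIV - S"
    then have "x \<notin> B" "\<And>y. y \<in> nbrs x \<Longrightarrow> y \<notin> B" by (auto simp: S_def nbrs_sym)
    then show "(\<Sum>y\<in>nbrs x. f x y) = 0" by (intro sum.neutral) (auto simp: f)
  qed auto
  also have "\<dots> = (\<Sum>x\<in>S. \<Sum>y\<in>nbrs x. f x y)" using S by simp
  also have "\<dots> = (\<Sum>x\<in>S. \<Sum>y\<in>nbrs x. if y \<notin> B then (if x \<in> B then - (?a x y) else 0) else 0)
    + (\<Sum>x\<in>S. \<Sum>y\<in>nbrs x. if y \<in> B then (if x \<notin> B then ?b x y else 0) else 0)"
    by (simp add: sum.distrib f)
  also have "(\<Sum>x\<in>S. \<Sum>y\<in>nbrs x. if y \<notin> B then (if x \<in> B then - (?a x y) else 0) else 0)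
     = (\<Sum>x\<in>B. \<Sum>y\<in>nbrs x - B. - (?a x y))"
  proof -
    have "(\<Sum>x\<in>S. \<Sum>y\<in>nbrs x. if y \<notin> B then (if x \<in> B then - (?a x y) else 0) else 0)
      = (\<Sum>x\<in>S. if x \<in> B then \<Sum>y\<in>nbrs x - B. - (?a x y) else 0)"
      by (intro sum.cong refl) (auto intro!: sum.mono_neutral_cong_right sum.neutral)
    also have "\<dots> = (\<Sum>x\<in>B. \<Sum>y\<in>nbrs x - B. - (?a x y))"
      using S by (intro sum.mono_neutral_cong_right) auto
    finally show ?thesis .
  qed
  also have "(\<Sum>x\<in>S. \<Sum>y\<in>nbrs x. if y \<in> B then (if x \<notin> B then ?b x y else 0) else 0)
     = (\<Sum>y\<in>B. \<Sum>x\<in>nbrs y - B. ?b x y)"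
  proof -
    have "(\<Sum>x\<in>S. \<Sum>y\<in>nbrs x. if y \<in> B then (if x \<notin> B then ?b x y else 0) else 0)
     = (\<Sum>x\<in>S. \<Sum>y\<in>{y. y \<in> B \<and> y \<in> nbrs x}. if x \<notin> B then ?b x y else 0)"
      by (intro sum.cong refl sum.mono_neutral_cong_right) auto
    also have "\<dots> = (\<Sum>y\<in>B. \<Sum>x\<in>{x. x \<in> S \<and> y \<in> nbrs x}. if x \<notin> B then ?b x y else 0)"
      by (rule sum.swap_restrict) (use S B in auto)
    also have "\<dots> = (\<Sum>y\<in>B. \<Sum>x\<in>nbrs y - B. ?b x y)"
      using S by (intro sum.cong refl sum.mono_neutral_cong_right)
        (auto simp: S_def dest: nbrs_sym[THEN iffD1])
    finally show ?thesis .
  qed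
  also have "(\<Sum>x\<in>B. \<Sum>y\<in>nbrs x - B. - (?a x y)) +
      (\<Sum>y\<in>B. \<Sum>x\<in>nbrs y - B. ?b x y)
     = (\<Sum>x\<in>B. \<Sum>y\<in>nbrs x - B. occupied (insert y (B - {x})) \<eta> - occupied B \<eta>)"
    unfolding sum.distrib[symmetric]
  proof (intro sum.cong refl)
    \<comment> \<open>Configurations with both \<open>x\<close> and \<open>y\<close> occupied
      contribute equally to the two indicators on the right and cancel; those with exactly one of
      them occupied give \<open>?a\<close> and \<open>?b\<close>.\<close>
    fix x y assume "x \<in> B" "y \<in> nbrs x - B"
    then show "- (?a x y) + ?b y x
       = occupied (insert y (B - {x})) \<eta> - occupied B \<eta>"
      by (auto simp: occupied_def)
  qed
  finally show ?thesis unfolding exclusion_generator_def f_def by simp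
qed

section \<open>Kolmogorov equations for the correlation functions\<close>

locale exclusion =
  fixes Pr :: "'d::finite config \<Rightarrow> 'w measure" and X :: "real \<Rightarrow> 'w \<Rightarrow> 'd config"
  assumes symmetric_exclusion: "symmetric_exclusion Pr X"
begin

lemma prob_space_Pr: "prob_space (Pr \<eta>)"
  and measurable_X: "0 \<le> t \<Longrightarrow> X t \<in> borel_measurable (Pr \<eta>)"
  and X_0: "AE \<omega> in Pr \<eta>. X 0 \<omega> = \<eta>"
  using symmetric_exclusion unfolding symmetric_exclusion_def by blast+

lemma feller: "continuous_on UNIV f \<Longrightarrow> 0 \<le> t \<Longrightarrow> continuous_on UNIV (\<lambda>\<eta>. \<integral>\<omega>. f (X t \<omega>) \<partial>Pr \<eta>)"
  for f :: "'d config \<Rightarrow> real"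
  using symmetric_exclusion unfolding symmetric_exclusion_def by blast

lemma markov: "continuous_on UNIV f \<Longrightarrow> 0 \<le> s \<Longrightarrow> 0 \<le> t \<Longrightarrow> AE \<omega> in Pr \<eta>.
      real_cond_exp (Pr \<eta>) (history (Pr \<eta>) X s) (\<lambda>\<omega>. f (X (s + t) \<omega>)) \<omega> =
      (\<integral>\<omega>'. f (X t \<omega>') \<partial>Pr (X s \<omega>))"
  for f :: "'d config \<Rightarrow> real"
  using symmetric_exclusion unfolding symmetric_exclusion_def by blast

lemma generator: "local_function f \<Longrightarrow>
   uniform_limit UNIV (\<lambda>t \<eta>. ((\<integral>\<omega>. f (X t \<omega>) \<partial>Pr \<eta>) - f \<eta>) / t) (exclusion_generator f) (at_right 0)"
  using symmetric_exclusion unfolding symmetric_exclusion_def by blast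

definition corr :: "'d config \<Rightarrow> real \<Rightarrow> 'd site set \<Rightarrow> real" where
  "corr \<eta> t B = (\<integral>\<omega>. occupied B (X t \<omega>) \<partial>Pr \<eta>)"

lemma integrable_cont:
  fixes f :: "'d config \<Rightarrow> real"
  assumes "continuous_on UNIV f" "\<And>\<xi>. \<bar>f \<xi>\<bar> \<le> C" "0 \<le> t"
  shows "integrable (Pr \<eta>) (\<lambda>\<omega>. f (X t \<omega>))"
proof -
  interpret prob_space "Pr \<eta>" by (rule prob_space_Pr)
  have "f \<in> borel_measurable borel" using assms(1) by (simp add: borel_measurable_continuous_onI)
  then have "(\<lambda>\<omega>. f (X t \<omega>)) \<in> borel_measurable (Pr \<eta>)"
    using measurable_X[OF assms(3)] by simp
  then show ?thesis using assms(2) by (intro integrable_const_bound[of _ C]) auto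
qed

lemma integrable_occupied: "finite B \<Longrightarrow> 0 \<le> t \<Longrightarrow> integrable (Pr \<eta>) (\<lambda>\<omega>. occupied B (X t \<omega>))"
  by (rule integrable_cont[OF continuous_occupied]) (auto intro: occupied_bounds)

lemma corr_bounds:
  assumes "finite B" "0 \<le> t"
  shows "0 \<le> corr \<eta> t B" "corr \<eta> t B \<le> 1"
proof -
  interpret prob_space "Pr \<eta>" by (rule prob_space_Pr)
  show "0 \<le> corr \<eta> t B" unfolding corr_def by (intro integral_nonneg_AE) (auto intro: occupied_bounds)
  show "corr \<eta> t B \<le> 1" unfolding corr_def
    by (rule integral_le_const[OF integrable_occupied[OF assms]]) (auto intro: occupied_bounds)
qed

lemma corr_0: "finite B \<Longrightarrow> corr \<eta> 0 B = occupied B \<eta>"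
proof -
  assume B: "finite B"
  interpret prob_space "Pr \<eta>" by (rule prob_space_Pr)
  have "corr \<eta> 0 B = (\<integral>\<omega>. occupied B \<eta> \<partial>Pr \<eta>)"
    unfolding corr_def
    by (intro integral_cong_AE) (use X_0[of \<eta>] integrable_occupied[OF B, of 0 \<eta>] in \<open>auto elim: eventually_mono\<close>)
  then show ?thesis by (simp add: prob_space)
qed

lemma continuous_corr: "finite B \<Longrightarrow> 0 \<le> t \<Longrightarrow> continuous_on UNIV (\<lambda>\<eta>. corr \<eta> t B)"
  unfolding corr_def by (intro feller continuous_occupied)

lemma corr_add:
  assumes B: "finite B" and st: "0 \<le> s" "0 \<le> t"
  shows "corr \<eta> (s + t) B = (\<integral>\<omega>. corr (X s \<omega>) t B \<partial>Pr \<eta>)"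
proof -
  interpret prob_space "Pr \<eta>" by (rule prob_space_Pr)
  define F where "F = history (Pr \<eta>) X s"
  have sub: "{X r -` B \<inter> space (Pr \<eta>) | r B. 0 \<le> r \<and> r \<le> s \<and> B \<in> sets borel} \<subseteq> sets (Pr \<eta>)"
    using measurable_X by (auto intro: measurable_sets)
  have "subalgebra (Pr \<eta>) F"
    unfolding subalgebra_def F_def history_def
  proof (intro conjI)
    show "sets (sigma (space (Pr \<eta>)) {X r -` B \<inter> space (Pr \<eta>) |r B. 0 \<le> r \<and> r \<le> s \<and> B \<in> sets borel}) \<subseteq> sets (Pr \<eta>)"
      using sets.sigma_sets_subset[OF sub] by (subst sets_measure_of) auto
  qed (simp add: space_measure_of_conv)
  then interpret finite_measure_subalgebra "Pr \<eta>" F by unfold_locales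
  note int = integrable_occupied[OF B, of "s + t" \<eta>]
  have "corr \<eta> (s + t) B = (\<integral>\<omega>. real_cond_exp (Pr \<eta>) F (\<lambda>\<omega>. occupied B (X (s + t) \<omega>)) \<omega> \<partial>Pr \<eta>)"
    unfolding corr_def using real_cond_exp_int(2)[OF int] st by simp
  also have "\<dots> = (\<integral>\<omega>. corr (X s \<omega>) t B \<partial>Pr \<eta>)"
  proof (rule integral_cong_AE)
    show "(\<lambda>\<omega>. corr (X s \<omega>) t B) \<in> borel_measurable (Pr \<eta>)"
      using integrable_cont[OF continuous_corr[OF B st(2)], of 1 s \<eta>] corr_bounds[OF B st(2)] st
      by (auto simp: abs_le_iff intro: order_trans[of _ 0])
    show "AE x in Pr \<eta>. real_cond_exp (Pr \<eta>) F (\<lambda>\<omega>. occupied B (X (s + t) \<omega>)) x = corr (X s x) t B"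
      unfolding F_def corr_def by (rule markov[OF continuous_occupied[OF B] st])
  qed simp
  finally show ?thesis .
qed

definition corr_rate :: "'d config \<Rightarrow> real \<Rightarrow> 'd site set \<Rightarrow> real" where
  "corr_rate \<eta> t B = 1 / (2 * real CARD('d)) *
     (\<Sum>x\<in>B. \<Sum>y\<in>nbrs x - B. corr \<eta> t (insert y (B - {x})) - corr \<eta> t B)"

lemma integral_generator:
  assumes B: "finite B" and t: "0 \<le> t"
  shows "integrable (Pr \<eta>) (\<lambda>\<omega>. exclusion_generator (occupied B) (X t \<omega>))"
    "(\<integral>\<omega>. exclusion_generator (occupied B) (X t \<omega>) \<partial>Pr \<eta>) = corr_rate \<eta> t B"
proof -
  note i = integrable_occupied[OF _ t, of _ \<eta>]
  have fin: "finite (insert y (B - {x}))" for x y using B by simp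
  note i = i[OF B] i[OF fin]
  show "integrable (Pr \<eta>) (\<lambda>\<omega>. exclusion_generator (occupied B) (X t \<omega>))"
    unfolding generator_occupied[OF B]
    by (intro integrable_mult_right Bochner_Integration.integrable_sum Bochner_Integration.integrable_diff i)
  show "(\<integral>\<omega>. exclusion_generator (occupied B) (X t \<omega>) \<partial>Pr \<eta>) = corr_rate \<eta> t B"
    unfolding generator_occupied[OF B] corr_rate_def corr_def
    by (simp add: i Bochner_Integration.integral_sum)
qed

text \<open>The generator limit is uniform over configurations, so it may be applied at the random
  state \<open>X t\<close> and integrated by means of \<open>corr_add\<close>. Hence one
  \<open>\<delta>\<close> serves all times and all initial configurations.\<close>

lemma corr_increment:
  assumes B: "finite B" and e: "0 < e"
  obtains \<delta> where "0 < \<delta>"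
    "\<And>t h \<eta>. 0 \<le> t \<Longrightarrow> 0 \<le> h \<Longrightarrow> h < \<delta> \<Longrightarrow> \<bar>corr \<eta> (t + h) B - corr \<eta> t B - h * corr_rate \<eta> t B\<bar> \<le> e * h"
proof -
  from uniform_limitD[OF generator[OF local_occupied[OF B]] e]
  obtain \<delta> where \<delta>: "0 < \<delta>" "\<And>h \<xi>. 0 < h \<Longrightarrow> h < \<delta> \<Longrightarrow>
      dist ((corr \<xi> h B - occupied B \<xi>) / h) (exclusion_generator (occupied B) \<xi>) < e"
    unfolding eventually_at_right_field corr_def by auto
  show ?thesis
  proof (rule that[OF \<delta>(1)])
    fix t h :: real and \<eta> assume t: "0 \<le> t" and h: "0 \<le> h" "h < \<delta>"
    interpret prob_space "Pr \<eta>" by (rule prob_space_Pr)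
    show "\<bar>corr \<eta> (t + h) B - corr \<eta> t B - h * corr_rate \<eta> t B\<bar> \<le> e * h"
    proof (cases "h = 0")
      case False
      define f where "f \<xi> = corr \<xi> h B - occupied B \<xi> - h * exclusion_generator (occupied B) \<xi>" for \<xi>
      have f: "\<bar>f \<xi>\<bar> \<le> e * h" for \<xi>
      proof -
        have "f \<xi> = h * ((corr \<xi> h B - occupied B \<xi>) / h - exclusion_generator (occupied B) \<xi>)"
          using False by (simp add: f_def field_simps)
        then have "\<bar>f \<xi>\<bar> = h * dist ((corr \<xi> h B - occupied B \<xi>) / h) (exclusion_generator (occupied B) \<xi>)"
          using h by (simp add: abs_mult dist_real_def)
        also have "\<dots> \<le> h * e" using \<delta>(2)[of h \<xi>] h False by (intro mult_left_mono) auto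
        finally show ?thesis by (simp add: mult.commute)
      qed
      have i1: "integrable (Pr \<eta>) (\<lambda>\<omega>. corr (X t \<omega>) h B)"
        using corr_bounds[OF B h(1)]
        by (intro integrable_cont[OF continuous_corr[OF B h(1)], of 1] t) (auto simp: abs_le_iff intro: order_trans[of _ 0])
      have int: "integrable (Pr \<eta>) (\<lambda>\<omega>. f (X t \<omega>))"
        unfolding f_def by (intro Bochner_Integration.integrable_diff integrable_mult_right i1 integrable_occupied[OF B t] integral_generator[OF B t])
      have "corr \<eta> (t + h) B - corr \<eta> t B - h * corr_rate \<eta> t B = (\<integral>\<omega>. f (X t \<omega>) \<partial>Pr \<eta>)"
        unfolding f_def corr_add[OF B t h(1)]
        using i1 integrable_occupied[OF B t, of \<eta>] integral_generator[OF B t, of \<eta>]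
        by (simp add: corr_def[symmetric])
      also have "\<bar>\<dots>\<bar> \<le> (\<integral>\<omega>. \<bar>f (X t \<omega>)\<bar> \<partial>Pr \<eta>)" by (rule integral_abs_bound)
      also have "\<dots> \<le> e * h"
        using f int by (intro integral_le_const) auto
      finally show ?thesis .
    qed simp
  qed
qed

lemma corr_rate_bound:
  assumes B: "finite B"
  shows "\<exists>C. \<forall>t\<ge>0. \<forall>\<eta>. \<bar>corr_rate \<eta> t B\<bar> \<le> C"
proof (intro exI allI impI)
  fix t :: real and \<eta> assume t: "0 \<le> t"
  have "\<bar>corr_rate \<eta> t B\<bar> = 1 / (2 * real CARD('d)) *
     \<bar>\<Sum>x\<in>B. \<Sum>y\<in>nbrs x - B. corr \<eta> t (insert y (B - {x})) - corr \<eta> t B\<bar>"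
    by (simp add: corr_rate_def abs_mult)
  also have "\<dots> \<le> 1 / (2 * real CARD('d)) * (\<Sum>x\<in>B. \<Sum>y\<in>nbrs x - B. 1)"
  proof (intro mult_left_mono order_trans[OF sum_abs] sum_mono)
    fix x y assume "x \<in> B" "y \<in> nbrs x - B"
    show "\<bar>corr \<eta> t (insert y (B - {x})) - corr \<eta> t B\<bar> \<le> 1"
      using corr_bounds[of B t \<eta>] corr_bounds[of "insert y (B - {x})" t \<eta>] B t by auto
  qed auto
  finally show "\<bar>corr_rate \<eta> t B\<bar> \<le> 1 / (2 * real CARD('d)) * (\<Sum>x\<in>B. \<Sum>y\<in>nbrs x - B. 1)" .
qed

lemma corr_isCont:
  assumes B: "finite B"
  shows "continuous_on {0..} (\<lambda>t. corr \<eta> t B)"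
proof -
  obtain C where C: "\<And>t \<eta>. 0 \<le> t \<Longrightarrow> \<bar>corr_rate \<eta> t B\<bar> \<le> C" using corr_rate_bound[OF B] by blast
  obtain \<delta> where \<delta>: "0 < \<delta>"
    "\<And>t h \<eta>. 0 \<le> t \<Longrightarrow> 0 \<le> h \<Longrightarrow> h < \<delta> \<Longrightarrow> \<bar>corr \<eta> (t + h) B - corr \<eta> t B - h * corr_rate \<eta> t B\<bar> \<le> 1 * h"
    using corr_increment[OF B, of 1] by (auto simp del: mult_1)
  have C0: "0 \<le> C" using C[of 0] by (auto intro: order_trans[OF abs_ge_zero])
  have step: "\<bar>corr \<eta> (t + h) B - corr \<eta> t B\<bar> \<le> (C + 1) * h" if "0 \<le> t" "0 \<le> h" "h < \<delta>" for t h
  proof -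
    have "\<bar>h * corr_rate \<eta> t B\<bar> \<le> h * C" using C[OF that(1)] that by (simp add: abs_mult mult_left_mono)
    then show ?thesis using \<delta>(2)[OF that, of \<eta>] by (simp add: algebra_simps)
  qed
  have lip: "\<bar>corr \<eta> s B - corr \<eta> t B\<bar> \<le> (C + 1) * \<bar>s - t\<bar>" if "0 \<le> t" "0 \<le> s" "\<bar>s - t\<bar> < \<delta>" for s t
    using step[of t "s - t"] step[of s "t - s"] that by (cases "s \<le> t") (auto simp: abs_minus_commute)
  show ?thesis unfolding continuous_on_iff dist_real_def
  proof (intro ballI allI impI)
    fix t e :: real assume t: "t \<in> {0..}" and e: "0 < e"
    show "\<exists>d>0. \<forall>s\<in>{0..}. \<bar>s - t\<bar> < d \<longrightarrow> \<bar>corr \<eta> s B - corr \<eta> t B\<bar> < e"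
    proof (intro exI[of _ "min \<delta> (e / (C + 1))"] conjI ballI impI)
      fix s assume s: "s \<in> {0..}" "\<bar>s - t\<bar> < min \<delta> (e / (C + 1))"
      then have "(C + 1) * \<bar>s - t\<bar> < e" using C0 by (simp add: field_simps)
      then show "\<bar>corr \<eta> s B - corr \<eta> t B\<bar> < e" using lip[of t s] s t by auto
    qed (use \<delta> e C0 in auto)
  qed
qed

text \<open>\<open>corr_increment\<close> only looks forward in time. For \<open>s < t\<close> it is
  started at \<open>s\<close>, which produces the rate at \<open>s\<close>; continuity of the rate
  in time then replaces it by the rate at \<open>t\<close>.\<close>

theorem corr_has_derivative:
  assumes B: "finite B" and t: "0 \<le> t"
  shows "((\<lambda>t. corr \<eta> t B) has_real_derivative corr_rate \<eta> t B) (at t within {0..})"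
  unfolding has_field_derivative_iff tendsto_iff eventually_at
proof (intro allI impI)
  fix e :: real assume e: "0 < e"
  obtain \<delta> where \<delta>: "0 < \<delta>"
    "\<And>t h \<eta>. 0 \<le> t \<Longrightarrow> 0 \<le> h \<Longrightarrow> h < \<delta> \<Longrightarrow> \<bar>corr \<eta> (t + h) B - corr \<eta> t B - h * corr_rate \<eta> t B\<bar> \<le> e/3 * h"
    using corr_increment[OF B, of "e/3"] e by (auto simp del: times_divide_eq_left)
  have "continuous_on {0..} (\<lambda>t. corr_rate \<eta> t B)"
    unfolding corr_rate_def using B by (intro continuous_intros corr_isCont) auto
  then obtain \<delta>' where \<delta>': "0 < \<delta>'" "\<And>s. 0 \<le> s \<Longrightarrow> \<bar>s - t\<bar> < \<delta>' \<Longrightarrow> \<bar>corr_rate \<eta> s B - corr_rate \<eta> t B\<bar> < e/3"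
    unfolding continuous_on_iff dist_real_def using t e by (metis atLeast_iff divide_pos_pos zero_less_numeral)
  have main: "\<bar>corr \<eta> s B - corr \<eta> t B - (s - t) * corr_rate \<eta> t B\<bar> \<le> (e/3 + e/3) * \<bar>s - t\<bar>"
    if s: "0 \<le> s" "\<bar>s - t\<bar> < min \<delta> \<delta>'" for s
  proof (cases "t \<le> s")
    case True
    have "e/3 * (s - t) \<le> (e/3 + e/3) * (s - t)" using True e by (intro mult_right_mono) auto
    with \<delta>(2)[of t "s - t" \<eta>] s t True show ?thesis by auto
  next
    case False
    have a: "\<bar>corr \<eta> t B - corr \<eta> s B - (t - s) * corr_rate \<eta> s B\<bar> \<le> e/3 * (t - s)"
      using \<delta>(2)[of s "t - s" \<eta>] s False by auto
    have b: "\<bar>(t - s) * (corr_rate \<eta> s B - corr_rate \<eta> t B)\<bar> \<le> (t - s) * (e/3)"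
      unfolding abs_mult using \<delta>'(2)[of s] s False by (intro mult_mono) auto
    have "corr \<eta> s B - corr \<eta> t B - (s - t) * corr_rate \<eta> t B =
       - (corr \<eta> t B - corr \<eta> s B - (t - s) * corr_rate \<eta> s B) - (t - s) * (corr_rate \<eta> s B - corr_rate \<eta> t B)"
      by (simp add: algebra_simps)
    then have "\<bar>corr \<eta> s B - corr \<eta> t B - (s - t) * corr_rate \<eta> t B\<bar> \<le> e/3 * (t - s) + (t - s) * (e/3)"
      using a b by linarith
    then show ?thesis using False by (simp add: algebra_simps)
  qed
  show "\<exists>d>0. \<forall>s\<in>{0..}. s \<noteq> t \<and> dist s t < d \<longrightarrow>
      dist ((corr \<eta> s B - corr \<eta> t B) / (s - t)) (corr_rate \<eta> t B) < e"
  proof (intro exI[of _ "min \<delta> \<delta>'"] conjI ballI impI)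
    fix s assume s: "s \<in> {0..}" "s \<noteq> t \<and> dist s t < min \<delta> \<delta>'"
    have "(corr \<eta> s B - corr \<eta> t B) / (s - t) - corr_rate \<eta> t B =
       (corr \<eta> s B - corr \<eta> t B - (s - t) * corr_rate \<eta> t B) / (s - t)"
      using s by (simp add: field_simps)
    then have "dist ((corr \<eta> s B - corr \<eta> t B) / (s - t)) (corr_rate \<eta> t B) =
      \<bar>corr \<eta> s B - corr \<eta> t B - (s - t) * corr_rate \<eta> t B\<bar> / \<bar>s - t\<bar>"
      by (simp add: dist_real_def)
    also have "\<dots> \<le> e/3 + e/3"
      using main[of s] s by (simp add: dist_real_def divide_le_eq)
    also have "\<dots> < e" using e by simp
    finally show "dist ((corr \<eta> s B - corr \<eta> t B) / (s - t)) (corr_rate \<eta> t B) < e" .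
  qed (use \<delta> \<delta>' in auto)
qed

end

section \<open>The random walk kernel\<close>

lemma pmf_has_sum:
  fixes f :: "'a \<Rightarrow> real"
  assumes f: "\<And>x. \<bar>f x\<bar> \<le> C"
  shows "((\<lambda>x. pmf M x * f x) has_sum measure_pmf.expectation M f) UNIV"
proof -
  have "Infinite_Set_Sum.abs_summable_on (\<lambda>x. pmf M x * C) UNIV"
    by (intro Infinite_Set_Sum.abs_summable_on_cmult_left pmf_abs_summable)
  then have s: "Infinite_Set_Sum.abs_summable_on (\<lambda>x. pmf M x * f x) UNIV"
    by (rule Infinite_Set_Sum.abs_summable_on_comparison_test)
       (use f in \<open>auto simp: abs_mult intro!: mult_mono order_trans[OF f abs_ge_self]\<close>)
  have "measure_pmf.expectation M f = infsum (\<lambda>x. pmf M x * f x) UNIV"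
    unfolding pmf_expectation_eq_infsetsum by (rule infsetsum_infsum[OF s])
  moreover have "(\<lambda>x. pmf M x * f x) summable_on UNIV"
    using s by (simp add: abs_summable_equivalent[symmetric] abs_summable_summable)
  ultimately show ?thesis by (metis has_sum_infsum)
qed

lemma abs_expectation_le:
  fixes f :: "'a \<Rightarrow> real"
  assumes f: "\<And>x. \<bar>f x\<bar> \<le> C"
  shows "\<bar>measure_pmf.expectation M f\<bar> \<le> C"
proof -
  have "\<bar>measure_pmf.expectation M f\<bar> \<le> measure_pmf.expectation M (\<lambda>x. \<bar>f x\<bar>)"
    by (rule integral_abs_bound)
  also have "\<dots> \<le> C"
    by (intro measure_pmf.integral_le_const measure_pmf.integrable_const_bound[of _ C]) (auto simp: f)
  finally show ?thesis .
qed

lemma expectation_bind_pmf: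
  fixes f :: "'b \<Rightarrow> real"
  assumes f: "\<And>n. \<bar>f n\<bar> \<le> C"
  shows "measure_pmf.expectation (bind_pmf M N) f = measure_pmf.expectation M (\<lambda>x. measure_pmf.expectation (N x) f)"
  unfolding measure_pmf_bind
  by (rule integral_bind[where K="count_space UNIV" and B=C and B'=1])
     (auto simp: f measurable_measure_pmf[simplified] measure_pmf_in_subprob_algebra measure_pmf.emeasure_space_1 measure_pmf.finite_measure_axioms)

lemma srw_expectation_Suc:
  fixes f :: "int \<Rightarrow> real"
  assumes f: "\<And>n. \<bar>f n\<bar> \<le> C"
  shows "measure_pmf.expectation (srw_pmf j (Suc k)) f =
    (measure_pmf.expectation (srw_pmf j k) (\<lambda>n. f (n - 1)) + measure_pmf.expectation (srw_pmf j k) (\<lambda>n. f (n + 1))) / 2"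
proof -
  have int: "integrable (measure_pmf M) (\<lambda>n. f (n + m))" for M m
    by (rule measure_pmf.integrable_const_bound[of _ C]) (auto simp: f)
  have "measure_pmf.expectation (srw_pmf j (Suc k)) f =
    measure_pmf.expectation (srw_pmf j k) (\<lambda>n. measure_pmf.expectation (pmf_of_set {n - 1, n + 1}) f)"
    by (simp add: expectation_bind_pmf[OF f])
  also have "\<dots> = measure_pmf.expectation (srw_pmf j k) (\<lambda>n. (f (n - 1) + f (n + 1)) / 2)"
    by (intro Bochner_Integration.integral_cong refl) (auto simp: integral_pmf_of_set)
  finally show ?thesis
    using int[of "srw_pmf j k" "-1"] int[of "srw_pmf j k" 1] by (simp add: Bochner_Integration.integral_add)
qed

section \<open>Square-root decay of the discrete-time kernel\<close>

lemma pmf_srw_Suc: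
  "pmf (srw_pmf j (Suc k)) n = (pmf (srw_pmf j k) (n - 1) + pmf (srw_pmf j k) (n + 1)) / 2"
proof -
  have "(\<lambda>m. indicator {n} (m - 1) :: real) = indicator {n + 1}" "(\<lambda>m. indicator {n} (m + 1) :: real) = indicator {n - 1}"
    by (auto simp: indicator_def fun_eq_iff)
  moreover have "measure_pmf.expectation M (indicator {n}) = pmf M n" for M :: "int pmf" and n
    by (simp add: measure_pmf_single)
  ultimately show ?thesis
    using srw_expectation_Suc[of "indicator {n}" 1 j k] by (simp only: indicator_abs_le_1 add.commute)
qed

lemma pmf_srw_binomial:
  "pmf (srw_pmf 0 k) n =
     (if even (n + int k) \<and> 0 \<le> n + int k then real (k choose nat ((n + int k) div 2)) / 2 ^ k else 0)"
proof (induction k arbitrary: n)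
  case 0
  then show ?case by (auto simp: pmf_return indicator_def elim!: evenE)
next
  case (Suc k)
  show ?case
  proof (cases "even (n + int (Suc k)) \<and> 0 \<le> n + int (Suc k)")
    case True
    then obtain j' where j': "n + int (Suc k) = 2 * j'" by (blast elim: evenE)
    with True obtain j where j: "n + int (Suc k) = 2 * int j" by (cases j' rule: int_cases) auto
    then have n: "n = 2 * int j - int k - 1" by simp
    have 1: "n - 1 + int k = 2 * (int j - 1)" "n + 1 + int k = 2 * int j" using n by auto
    have "pmf (srw_pmf 0 k) (n + 1) = real (k choose j) / 2 ^ k"
      unfolding Suc 1 by simp
    moreover have "pmf (srw_pmf 0 k) (n - 1) = (if j = 0 then 0 else real (k choose (j - 1)) / 2 ^ k)"
      unfolding Suc 1 by (auto simp: nat_diff_distrib)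
    moreover have "pmf (srw_pmf 0 (Suc k)) n = (pmf (srw_pmf 0 k) (n - 1) + pmf (srw_pmf 0 k) (n + 1)) / 2"
      by (rule pmf_srw_Suc)
    ultimately have "pmf (srw_pmf 0 (Suc k)) n = real (Suc k choose j) / 2 ^ Suc k"
      by (cases j) (simp_all add: add_divide_distrib del: srw_pmf.simps)
    moreover have "nat ((n + int (Suc k)) div 2) = j" using j by simp
    ultimately show ?thesis by (simp only: if_P[OF True])
  next
    case False
    moreover have "even (n - 1 + int k) = even (n + int (Suc k))" "even (n + 1 + int k) = even (n + int (Suc k))"
      by auto
    moreover have "\<not> 0 \<le> n - 1 + int k \<or> odd (n - 1 + int k)" "\<not> 0 \<le> n + 1 + int k \<or> odd (n + 1 + int k)"
      using False by (auto)
    ultimately have "pmf (srw_pmf 0 k) (n - 1) = 0" "pmf (srw_pmf 0 k) (n + 1) = 0"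
      unfolding Suc by auto
    then show ?thesis using False by (simp only: pmf_srw_Suc if_False) simp
  qed
qed

text \<open>Consecutive terms have ratio \<open>(2 * m + 1) / (2 * m + 2)\<close>, and
  \<open>(2 * m + 1) * (2 * m + 3) \<le> (2 * m + 2)^2\<close> closes the induction.\<close>

lemma central_binomial_upper_bound: "real ((2 * m) choose m) / 4 ^ m \<le> 1 / sqrt (2 * m + 1)"
proof (induction m)
  case (Suc m)
  have id: "real ((2 * Suc m) choose Suc m) * (m + 1) = real ((2 * m) choose m) * (2 * (2 * m + 1))"
  proof -
    define a where "a = real m + 1"
    have a: "a \<noteq> 0" unfolding a_def by linarith
    have f: "fact (Suc m) = a * fact m" "fact (Suc (Suc (2 * m))) = 2 * a * ((2 * real m + 1) * fact (2 * m))"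
      by (simp_all add: a_def algebra_simps)
    have "real ((2 * Suc m) choose Suc m) = fact (Suc (Suc (2 * m))) / (fact (Suc m) * fact (Suc m))"
      by (subst binomial_fact) auto
    moreover have "real ((2 * m) choose m) = fact (2 * m) / (fact m * fact m)"
      by (subst binomial_fact) auto
    ultimately have "real ((2 * Suc m) choose Suc m) * a = real ((2 * m) choose m) * (2 * (2 * real m + 1))"
      unfolding f using a by (simp only:) (simp add: divide_simps)
    then show ?thesis by (simp add: a_def add.commute del: binomial_Suc_Suc)
  qed
  have "P / (4 * F) = Q / F * ((2 * m + 1) / (2 * m + 2))"
    if "P * (m + 1) = Q * (2 * (2 * m + 1))" for P Q F :: real
  proof -
    have "P = Q * (2 * (2 * m + 1)) / (m + 1)" using that by (subst eq_divide_eq) auto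
    then have "P / (4 * F) = (Q * (2 * (2 * m + 1)) / (m + 1)) / (4 * F)" by (simp only:)
    also have "\<dots> = Q / F * ((2 * m + 1) / (2 * m + 2))" by (simp add: divide_simps) (simp add: algebra_simps)
    finally show ?thesis .
  qed
  from this[OF id, of "4 ^ m"] have "real ((2 * Suc m) choose Suc m) / 4 ^ Suc m =
        real ((2 * m) choose m) / 4 ^ m * ((2 * m + 1) / (2 * m + 2))"
    by (simp only: power_Suc)
  also have "\<dots> \<le> 1 / sqrt (2 * m + 1) * ((2 * m + 1) / (2 * m + 2))"
    by (intro mult_right_mono Suc) auto
  also have "\<dots> \<le> 1 / sqrt (2 * Suc m + 1)"
  proof -
    have "1 / sqrt (2 * m + 1) * ((2 * m + 1) / (2 * m + 2)) = real (2 * m + 1) / sqrt (real (2 * m + 1)) / (2 * m + 2)"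
      by simp
    also have "\<dots> = sqrt (2 * m + 1) / (2 * m + 2)" by (simp only: real_div_sqrt of_nat_0_le_iff)
    also have "\<dots> \<le> 1 / sqrt (2 * Suc m + 1)"
    proof -
      have "sqrt (2 * m + 1) * sqrt (2 * Suc m + 1) = sqrt ((2 * m + 1) * (2 * m + 3))"
        by (simp add: real_sqrt_mult[symmetric] algebra_simps)
      also have "\<dots> \<le> 2 * m + 2"
        by (rule real_le_lsqrt) (auto simp: power2_eq_square algebra_simps)
      finally show ?thesis by (simp add: field_simps)
    qed
    finally show ?thesis .
  qed
  finally show ?case .
qed simp

text \<open>Even times are bounded by the central coefficient; a value at an odd time is an average
  of two values at the preceding even time. The numerator 2 absorbs this loss of one step.\<close>

lemma pmf_srw_le: "pmf (srw_pmf 0 k) n \<le> sqrt (2 / (k + 1))"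
proof -
  have even: "pmf (srw_pmf 0 (2 * m)) n \<le> 1 / sqrt (real (2 * m) + 1)" for m n
  proof -
    have "pmf (srw_pmf 0 (2 * m)) n \<le> real ((2 * m) choose m) / 2 ^ (2 * m)"
      unfolding pmf_srw_binomial using binomial_maximum[of "2 * m"]
      by (auto intro!: divide_right_mono)
    also have "\<dots> \<le> 1 / sqrt (real (2 * m) + 1)" using central_binomial_upper_bound[of m] by (simp add: power_mult add.commute)
    finally show ?thesis .
  qed
  have odd: "pmf (srw_pmf 0 (2 * m + 1)) n \<le> 1 / sqrt (real (2 * m) + 1)" for m n
    using pmf_srw_Suc[of 0 "2 * m" n] even[of m "n - 1"] even[of m "n + 1"] by simp
  have le: "pmf (srw_pmf 0 k) n \<le> 1 / sqrt (real (2 * (k div 2)) + 1)"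
  proof (cases "even k")
    case True
    then have "2 * (k div 2) = k" by simp
    then show ?thesis using even[of "k div 2" n] by (simp add: add.commute)
  next
    case False
    then have "2 * (k div 2) + 1 = k" by presburger
    then show ?thesis using odd[of "k div 2" n] by (simp only:)
  qed
  also have "1 / sqrt (real (2 * (k div 2)) + 1) = sqrt (1 / (real (2 * (k div 2)) + 1))" by (simp add: real_sqrt_divide)
  also have "\<dots> \<le> sqrt (2 / (real k + 1))"
  proof (rule real_sqrt_le_mono)
    have "k + 1 \<le> 2 * (2 * (k div 2) + 1)" by presburger
    then have "real (k + 1) \<le> real (2 * (2 * (k div 2) + 1))" by linarith
    then show "1 / (real (2 * (k div 2)) + 1) \<le> 2 / (real k + 1)" by (simp add: divide_simps)
  qed
  finally show ?thesis by simp
qed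

section \<open>Continuous-time kernel on the integers: evolution equation, tails, decay and
  convolution\<close>

definition walk :: "real \<Rightarrow> int \<Rightarrow> real" where
  "walk s n = pmf (ctrw_pmf 0 s) n"

lemma walk_nonneg [simp]: "0 \<le> walk s n"
  and walk_le_1 [simp]: "walk s n \<le> 1"
  by (simp_all add: walk_def pmf_le_1)

lemma walk_0: "walk 0 n = of_bool (n = 0)"
  by (auto simp: walk_def ctrw_pmf_def pmf_return indicator_def)

text \<open>Without the Poisson normalisation the expectation is an everywhere convergent power
  series in \<open>s\<close>, ready for termwise differentiation.\<close>

lemma walk_expectation_series:
  fixes f :: "int \<Rightarrow> real"
  assumes f: "\<And>n. \<bar>f n\<bar> \<le> C" and s: "0 \<le> s"
  shows "(\<lambda>k. measure_pmf.expectation (srw_pmf 0 k) f * (s ^ k / fact k)) sums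
    (exp s * measure_pmf.expectation (ctrw_pmf 0 s) f)"
proof (cases "s = 0")
  case True
  have "(\<lambda>k. measure_pmf.expectation (srw_pmf 0 k) f * (0 ^ k / fact k)) sums
      (\<Sum>k\<in>{0}. measure_pmf.expectation (srw_pmf 0 k) f * (0 ^ k / fact k))"
    by (intro sums_finite) auto
  then show ?thesis using True by (simp add: ctrw_pmf_def)
next
  case False
  then have s: "0 < s" using assms by simp
  define c where "c k = measure_pmf.expectation (srw_pmf 0 k) f" for k
  have c: "\<bar>c k\<bar> \<le> C" for k
    unfolding c_def by (rule abs_expectation_le[OF f])
  have "measure_pmf.expectation (ctrw_pmf 0 s) f = measure_pmf.expectation (poisson_pmf s) c"
    using s unfolding c_def ctrw_pmf_def by (simp add: expectation_bind_pmf[OF f])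
  moreover have "((\<lambda>k. pmf (poisson_pmf s) k * c k) has_sum measure_pmf.expectation (poisson_pmf s) c) UNIV"
    by (rule pmf_has_sum) (rule c)
  ultimately have "(\<lambda>k. pmf (poisson_pmf s) k * c k) sums measure_pmf.expectation (ctrw_pmf 0 s) f"
    by (simp only: has_sum_imp_sums)
  then have "(\<lambda>k. exp s * (pmf (poisson_pmf s) k * c k)) sums (exp s * measure_pmf.expectation (ctrw_pmf 0 s) f)"
    by (rule sums_mult)
  moreover have "exp s * (pmf (poisson_pmf s) k * c k) = c k * (s ^ k / fact k)" for k
    using s exp_minus_inverse[of s] by (simp add: field_simps)
  ultimately show ?thesis by (simp add: c_def)
qed

text \<open>Differentiating the power series advances the number of jumps by one, and one more jump
  averages the two shifts of \<open>f\<close>; the derivative of \<open>exp (- s)\<close> supplies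
  the remaining \<open>- E s f\<close>.\<close>

lemma walk_expectation_has_derivative:
  fixes f :: "int \<Rightarrow> real"
  assumes f: "\<And>n. \<bar>f n\<bar> \<le> C" and s: "0 \<le> s"
  defines "E \<equiv> (\<lambda>s. measure_pmf.expectation (ctrw_pmf 0 s))"
  shows "((\<lambda>s. E s f) has_real_derivative
      ((E s (\<lambda>n. f (n - 1)) + E s (\<lambda>n. f (n + 1))) / 2 - E s f)) (at s within {0..})"
proof -
  define c where "c k = measure_pmf.expectation (srw_pmf 0 k) f / fact k" for k
  have summ: "summable (\<lambda>k. c k * y ^ k)" for y
  proof -
    have "\<bar>measure_pmf.expectation (srw_pmf 0 k) f\<bar> \<le> C" for k
      by (rule abs_expectation_le[OF f])
    then have "norm (c k * y ^ k) \<le> C * (\<bar>y\<bar> ^ k / fact k)" for k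
      by (auto simp: c_def abs_mult power_abs intro!: divide_right_mono mult_right_mono)
    moreover have "summable (\<lambda>k. C * (\<bar>y\<bar> ^ k / fact k))"
      using summable_exp[of "\<bar>y\<bar>"] by (intro summable_mult) (simp add: field_simps)
    ultimately show ?thesis by (intro summable_comparison_test'[where f="\<lambda>k. c k * y ^ k" and N=0]) auto
  qed
  have d: "((\<lambda>x. \<Sum>k. c k * x ^ k) has_real_derivative (\<Sum>k. diffs c k * s ^ k)) (at s)"
    by (rule termdiffs_strong_converges_everywhere[OF summ])
  have eq: "E x f = exp (- x) * (\<Sum>k. c k * x ^ k)" if "0 \<le> x" for x
  proof -
    have "exp x * E x f = (\<Sum>k. c k * x ^ k)"
      using sums_unique[OF walk_expectation_series[OF f that]] by (simp add: c_def E_def)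
    moreover have "exp (- x) * (exp x * E x f) = E x f"
      by (simp add: mult.assoc[symmetric] mult_exp_exp)
    ultimately show ?thesis by simp
  qed
  let ?e = "\<lambda>k. measure_pmf.expectation (srw_pmf 0 k)"
  have "(\<lambda>k. (?e k (\<lambda>n. f (n - 1)) * (s ^ k / fact k) + ?e k (\<lambda>n. f (n + 1)) * (s ^ k / fact k)) / 2)
     sums ((exp s * E s (\<lambda>n. f (n - 1)) + exp s * E s (\<lambda>n. f (n + 1))) / 2)"
    unfolding E_def by (intro sums_divide sums_add walk_expectation_series[where C=C] f s)
  moreover have "diffs c k * s ^ k = (?e k (\<lambda>n. f (n - 1)) * (s ^ k / fact k) + ?e k (\<lambda>n. f (n + 1)) * (s ^ k / fact k)) / 2" for k
  proof -
    have "diffs c k = ?e (Suc k) f / fact k"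
      by (simp add: diffs_def c_def field_simps del: of_nat_Suc srw_pmf.simps)
    then show ?thesis by (simp add: srw_expectation_Suc[OF f] field_simps del: srw_pmf.simps)
  qed
  ultimately have "(\<lambda>k. diffs c k * s ^ k) sums ((exp s * E s (\<lambda>n. f (n - 1)) + exp s * E s (\<lambda>n. f (n + 1))) / 2)"
    by (simp only:)
  from sums_unique[OF this]
  have d2: "(\<Sum>k. diffs c k * s ^ k) = exp s * ((E s (\<lambda>n. f (n - 1)) + E s (\<lambda>n. f (n + 1))) / 2)"
    by (simp add: distrib_left)
  have "((\<lambda>x. exp (- x) * (\<Sum>k. c k * x ^ k)) has_real_derivative
      (- exp (- s) * (\<Sum>k. c k * s ^ k) + exp (- s) * (\<Sum>k. diffs c k * s ^ k))) (at s within {0..})"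
    by (rule derivative_eq_intros has_field_derivative_at_within[OF d] refl | simp)+
  also have "- exp (- s) * (\<Sum>k. c k * s ^ k) + exp (- s) * (\<Sum>k. diffs c k * s ^ k) =
      (E s (\<lambda>n. f (n - 1)) + E s (\<lambda>n. f (n + 1))) / 2 - E s f"
  proof -
    have "exp (- s) * (exp s * X) = X" for X :: real
      by (simp add: mult.assoc[symmetric] mult_exp_exp)
    then show ?thesis unfolding d2 by (simp add: eq[OF s])
  qed
  finally show ?thesis
    by (rule has_field_derivative_transform_within[OF _ zero_less_one]) (use s eq in auto)
qed

lemma walk_series: "0 \<le> s \<Longrightarrow> (\<lambda>k. pmf (srw_pmf 0 k) n * (s ^ k / fact k)) sums (exp s * walk s n)"
  using walk_expectation_series[of "indicator {n}" 1 s] by (simp add: walk_def measure_pmf_single)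

lemma walk_expectation_indicator:
  "measure_pmf.expectation (ctrw_pmf 0 s) (indicator {n}) = walk s n"
  by (simp add: walk_def measure_pmf_single)

lemma walk_has_derivative:
  assumes s: "0 \<le> s"
  shows "((\<lambda>s. walk s n) has_real_derivative ((walk s (n - 1) + walk s (n + 1)) / 2 - walk s n)) (at s within {0..})"
proof -
  have "(\<lambda>m. indicator {n} (m - 1) :: real) = indicator {n + 1}" "(\<lambda>m. indicator {n} (m + 1) :: real) = indicator {n - 1}"
    by (auto simp: indicator_def fun_eq_iff)
  then show ?thesis
    using walk_expectation_has_derivative[of "indicator {n}" 1 s] s
    by (simp only: walk_expectation_indicator indicator_abs_le_1 add.commute)
qed

definition tail :: "real \<Rightarrow> int \<Rightarrow> real" where
  "tail s n = measure_pmf.expectation (ctrw_pmf 0 s) (indicator {n..})"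

lemma tail_bounds: "0 \<le> tail s n" "tail s n \<le> 1"
  by (auto simp: tail_def)

lemma tail_0: "tail 0 n = of_bool (n \<le> 0)"
  by (simp add: tail_def ctrw_pmf_def indicator_def)

lemma tail_diff: "tail s n - tail s (n + 1) = walk s n"
proof -
  have int: "integrable (measure_pmf M) (indicator A :: int \<Rightarrow> real)" for M A
    by (rule measure_pmf.integrable_const_bound[of _ 1]) (auto simp: indicator_def)
  have "tail s n - tail s (n + 1) =
      measure_pmf.expectation (ctrw_pmf 0 s) (\<lambda>m. indicator {n..} m - indicator {n + 1..} m)"
    unfolding tail_def by (subst Bochner_Integration.integral_diff[OF int int]) simp
  also have "(\<lambda>m. indicator {n..} m - indicator {n + 1..} m :: real) = indicator {n}"
    by (auto simp: fun_eq_iff indicator_def)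
  finally show ?thesis by (simp only: walk_expectation_indicator)
qed

lemma tail_has_derivative:
  assumes s: "0 \<le> s"
  shows "((\<lambda>s. tail s n) has_real_derivative ((tail s (n - 1) + tail s (n + 1)) / 2 - tail s n)) (at s within {0..})"
proof -
  have "(\<lambda>m. indicator {n..} (m - 1) :: real) = indicator {n + 1..}" "(\<lambda>m. indicator {n..} (m + 1) :: real) = indicator {n - 1..}"
    by (auto simp: indicator_def fun_eq_iff)
  then show ?thesis
    using walk_expectation_has_derivative[of "indicator {n..}" 1 s] s
    unfolding tail_def by (simp only: indicator_abs_le_1 add.commute)
qed

text \<open>The discrete bound is of order \<open>(k + 1)^(-1/2)\<close>, whose Poisson mean is not
  explicit. The arithmetic-geometric mean inequality, weighted with the target value
  \<open>l\<close>, trades it for the mean of \<open>1 / (k + 1)\<close>, which is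
  \<open>(1 - exp (- s)) / s\<close>.\<close>

lemma walk_le:
  assumes s: "0 \<le> s"
  shows "walk s n \<le> 2 / sqrt (1 + s)"
proof (cases "s = 0")
  case True
  then show ?thesis by (simp add: walk_0)
next
  case False
  then have s: "0 < s" using s by simp
  \<comment> \<open>\<open>l\<close> is the bound to be proved; with this weight each of the two
    terms of the inequality contributes at most \<open>exp s * l / 2\<close>.\<close>
  define l where "l = 2 / sqrt (1 + s)"
  have l: "0 < l" "l * l = 4 / (1 + s)" using s by (auto simp: l_def)
  have amgm: "pmf (srw_pmf 0 k) n \<le> (l + 2 / (real k + 1) / l) / 2" for k
  proof -
    define c where "c = pmf (srw_pmf 0 k) n"
    have "c * c \<le> sqrt (2 / (real k + 1)) * sqrt (2 / (real k + 1))"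
      unfolding c_def by (rule mult_mono[OF pmf_srw_le pmf_srw_le]) simp_all
    also have "\<dots> = 2 / (real k + 1)" by simp
    finally have cc: "c * c \<le> 2 / (real k + 1)" .
    have "0 \<le> (l - c) * (l - c)" by simp
    moreover have "(l - c) * (l - c) = l * l - 2 * (l * c) + c * c" by (simp add: algebra_simps)
    ultimately have "2 * (l * c) \<le> l * l + 2 / (real k + 1)" using cc by linarith
    then have "c \<le> (l * l + 2 / (real k + 1)) / (2 * l)"
      using l by (subst pos_le_divide_eq) (auto simp: mult_ac)
    also have "\<dots> = (l + 2 / (real k + 1) / l) / 2"
      using l(1) by (simp add: add_divide_distrib mult_ac)
    finally show ?thesis unfolding c_def .
  qed
  have e1: "(\<lambda>k. s ^ k / fact k) sums exp s" using exp_converges[of s] by (simp add: field_simps)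
  have "(\<lambda>k. s ^ Suc k / fact (Suc k)) sums (exp s - 1)"
    using sums_split_initial_segment[OF e1, of 1] by simp
  then have "(\<lambda>k. s ^ Suc k / fact (Suc k) / s) sums ((exp s - 1) / s)" by (rule sums_divide)
  moreover have "s ^ Suc k / fact (Suc k) / s = 1 / (real k + 1) * (s ^ k / fact k)" for k
    using s by (simp add: divide_simps)
  ultimately have e2: "(\<lambda>k. 1 / (real k + 1) * (s ^ k / fact k)) sums ((exp s - 1) / s)" by (simp only:)
  have "(\<lambda>k. l / 2 * (s ^ k / fact k) + 1 / l * (1 / (real k + 1) * (s ^ k / fact k))) sums
     (l / 2 * exp s + 1 / l * ((exp s - 1) / s))"
    by (intro sums_add sums_mult e1 e2)
  moreover have "l / 2 * (s ^ k / fact k) + 1 / l * (1 / (real k + 1) * (s ^ k / fact k))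
     = (l + 2 / (real k + 1) / l) / 2 * (s ^ k / fact k)" for k
    by (simp add: algebra_simps)
  ultimately have e3: "(\<lambda>k. (l + 2 / (real k + 1) / l) / 2 * (s ^ k / fact k)) sums
     (l / 2 * exp s + 1 / l * ((exp s - 1) / s))" by (simp only:)
  have "exp s * walk s n \<le> l / 2 * exp s + 1 / l * ((exp s - 1) / s)"
    by (rule sums_le[OF _ walk_series[of s n] e3]) (rule mult_right_mono[OF amgm], use s in auto)
  also have "(exp s - 1) / s \<le> exp s * (2 / (1 + s))"
  proof (cases "s \<le> 1")
    case True
    have "1 + - s \<le> exp (- s)" by (rule exp_ge_add_one_self)
    then have "exp s * (1 - s) \<le> exp s * exp (- s)" by (intro mult_left_mono) auto
    then have "exp s - 1 \<le> exp s * s" by (simp add: exp_minus field_simps)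
    then have "(exp s - 1) / s \<le> exp s" using s by (simp add: field_simps)
    also have "\<dots> \<le> exp s * (2 / (1 + s))" using True s by (simp add: field_simps)
    finally show ?thesis .
  next
    case False
    have "(exp s - 1) / s \<le> exp s / s" using s by (intro divide_right_mono) auto
    also have "\<dots> \<le> exp s * (2 / (1 + s))" using False by (simp add: field_simps)
    finally show ?thesis .
  qed
  then have "l / 2 * exp s + 1 / l * ((exp s - 1) / s) \<le> l / 2 * exp s + 1 / l * (exp s * (2 / (1 + s)))"
    using l by (intro add_left_mono mult_left_mono) auto
  also have "\<dots> = exp s * l"
  proof -
    have "2 / (1 + s) = (4 / (1 + s)) / 2" using s by (simp add: field_simps)
    then have "2 / (1 + s) = l * l / 2" by (simp only: l(2))
    then have "1 / l * (exp s * (2 / (1 + s))) = 1 / l * (exp s * (l * l / 2))" by (simp only:)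
    also have "\<dots> = exp s * (l / 2)" using l(1) by simp
    finally have *: "1 / l * (exp s * (2 / (1 + s))) = exp s * (l / 2)" .
    show ?thesis unfolding * by simp
  qed
  finally show ?thesis
    using exp_gt_zero[of s] by (simp only: l_def mult_le_cancel_left_pos)
qed

lemma srw_pmf_shift: "srw_pmf j k = map_pmf ((+) j) (srw_pmf 0 k)"
proof (induction k)
  case (Suc k)
  have "map_pmf ((+) j) (pmf_of_set {i - 1, i + 1}) = pmf_of_set {j + i - 1, j + i + 1}" for i :: int
    by (subst map_pmf_of_set_inj) (auto simp: algebra_simps)
  then show ?case
    by (simp add: Suc map_bind_pmf bind_map_pmf)
qed simp

lemma srw_pmf_add: "srw_pmf j (m + n) = bind_pmf (srw_pmf j m) (\<lambda>k. srw_pmf k n)"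
  by (induction n) (auto simp: bind_assoc_pmf bind_return_pmf')

lemma poisson_pmf_add:
  assumes "0 < s" "0 < t"
  shows "poisson_pmf (s + t) = bind_pmf (poisson_pmf s) (\<lambda>i. map_pmf ((+) i) (poisson_pmf t))"
proof (rule pmf_eqI)
  fix n
  have m: "pmf (map_pmf ((+) i) (poisson_pmf t)) n = (if i \<le> n then pmf (poisson_pmf t) (n - i) else 0)" for i
  proof (cases "i \<le> n")
    case True
    then have "n = i + (n - i)" by simp
    then have "pmf (map_pmf ((+) i) (poisson_pmf t)) n = pmf (map_pmf ((+) i) (poisson_pmf t)) (i + (n - i))" by simp
    also have "\<dots> = pmf (poisson_pmf t) (n - i)" by (rule pmf_map_inj') (auto simp: inj_def)
    finally show ?thesis using True by simp
  next
    case False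
    then show ?thesis by (auto simp: pmf_eq_0_set_pmf)
  qed
  have "pmf (bind_pmf (poisson_pmf s) (\<lambda>i. map_pmf ((+) i) (poisson_pmf t))) n =
    measure_pmf.expectation (poisson_pmf s) (\<lambda>i. if i \<le> n then pmf (poisson_pmf t) (n - i) else 0)"
    by (simp only: pmf_bind m)
  also have "\<dots> = (\<Sum>i\<le>n. pmf (poisson_pmf s) i * pmf (poisson_pmf t) (n - i))"
    by (subst integral_measure_pmf_real[of "{..n}"]) (auto split: if_splits simp: mult.commute)
  also have "\<dots> = (\<Sum>i\<le>n. exp (- (s + t)) / fact n * ((n choose i) * s ^ i * t ^ (n - i)))"
  proof (intro sum.cong refl)
    fix i assume "i \<in> {..n}"
    moreover have "exp (- (s + t)) = exp (- s) * exp (- t)" by (simp add: mult_exp_exp)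
    ultimately show "pmf (poisson_pmf s) i * pmf (poisson_pmf t) (n - i) =
        exp (- (s + t)) / fact n * (real (n choose i) * s ^ i * t ^ (n - i))"
      using assms by (simp only: pmf_poisson) (simp add: binomial_fact field_simps)
  qed
  also have "\<dots> = exp (- (s + t)) / fact n * (s + t) ^ n"
    by (simp only: sum_distrib_left[symmetric] binomial_ring)
  finally show "pmf (poisson_pmf (s + t)) n = pmf (bind_pmf (poisson_pmf s) (\<lambda>i. map_pmf ((+) i) (poisson_pmf t))) n"
    using assms by simp
qed

lemma ctrw_pmf_add:
  assumes "0 \<le> s" "0 \<le> t"
  shows "ctrw_pmf 0 (s + t) = bind_pmf (ctrw_pmf 0 s) (\<lambda>k. map_pmf ((+) k) (ctrw_pmf 0 t))"
proof (cases "s = 0 \<or> t = 0")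
  case True
  moreover have "(+) (0::int) = id" by auto
  ultimately show ?thesis by (auto simp: ctrw_pmf_def bind_return_pmf bind_return_pmf')
next
  case False
  then have st: "0 < s" "0 < t" "0 < s + t" using assms by auto
  have "ctrw_pmf 0 (s + t) = bind_pmf (poisson_pmf s) (\<lambda>i. bind_pmf (poisson_pmf t) (\<lambda>j. bind_pmf (srw_pmf 0 i) (\<lambda>k. srw_pmf k j)))"
    using st by (simp add: ctrw_pmf_def poisson_pmf_add bind_assoc_pmf bind_map_pmf srw_pmf_add)
  also have "\<dots> = bind_pmf (poisson_pmf s) (\<lambda>i. bind_pmf (srw_pmf 0 i) (\<lambda>k. bind_pmf (poisson_pmf t) (\<lambda>j. srw_pmf k j)))"
    by (subst bind_commute_pmf) simp
  also have "\<dots> = bind_pmf (ctrw_pmf 0 s) (\<lambda>k. map_pmf ((+) k) (ctrw_pmf 0 t))"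
    using st by (simp add: ctrw_pmf_def bind_assoc_pmf map_bind_pmf srw_pmf_shift[symmetric])
  finally show ?thesis .
qed

lemma walk_add_has_sum:
  assumes "0 \<le> s" "0 \<le> t"
  shows "((\<lambda>k. walk s k * walk t (n - k)) has_sum walk (s + t) n) UNIV"
proof -
  have "pmf (map_pmf ((+) k) (ctrw_pmf 0 t)) n = walk t (n - k)" for k
    using pmf_map_inj'[of "(+) k" "ctrw_pmf 0 t" "n - k"] by (simp add: walk_def inj_def)
  then have "walk (s + t) n = measure_pmf.expectation (ctrw_pmf 0 s) (\<lambda>k. walk t (n - k))"
    unfolding walk_def[of "s + t"] ctrw_pmf_add[OF assms] pmf_bind by simp
  then show ?thesis
    using pmf_has_sum[of "\<lambda>k. walk t (n - k)" 1 "ctrw_pmf 0 s"] by (simp add: walk_def[of s])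
qed

section \<open>The heat kernel of the lattice as a product of one-dimensional kernels\<close>

definition heat :: "real \<Rightarrow> 'd::finite site \<Rightarrow> real" where
  "heat t x = (\<Prod>i\<in>UNIV. walk (t / real CARD('d)) (x $ i))"

lemma heat_nonneg [simp]: "0 \<le> heat t x"
  by (simp add: heat_def prod_nonneg)

lemma heat_le_1: "heat t x \<le> 1"
  by (simp add: heat_def prod_le_1)

lemma heat_0: "heat 0 x = of_bool (x = 0)"
  by (auto simp: heat_def walk_0 vec_eq_iff)

text \<open>\<open>heat\<close> is realised as the distribution of independent coordinates through
  \<open>Pi_pmf\<close>, so summing a function of one coordinate is an expectation under the
  marginal.\<close>

lemma heat_has_sum:
  fixes y :: "'d::finite site" and f :: "int \<Rightarrow> real"
  assumes f: "\<And>k. \<bar>f k\<bar> \<le> C"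
  shows "((\<lambda>x. heat t (x - y) * f (x $ e)) has_sum
    measure_pmf.expectation (ctrw_pmf 0 (t / real CARD('d))) (\<lambda>k. f (k + y $ e))) UNIV"
proof -
  define q where "q = ctrw_pmf 0 (t / real CARD('d))"
  define P where "P = map_pmf vec_lambda (Pi_pmf (UNIV::'d set) 0 (\<lambda>_. q))"
  have pmf_P: "pmf P x = heat t x" for x
  proof -
    have "pmf P (vec_lambda (vec_nth x)) = pmf (Pi_pmf (UNIV::'d set) 0 (\<lambda>_. q)) (vec_nth x)"
      unfolding P_def by (rule pmf_map_inj') (auto simp: inj_def vec_lambda_inject)
    then show ?thesis by (simp add: pmf_Pi heat_def walk_def q_def)
  qed
  have marg: "map_pmf (\<lambda>x. x $ e) P = q"
    unfolding P_def map_pmf_comp using Pi_pmf_component[of UNIV e 0 "\<lambda>_. q"] by simp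
  have "measure_pmf.expectation q (\<lambda>k. f (k + y $ e)) = measure_pmf.expectation P (\<lambda>x. f (x $ e + y $ e))"
    unfolding marg[symmetric] by (rule integral_map_pmf)
  then have 1: "((\<lambda>x. heat t x * f (x $ e + y $ e)) has_sum measure_pmf.expectation q (\<lambda>k. f (k + y $ e))) UNIV"
    using pmf_has_sum[of "\<lambda>x. f (x $ e + y $ e)" C P] f by (simp add: pmf_P)
  have "bij_betw (\<lambda>x. x - y) UNIV UNIV"
    by (rule bij_betw_byWitness[of _ "\<lambda>x. x + y"]) auto
  from has_sum_reindex_bij_betw[OF this, of "\<lambda>x. heat t x * f (x $ e + y $ e)"] 1
  show ?thesis by (simp add: q_def)
qed

text \<open>All coordinates except \<open>e\<close> are estimated uniformly by
  \<open>walk_le\<close>. The kernel in direction \<open>e\<close> stays exact, so that summing over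
  initial sites recovers the mass of a layer.\<close>

lemma heat_le_layer:
  fixes x :: "'d::finite site"
  assumes t: "0 \<le> t"
  shows "heat t x \<le> (2 / sqrt (1 + t / real CARD('d))) ^ (CARD('d) - 1) * walk (t / real CARD('d)) (x $ e)"
proof -
  have "heat t x = (\<Prod>i\<in>UNIV - {e}. walk (t / real CARD('d)) (x $ i)) * walk (t / real CARD('d)) (x $ e)"
    unfolding heat_def by (subst prod.remove[of _ e]) (auto simp: mult.commute)
  also have "\<dots> \<le> (\<Prod>i\<in>UNIV - {e}. 2 / sqrt (1 + t / real CARD('d))) * walk (t / real CARD('d)) (x $ e)"
    using t by (intro mult_right_mono prod_mono) (auto intro!: walk_le)
  finally show ?thesis by (simp add: card_Diff_singleton)
qed

lemma heat_has_derivative: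
  fixes x :: "'d::finite site"
  assumes t: "0 \<le> t"
  shows "((\<lambda>t. heat t x) has_real_derivative
    1 / (2 * real CARD('d)) * (\<Sum>y\<in>nbrs x. heat t y - heat t x)) (at t within {0..})"
proof -
  define c where "c = real CARD('d)"
  have c: "0 < c" by (simp add: c_def)
  define w where "w = walk (t / c)"
  have d: "((\<lambda>t. walk (t / c) n) has_real_derivative ((w (n - 1) + w (n + 1)) / 2 - w n) * (1 / c)) (at t within {0..})" for n
  proof -
    have "((\<lambda>t. t / c) has_real_derivative 1 / c) (at t within {0..})"
      using c by (auto intro!: derivative_eq_intros)
    moreover have "((\<lambda>s. walk s n) has_real_derivative ((w (n - 1) + w (n + 1)) / 2 - w n)) (at (t / c) within (\<lambda>t. t / c) ` {0..})"
      unfolding w_def using c by (intro DERIV_subset[OF walk_has_derivative]) (auto simp: t)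
    ultimately show ?thesis using DERIV_image_chain[of "\<lambda>s. walk s n" _ "\<lambda>t. t / c" t "{0..}" "1 / c"] by (simp add: o_def)
  qed
  have "((\<lambda>t. \<Prod>i\<in>UNIV. walk (t / c) (x $ i)) has_real_derivative
      (\<Sum>i\<in>UNIV. ((w (x $ i - 1) + w (x $ i + 1)) / 2 - w (x $ i)) * (1 / c) * (\<Prod>j\<in>UNIV - {i}. walk (t / c) (x $ j))))
      (at t within {0..})"
    using has_derivative_prod[OF d[unfolded has_field_derivative_def], of "\<lambda>i. x $ i" UNIV]
    unfolding has_field_derivative_def
    by (rule has_derivative_eq_rhs) (auto simp: fun_eq_iff sum_distrib_left mult_ac)
  moreover have "((w (x $ i - 1) + w (x $ i + 1)) / 2 - w (x $ i)) * (1 / c) * (\<Prod>j\<in>UNIV - {i}. walk (t / c) (x $ j))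
      = 1 / (2 * c) * ((heat t (x + axis i 1) - heat t x) + (heat t (x - axis i 1) - heat t x))" for i
  proof -
    have h: "heat t (x + v) = w (x $ i + v $ i) * (\<Prod>j\<in>UNIV - {i}. w (x $ j))"
      if "\<And>j. j \<noteq> i \<Longrightarrow> v $ j = 0" for v
      unfolding heat_def c_def[symmetric] w_def
      by (subst prod.remove[of _ i]) (auto simp: that intro!: prod.cong)
    have "heat t (x + axis i 1) = w (x $ i + 1) * (\<Prod>j\<in>UNIV - {i}. w (x $ j))"
      by (subst h) (auto simp: axis_def)
    moreover have "heat t (x - axis i 1) = w (x $ i - 1) * (\<Prod>j\<in>UNIV - {i}. w (x $ j))"
      using h[of "- axis i 1"] by (auto simp: axis_def)
    moreover have "heat t x = w (x $ i) * (\<Prod>j\<in>UNIV - {i}. w (x $ j))"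
      using h[of 0] by simp
    moreover have "(\<Prod>j\<in>UNIV - {i}. walk (t / c) (x $ j)) = (\<Prod>j\<in>UNIV - {i}. w (x $ j))"
      by (simp add: w_def)
    moreover have "((a + b) / 2 - e) * (1 / c) * P = 1 / (2 * c) * ((b * P - e * P) + (a * P - e * P))" for a b e P :: real
      using c by (simp add: divide_simps) (simp add: algebra_simps)
    ultimately show ?thesis by (simp only:)
  qed
  ultimately have "((\<lambda>t. heat t x) has_real_derivative
      (\<Sum>i\<in>UNIV. 1 / (2 * c) * ((heat t (x + axis i 1) - heat t x) + (heat t (x - axis i 1) - heat t x)))) (at t within {0..})"
    by (simp only: heat_def[abs_def] c_def[symmetric])
  then show ?thesis
    by (simp only: sum_nbrs c_def[symmetric] sum_distrib_left)
qed

section \<open>Negative correlation\<close>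

context exclusion
begin

definition occ_prob :: "'d config \<Rightarrow> real \<Rightarrow> 'd site \<Rightarrow> real" where
  "occ_prob \<eta> t x = corr \<eta> t {x}"

text \<open>The value 0 on the diagonal, instead of the one-point function, lets double sums over
  distinct sites run over all pairs.\<close>

definition pair_prob :: "'d config \<Rightarrow> real \<Rightarrow> 'd site \<Rightarrow> 'd site \<Rightarrow> real" where
  "pair_prob \<eta> t u v = (if u = v then 0 else corr \<eta> t {u, v})"

text \<open>For \<open>x = y\<close> this is the squared occupation probability, so its sum over all
  ordered pairs covers the square sum and the covariance sum at once.\<close>

abbreviation (input) neg_cov :: "'d config \<Rightarrow> real \<Rightarrow> 'd site \<Rightarrow> 'd site \<Rightarrow> real" where
  "neg_cov \<eta> t x y \<equiv> occ_prob \<eta> t x * occ_prob \<eta> t y - pair_prob \<eta> t x y"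

lemma occ_prob_bounds: "0 \<le> t \<Longrightarrow> 0 \<le> occ_prob \<eta> t x" "0 \<le> t \<Longrightarrow> occ_prob \<eta> t x \<le> 1"
  by (simp_all add: occ_prob_def corr_bounds)

lemma pair_prob_bounds: "0 \<le> t \<Longrightarrow> 0 \<le> pair_prob \<eta> t u v" "0 \<le> t \<Longrightarrow> pair_prob \<eta> t u v \<le> 1"
  by (simp_all add: pair_prob_def corr_bounds)

lemma pair_prob_commute: "pair_prob \<eta> t u v = pair_prob \<eta> t v u"
  by (simp add: pair_prob_def insert_commute[of u v])

lemma pair_prob_self [simp]: "pair_prob \<eta> t u u = 0"
  by (simp add: pair_prob_def)

lemma occ_prob_0: "occ_prob \<eta> 0 x = of_bool (\<eta> x)"
  by (simp add: occ_prob_def corr_0 occupied_def)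

lemma pair_prob_0: "pair_prob \<eta> 0 u v = of_bool (u \<noteq> v \<and> \<eta> u \<and> \<eta> v)"
  by (simp add: pair_prob_def corr_0 occupied_def)

lemma occ_prob_has_derivative:
  assumes t: "0 \<le> t"
  shows "((\<lambda>t. occ_prob \<eta> t x) has_real_derivative
     1 / (2 * real CARD('d)) * (\<Sum>y\<in>nbrs x. occ_prob \<eta> t y - occ_prob \<eta> t x)) (at t within {0..})"
  using corr_has_derivative[of "{x}" t \<eta>] t
  by (simp add: occ_prob_def corr_rate_def)

lemma pair_prob_has_derivative:
  assumes t: "0 \<le> t" and uv: "u \<noteq> v"
  shows "((\<lambda>t. pair_prob \<eta> t u v) has_real_derivative
     1 / (2 * real CARD('d)) *
       ((\<Sum>y\<in>nbrs u - {v}. pair_prob \<eta> t y v - pair_prob \<eta> t u v) + (\<Sum>y\<in>nbrs v - {u}. pair_prob \<eta> t u y - pair_prob \<eta> t u v)))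
     (at t within {0..})"
proof -
  have "corr_rate \<eta> t {u, v} = 1 / (2 * real CARD('d)) *
     ((\<Sum>y\<in>nbrs u - {u, v}. corr \<eta> t {y, v} - corr \<eta> t {u, v})
      + (\<Sum>y\<in>nbrs v - {u, v}. corr \<eta> t {y, u} - corr \<eta> t {u, v}))"
  proof -
    have "{u, v} - {u} = {v}" "{u, v} - {v} = {u}" using uv by auto
    then show ?thesis unfolding corr_rate_def using uv by simp
  qed
  moreover have "nbrs u - {u, v} = nbrs u - {v}" "nbrs v - {u, v} = nbrs v - {u}" by auto
  moreover have "(\<Sum>y\<in>nbrs u - {v}. corr \<eta> t {y, v} - corr \<eta> t {u, v}) = (\<Sum>y\<in>nbrs u - {v}. pair_prob \<eta> t y v - pair_prob \<eta> t u v)"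
    using uv by (intro sum.cong) (auto simp: pair_prob_def)
  moreover have "(\<Sum>y\<in>nbrs v - {u}. corr \<eta> t {y, u} - corr \<eta> t {u, v}) = (\<Sum>y\<in>nbrs v - {u}. pair_prob \<eta> t u y - pair_prob \<eta> t u v)"
  proof (intro sum.cong refl)
    fix y assume "y \<in> nbrs v - {u}"
    moreover have "{y, u} = {u, y}" by auto
    ultimately show "corr \<eta> t {y, u} - corr \<eta> t {u, v} = pair_prob \<eta> t u y - pair_prob \<eta> t u v"
      using uv by (auto simp: pair_prob_def)
  qed
  ultimately have "corr_rate \<eta> t {u, v} = 1 / (2 * real CARD('d)) *
    ((\<Sum>y\<in>nbrs u - {v}. pair_prob \<eta> t y v - pair_prob \<eta> t u v) + (\<Sum>y\<in>nbrs v - {u}. pair_prob \<eta> t u y - pair_prob \<eta> t u v))"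
    by (simp only:)
  moreover have "(\<lambda>t. pair_prob \<eta> t u v) = (\<lambda>t. corr \<eta> t {u, v})" using uv by (simp add: pair_prob_def)
  ultimately show ?thesis
    using corr_has_derivative[of "{u, v}" t \<eta>] t by (simp only: finite.intros)
qed

lemma sum_nbrs_remove:
  fixes f :: "'d site \<Rightarrow> real"
  shows "(\<Sum>y\<in>nbrs u. f y) = (\<Sum>y\<in>nbrs u - {v}. f y) + (if v \<in> nbrs u then f v else 0)"
  by (auto simp: sum.remove)

text \<open>A product of one-point functions evolves by unrestricted moves of both coordinates, the
  pair function only by moves that avoid the partner. The difference thus solves the restricted
  equation with a source on adjacent pairs; the source is a square, so
  \<open>maximum_principle\<close> applies.\<close>

theorem negative_correlation:
  assumes t: "0 \<le> t"
  shows "pair_prob \<eta> t u v \<le> occ_prob \<eta> t u * occ_prob \<eta> t v"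
proof (cases "u = v")
  case True
  then show ?thesis using occ_prob_bounds[OF t] by simp
next
  case False
  define c where "c = 1 / (2 * real CARD('d))"
  define I where "I = {(u::'d site, v). u \<noteq> v}"
  define N where "N p = (\<lambda>y. (y, snd p)) ` (nbrs (fst p) - {snd p}) \<union> (\<lambda>y. (fst p, y)) ` (nbrs (snd p) - {fst p})"
    for p :: "'d site \<times> 'd site"
  define D where "D t p = occ_prob \<eta> t (fst p) * occ_prob \<eta> t (snd p) - pair_prob \<eta> t (fst p) (snd p)" for t p
  \<comment> \<open>For adjacent sites with values \<open>a\<close> and \<open>b\<close>, the two
    moves onto the partner leave \<open>(b - a) * b + (a - b) * a\<close>, which is
    \<open>(a - b)^2\<close>.\<close>
  define s where "s t p = (if snd p \<in> nbrs (fst p) then c * (occ_prob \<eta> t (fst p) - occ_prob \<eta> t (snd p))\<^sup>2 else 0)"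
    for t and p :: "'d site \<times> 'd site"
  have sumN: "(\<Sum>q\<in>N (u, v). f q) = (\<Sum>y\<in>nbrs u - {v}. f (y, v)) + (\<Sum>y\<in>nbrs v - {u}. f (u, y))"
    for u v and f :: "_ \<Rightarrow> real"
    unfolding N_def by (subst sum.union_disjoint) (auto simp: sum.reindex inj_on_def)
  have "0 \<le> D t (u, v)"
  proof (rule maximum_principle[where D=D and i="(u, v)" and t=t and I=I and N=N and c=c and s=s and T=t and M=2 and m="4 * CARD('d)"])
    fix p and r :: real assume p: "p \<in> I" and r: "0 \<le> r" "r \<le> t"
    obtain u v where uv: "p = (u, v)" "u \<noteq> v" using p by (auto simp: I_def)
    let ?\<rho> = "occ_prob \<eta> r" and ?q = "pair_prob \<eta> r"
    have "((\<lambda>r. D r p) has_real_derivative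
        (c * (\<Sum>y\<in>nbrs u. ?\<rho> y - ?\<rho> u) * ?\<rho> v + c * (\<Sum>y\<in>nbrs v. ?\<rho> y - ?\<rho> v) * ?\<rho> u
         - c * ((\<Sum>y\<in>nbrs u - {v}. ?q y v - ?q u v) + (\<Sum>y\<in>nbrs v - {u}. ?q u y - ?q u v)))) (at r within {0..})"
      unfolding D_def uv(1) fst_conv snd_conv c_def
      by (rule DERIV_diff[OF DERIV_mult[OF occ_prob_has_derivative occ_prob_has_derivative] pair_prob_has_derivative]) (use r uv in auto)
    moreover have "c * (\<Sum>y\<in>nbrs u. ?\<rho> y - ?\<rho> u) * ?\<rho> v + c * (\<Sum>y\<in>nbrs v. ?\<rho> y - ?\<rho> v) * ?\<rho> u
         - c * ((\<Sum>y\<in>nbrs u - {v}. ?q y v - ?q u v) + (\<Sum>y\<in>nbrs v - {u}. ?q u y - ?q u v))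
       = c * (\<Sum>q\<in>N p. D r q - D r p) + s r p"
    proof -
      have "(\<Sum>q\<in>N p. D r q - D r p) =
          (\<Sum>y\<in>nbrs u - {v}. (?\<rho> y - ?\<rho> u) * ?\<rho> v - (?q y v - ?q u v))
        + (\<Sum>y\<in>nbrs v - {u}. (?\<rho> y - ?\<rho> v) * ?\<rho> u - (?q u y - ?q u v))"
        unfolding uv(1) sumN by (simp add: D_def algebra_simps)
      also have "\<dots> = (\<Sum>y\<in>nbrs u - {v}. ?\<rho> y - ?\<rho> u) * ?\<rho> v - (\<Sum>y\<in>nbrs u - {v}. ?q y v - ?q u v)
        + ((\<Sum>y\<in>nbrs v - {u}. ?\<rho> y - ?\<rho> v) * ?\<rho> u - (\<Sum>y\<in>nbrs v - {u}. ?q u y - ?q u v))"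
      proof -
        have "(\<Sum>y\<in>A. f y * b - g y) = sum f A * b - sum g A" for A and f g :: "'d site \<Rightarrow> real" and b
          by (simp add: sum_subtractf sum_distrib_right)
        then show ?thesis by (intro arg_cong2[where f="(+)"])
      qed
      finally have *: "(\<Sum>q\<in>N p. D r q - D r p) = \<dots>" .
      have s: "s r p = c * ((if v \<in> nbrs u then ?\<rho> v - ?\<rho> u else 0) * ?\<rho> v + (if u \<in> nbrs v then ?\<rho> u - ?\<rho> v else 0) * ?\<rho> u)"
        by (auto simp: s_def uv(1) power2_eq_square nbrs_sym[of u v] algebra_simps)
      have alg: "c * (SA + X1) * b + c * (SB + X2) * a - c * (QA + QB) =
          c * (SA * b - QA + (SB * a - QB)) + c * (X1 * b + X2 * a)" for SA X1 SB X2 QA QB a b :: real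
        by (simp add: algebra_simps)
      show ?thesis
        unfolding * s sum_nbrs_remove[of _ u v] sum_nbrs_remove[of _ v u] by (rule alg)
    qed
    ultimately show "((\<lambda>r. D r p) has_real_derivative c * (\<Sum>q\<in>N p. D r q - D r p) + s r p) (at r within {0..t})"
      by (auto intro: DERIV_subset)
    show "0 \<le> s r p" by (auto simp: s_def c_def)
    have "\<bar>occ_prob \<eta> r u * occ_prob \<eta> r v\<bar> \<le> 1"
      using occ_prob_bounds[OF r(1)] by (auto simp: abs_mult intro!: mult_le_one)
    then show "\<bar>D r p\<bar> \<le> 2"
      using pair_prob_bounds[OF r(1), of \<eta> u v] unfolding D_def uv(1) by auto
  next
    fix p assume p: "p \<in> I"
    then obtain u v where uv: "p = (u, v)" "u \<noteq> v" by (auto simp: I_def)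
    show "N p \<subseteq> I" using p by (auto simp: N_def I_def)
    have "card (N p) \<le> card (nbrs u - {v}) + card (nbrs v - {u})"
      unfolding N_def uv(1) fst_conv snd_conv
      by (intro order_trans[OF card_Un_le] add_mono card_image_le) auto
    also have "\<dots> \<le> card (nbrs u) + card (nbrs v)" by (intro add_mono card_mono) auto
    finally show "card (N p) \<le> 4 * CARD('d)" by (simp add: card_nbrs)
    show "0 \<le> D 0 p" by (auto simp: D_def occ_prob_0 pair_prob_0)
  qed (use False t in \<open>auto simp: I_def c_def\<close>)
  then show ?thesis by (simp add: D_def)
qed

text \<open>The total jump rate out of a site is 1, so occupation probabilities decay no faster than
  exponentially. Read backwards, the values at the final time dominate those at all earlier times;
  this is the source of the time-uniform majorant for termwise differentiation.\<close>

lemma occ_prob_growth: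
  assumes "0 \<le> r" "r \<le> t"
  shows "occ_prob \<eta> r x \<le> exp (t - r) * occ_prob \<eta> t x"
proof -
  define f where "f h = exp h * occ_prob \<eta> (r + h) x" for h
  have "f 0 \<le> f (t - r)"
  proof (rule nondecreasing_from_derivative[where T="t - r"])
    fix h assume h: "0 \<le> h" "h \<le> t - r"
    let ?\<rho> = "occ_prob \<eta> (r + h)"
    let ?d = "1 / (2 * real CARD('d)) * (\<Sum>y\<in>nbrs x. ?\<rho> y - ?\<rho> x)"
    have "((\<lambda>h. occ_prob \<eta> (r + h) x) has_real_derivative ?d * 1) (at h within {0..t - r})"
    proof (rule DERIV_image_chain[of "\<lambda>s. occ_prob \<eta> s x" _ "\<lambda>h. r + h", unfolded o_def])
      show "((\<lambda>s. occ_prob \<eta> s x) has_real_derivative ?d) (at (r + h) within (\<lambda>h. r + h) ` {0..t - r})"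
        using assms h by (intro DERIV_subset[OF occ_prob_has_derivative]) auto
    qed (auto intro!: derivative_eq_intros)
    then show "(f has_real_derivative exp h * ?\<rho> x + exp h * ?d) (at h within {0..t - r})"
      unfolding f_def by (auto intro!: derivative_eq_intros)
    have "?d = 1 / (2 * real CARD('d)) * (\<Sum>y\<in>nbrs x. ?\<rho> y) - ?\<rho> x"
      by (simp add: sum_subtractf card_nbrs right_diff_distrib)
    then have "exp h * ?\<rho> x + exp h * ?d = exp h * (1 / (2 * real CARD('d)) * (\<Sum>y\<in>nbrs x. ?\<rho> y))"
      by (simp only: distrib_left[symmetric]) simp
    then show "0 \<le> exp h * ?\<rho> x + exp h * ?d"
      using occ_prob_bounds(1)[of "r + h"] assms h by (simp add: sum_nonneg)
  qed (use assms in auto)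
  then show ?thesis by (simp add: f_def)
qed

text \<open>Both sides are bounded solutions of the same lattice heat equation with the same initial
  values; applying \<open>maximum_principle\<close> to the difference with either sign gives
  uniqueness.\<close>

lemma occ_prob_finite:
  assumes fin: "finite {y. \<eta> y}" and t: "0 \<le> t"
  shows "occ_prob \<eta> t x = (\<Sum>y\<in>{y. \<eta> y}. heat t (x - y))"
proof -
  define S where "S = {y. \<eta> y}"
  define h where "h t x = (\<Sum>y\<in>S. heat t (x - y))" for t and x :: "'d site"
  define c where "c = 1 / (2 * real CARD('d))"
  have S: "finite S" using fin by (simp add: S_def)
  have hd: "((\<lambda>t. h t x) has_real_derivative c * (\<Sum>y\<in>nbrs x. h t y - h t x)) (at t within {0..})"
    if "0 \<le> t" for t x
  proof -
    have shift: "(\<Sum>z\<in>nbrs (x - y). heat t z - heat t (x - y)) = (\<Sum>z\<in>nbrs x. heat t (z - y) - heat t (x - y))" for y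
      unfolding sum_nbrs by (simp add: algebra_simps)
    have "((\<lambda>t. h t x) has_real_derivative (\<Sum>y\<in>S. c * (\<Sum>z\<in>nbrs (x - y). heat t z - heat t (x - y)))) (at t within {0..})"
      unfolding h_def c_def by (intro DERIV_sum heat_has_derivative that)
    also have "(\<Sum>y\<in>S. c * (\<Sum>z\<in>nbrs (x - y). heat t z - heat t (x - y))) = c * (\<Sum>z\<in>nbrs x. h t z - h t x)"
      unfolding shift h_def sum_distrib_left[symmetric] sum_subtractf[symmetric]
      by (subst sum.swap) simp
    finally show ?thesis .
  qed
  have h: "0 \<le> h t x" "h t x \<le> card S" for t x
    using sum_bounded_above[of S "\<lambda>y. heat t (x - y)" 1] by (auto simp: h_def sum_nonneg heat_le_1)
  have h0: "h 0 x = occ_prob \<eta> 0 x" for x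
  proof -
    have "h 0 x = (\<Sum>y\<in>S. if y = x then 1 else 0)"
      unfolding h_def heat_0 by (intro sum.cong) auto
    also have "\<dots> = of_bool (x \<in> S)" using S by simp
    finally show ?thesis by (simp add: occ_prob_0 S_def)
  qed
  have main: "0 \<le> \<sigma> * (occ_prob \<eta> t x - h t x)" if \<sigma>: "\<sigma> = 1 \<or> \<sigma> = -1" for \<sigma> :: real
  proof (rule maximum_principle[where D="\<lambda>t x. \<sigma> * (occ_prob \<eta> t x - h t x)" and i=x and t=t and I=UNIV and N=nbrs and c=c and s="\<lambda>_ _. 0" and T=t and M="1 + card S" and m="2 * CARD('d)"])
    fix x r assume r: "0 \<le> r" "r \<le> t"
    have "((\<lambda>r. \<sigma> * (occ_prob \<eta> r x - h r x)) has_real_derivative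
       \<sigma> * (c * (\<Sum>y\<in>nbrs x. occ_prob \<eta> r y - occ_prob \<eta> r x) - c * (\<Sum>y\<in>nbrs x. h r y - h r x))) (at r within {0..})"
      unfolding c_def by (intro DERIV_cmult DERIV_diff occ_prob_has_derivative hd[unfolded c_def] r)
    also have "\<sigma> * (c * (\<Sum>y\<in>nbrs x. occ_prob \<eta> r y - occ_prob \<eta> r x) - c * (\<Sum>y\<in>nbrs x. h r y - h r x))
      = c * (\<Sum>y\<in>nbrs x. \<sigma> * (occ_prob \<eta> r y - h r y) - \<sigma> * (occ_prob \<eta> r x - h r x)) + 0"
      by (simp add: sum_subtractf sum_distrib_left right_diff_distrib mult_ac)
    finally show "((\<lambda>r. \<sigma> * (occ_prob \<eta> r x - h r x)) has_real_derivative \<dots>) (at r within {0..t})"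
      by (rule DERIV_subset) auto
    show "\<bar>\<sigma> * (occ_prob \<eta> r x - h r x)\<bar> \<le> 1 + card S"
      using h[of r x] occ_prob_bounds[OF r(1), of \<eta> x] \<sigma> by auto
  qed (use t in \<open>auto simp: card_nbrs c_def h0\<close>)
  show ?thesis using main[of 1] main[of "-1"] by (simp add: h_def S_def)
qed

end

section \<open>The pair functional\<close>

lemma has_sum_sum_finite:
  fixes f :: "'j \<Rightarrow> 'i \<Rightarrow> real"
  assumes "finite J" "\<And>j. j \<in> J \<Longrightarrow> (f j has_sum s j) A"
  shows "((\<lambda>x. \<Sum>j\<in>J. f j x) has_sum (\<Sum>j\<in>J. s j)) A"
  using assms by (induction J) (auto intro: has_sum_add)

lemma summable_on_sum_finite:
  fixes f :: "'j \<Rightarrow> 'i \<Rightarrow> real"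
  assumes "finite J" "\<And>j. j \<in> J \<Longrightarrow> f j summable_on A"
  shows "(\<lambda>x. \<Sum>j\<in>J. f j x) summable_on A"
  using assms by (induction J) (auto intro: summable_on_add)

lemma has_sum_product_nonneg:
  fixes f :: "'i \<Rightarrow> real" and g :: "'j \<Rightarrow> real"
  assumes f: "(f has_sum a) UNIV" "\<And>x. 0 \<le> f x" and g: "(g has_sum b) UNIV" "\<And>x. 0 \<le> g x"
  shows "((\<lambda>(x, y). f x * g y) has_sum (a * b)) UNIV"
proof -
  have 1: "((\<lambda>y. f x * g y) has_sum (f x * b)) UNIV" for x
    by (rule has_sum_cmult_right[OF g(1)])
  have 2: "((\<lambda>x. f x * b) has_sum (a * b)) UNIV"
    by (rule has_sum_cmult_left[OF f(1)])
  have "(\<lambda>(x, y). f x * g y) summable_on (UNIV \<times> UNIV)"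
    by (rule summable_on_SigmaI[where g="\<lambda>x. f x * b"])
       (use 1 2 f g in \<open>auto intro: has_sum_imp_summable\<close>)
  then have "((\<lambda>(x, y). f x * g y) has_sum (a * b)) (UNIV \<times> UNIV)"
    by (rule has_sum_SigmaI[where g="\<lambda>x. f x * b", rotated 2]) (use 1 2 in auto)
  then show ?thesis by simp
qed

lemma summable_on_bound:
  fixes f g :: "'i \<Rightarrow> real"
  assumes "g summable_on A" "\<And>x. x \<in> A \<Longrightarrow> \<bar>f x\<bar> \<le> g x"
  shows "f summable_on A"
  by (rule abs_summable_summable, rule Infinite_Sum.abs_summable_on_comparison_test'[OF assms(1)])
     (use assms(2) in auto)

lemma sum_nbrs_shift:
  fixes x :: "'d::finite site" and f :: "'d site \<Rightarrow> real"
  shows "(\<Sum>y\<in>nbrs x. f y) = (\<Sum>a\<in>nbrs 0. f (x + a))"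
  unfolding sum_nbrs by simp

lemma sum_nbrs_minus:
  fixes f :: "'d::finite site \<Rightarrow> real"
  shows "(\<Sum>a\<in>nbrs 0. f (- a)) = (\<Sum>a\<in>nbrs 0. f a)"
  unfolding sum_nbrs by (simp add: add.commute)

lemma summable_on_bij:
  fixes f :: "'i \<Rightarrow> real"
  assumes "f summable_on UNIV" "bij \<tau>"
  shows "(\<lambda>p. f (\<tau> p)) summable_on UNIV"
  using summable_on_reindex_bij_betw[OF assms(2), of f] assms(1) by simp

text \<open>Discrete integration by parts: reindexing by \<open>T a\<close> turns the subtracted
  term into the total belonging to the reversed step \<open>- a\<close>, and the set of steps is
  symmetric under reversal.\<close>

lemma has_sum_nbrs_exchange:
  fixes f :: "'i \<Rightarrow> 'd::finite site \<Rightarrow> real"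
  assumes bij: "\<And>a. bij (T a)"
    and f: "\<And>a. a \<in> nbrs 0 \<Longrightarrow> (\<lambda>p. f p a) summable_on UNIV"
  shows "((\<lambda>p. \<Sum>a\<in>nbrs 0. f p a - f (T a p) (- a)) has_sum 0) UNIV"
proof -
  define S where "S a = infsum (\<lambda>p. f p a) UNIV" for a
  have S: "((\<lambda>p. f p a) has_sum S a) UNIV" if "a \<in> nbrs 0" for a
    unfolding S_def using f[OF that] by (rule has_sum_infsum)
  have "((\<lambda>p. \<Sum>a\<in>nbrs 0. f p a + - f (T a p) (- a)) has_sum (\<Sum>a\<in>nbrs 0. S a + - S (- a))) UNIV"
  proof (intro has_sum_sum_finite has_sum_add S)
    fix a :: "'d site" assume a: "a \<in> nbrs 0"
    then have "- a \<in> nbrs 0" by (simp add: nbrs_def)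
    from S[OF this] have "((\<lambda>p. f (T a p) (- a)) has_sum S (- a)) UNIV"
      using has_sum_reindex_bij_betw[OF bij[of a], of "\<lambda>p. f p (- a)"] by simp
    then show "((\<lambda>p. - f (T a p) (- a)) has_sum - S (- a)) UNIV" by (simp add: has_sum_uminus)
  qed simp_all
  also have "(\<Sum>a\<in>nbrs 0. S a + - S (- a)) = 0"
    by (simp add: sum_subtractf sum_nbrs_minus)
  finally show ?thesis by simp
qed

lemma bij_add_right: "bij (\<lambda>u::'a::ab_group_add. u + a)"
  by (rule o_bij[of "\<lambda>u. u - a"]) auto

lemma bij_add_fst: "bij (\<lambda>p::'a::ab_group_add \<times> 'b. (fst p + a, snd p))"
  by (rule o_bij[of "\<lambda>p. (fst p - a, snd p)"]) auto

lemma bij_add_snd: "bij (\<lambda>p::'b \<times> 'a::ab_group_add. (fst p, snd p + a))"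
  by (rule o_bij[of "\<lambda>p. (fst p, snd p - a)"]) auto

text \<open>The probability that a rate-one walk on \<open>\<int>\<^sup>d\<close> started at \<open>x\<close> is in the half-space
  \<open>{y. k \<le> y $ e}\<close> at time \<open>s\<close>; each coordinate jumps at rate \<open>1 / d\<close>.\<close>

definition reach :: "'d::finite \<Rightarrow> int \<Rightarrow> real \<Rightarrow> 'd site \<Rightarrow> real" where
  "reach e k s x = tail (s / real CARD('d)) (k - x $ e)"

text \<open>For finitely many initial particles this is the expected number of particles in the
  layer \<open>k\<close> at time \<open>s\<close>; for infinitely many the sum takes its default
  value 0.\<close>

definition layer_mass :: "'d::finite \<Rightarrow> 'd config \<Rightarrow> real \<Rightarrow> int \<Rightarrow> real" where
  "layer_mass e \<eta> s k = (\<Sum>y\<in>{y. \<eta> y}. walk (s / real CARD('d)) (k - y $ e))"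

lemma reach_bounds: "0 \<le> reach e k s x" "reach e k s x \<le> 1"
  by (simp_all add: reach_def tail_bounds)

lemma reach_0: "reach e k 0 x = of_bool (k \<le> x $ e)"
  by (simp add: reach_def tail_0)

lemma layer_mass_nonneg [simp]: "0 \<le> layer_mass e \<eta> s k"
  by (simp add: layer_mass_def sum_nonneg)

lemma reach_has_derivative:
  fixes x :: "'d::finite site"
  assumes s: "0 \<le> s"
  shows "((\<lambda>s. reach e k s x) has_real_derivative
    1 / (2 * real CARD('d)) * (\<Sum>y\<in>nbrs x. reach e k s y - reach e k s x)) (at s within {0..})"
proof -
  define c where "c = real CARD('d)"
  have c: "0 < c" by (simp add: c_def)
  define n where "n = k - x $ e"
  define w where "w = tail (s / c)"
  have "((\<lambda>t. t / c) has_real_derivative 1 / c) (at s within {0..})"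
    using c by (auto intro!: derivative_eq_intros)
  moreover have "((\<lambda>s. tail s n) has_real_derivative ((w (n - 1) + w (n + 1)) / 2 - w n)) (at (s / c) within (\<lambda>t. t / c) ` {0..})"
    unfolding w_def using c s by (intro DERIV_subset[OF tail_has_derivative]) auto
  ultimately have d: "((\<lambda>s. tail (s / c) n) has_real_derivative ((w (n - 1) + w (n + 1)) / 2 - w n) * (1 / c)) (at s within {0..})"
    using DERIV_image_chain[of "\<lambda>s. tail s n" _ "\<lambda>t. t / c" s "{0..}" "1 / c"] by (simp add: o_def)
  have "(\<Sum>y\<in>nbrs x. reach e k s y - reach e k s x) =
      (\<Sum>i\<in>UNIV. if i = e then (w (n - 1) - w n) + (w (n + 1) - w n) else 0)"
    unfolding sum_nbrs
  proof (intro sum.cong refl)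
    fix i
    have "k - (x + axis i 1) $ e = (if i = e then n - 1 else n)" "k - (x - axis i 1) $ e = (if i = e then n + 1 else n)"
      by (auto simp: n_def axis_def)
    then show "reach e k s (x + axis i 1) - reach e k s x + (reach e k s (x - axis i 1) - reach e k s x) =
      (if i = e then (w (n - 1) - w n) + (w (n + 1) - w n) else 0)"
      by (simp add: reach_def w_def c_def n_def)
  qed
  also have "\<dots> = (w (n - 1) - w n) + (w (n + 1) - w n)" by simp
  finally have "1 / (2 * c) * (\<Sum>y\<in>nbrs x. reach e k s y - reach e k s x) = ((w (n - 1) + w (n + 1)) / 2 - w n) * (1 / c)"
    using c by (simp add: field_simps)
  then show ?thesis using d by (simp add: reach_def c_def n_def)
qed

lemma reach_step:
  fixes x :: "'d::finite site"
  shows "reach e k s (x + axis i 1) - reach e k s x = (if i = e then walk (s / real CARD('d)) (k - 1 - x $ e) else 0)"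
  using tail_diff[of "s / real CARD('d)" "k - 1 - x $ e"]
  by (auto simp: reach_def axis_def algebra_simps)

text \<open>A single term of the Chapman-Kolmogorov sum, in which the particle passes through layer
  \<open>k\<close> at time \<open>r\<close>.\<close>

lemma layer_mass_walk_le:
  fixes \<eta> :: "'d::finite config"
  assumes r: "0 \<le> r" "r \<le> t"
  shows "layer_mass e \<eta> r k * walk ((t - r) / real CARD('d)) (n - k) \<le> layer_mass e \<eta> t n"
  unfolding layer_mass_def sum_distrib_right
proof (rule sum_mono)
  fix y :: "'d site"
  have "((\<lambda>j. walk (r / real CARD('d)) j * walk ((t - r) / real CARD('d)) (n - y $ e - j)) has_sum
      walk (r / real CARD('d) + (t - r) / real CARD('d)) (n - y $ e)) UNIV"
    using r by (intro walk_add_has_sum) auto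
  from finite_sum_le_has_sum[OF this, of "{k - y $ e}"]
  show "walk (r / real CARD('d)) (k - y $ e) * walk ((t - r) / real CARD('d)) (n - k) \<le> walk (t / real CARD('d)) (n - y $ e)"
    by (simp add: add_divide_distrib[symmetric])
qed

lemma expectation_walk:
  assumes "0 \<le> s" "0 \<le> t"
  shows "measure_pmf.expectation (ctrw_pmf 0 s) (\<lambda>k. walk t (n - k)) = walk (s + t) n"
  by (rule has_sum_unique[OF _ walk_add_has_sum[OF assms]])
     (use pmf_has_sum[of "\<lambda>k. walk t (n - k)" 1 "ctrw_pmf 0 s"] in \<open>simp add: walk_def[of s]\<close>)

section \<open>Layer estimates for the one-point function and the defect of the pair
  equation\<close>

context exclusion
begin

lemma occ_prob_layer_le:
  assumes fin: "finite {y. \<eta> y}" and r: "0 \<le> r"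
  shows "occ_prob \<eta> r u \<le> (2 / sqrt (1 + r / real CARD('d))) ^ (CARD('d) - 1) * layer_mass e \<eta> r (u $ e)"
  unfolding occ_prob_finite[OF fin r] layer_mass_def sum_distrib_left
  using heat_le_layer[OF r, of _ e] by (intro sum_mono) (metis vector_minus_component)

text \<open>The full Chapman-Kolmogorov sum over the position at time \<open>r\<close>, of which
  \<open>layer_mass_walk_le\<close> retains one term.\<close>

lemma occ_prob_has_sum_walk:
  assumes fin: "finite {y. \<eta> y}" and r: "0 \<le> r" "r \<le> t"
  shows "((\<lambda>u. occ_prob \<eta> r u * walk ((t - r) / real CARD('d)) (n - u $ e)) has_sum layer_mass e \<eta> t n) UNIV"
proof -
  have "((\<lambda>u. \<Sum>y\<in>{y. \<eta> y}. heat r (u - y) * walk ((t - r) / real CARD('d)) (n - u $ e)) has_sum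
     (\<Sum>y\<in>{y. \<eta> y}. walk (t / real CARD('d)) (n - y $ e))) UNIV"
  proof (rule has_sum_sum_finite[OF fin])
    fix y :: "'d site"
    have "measure_pmf.expectation (ctrw_pmf 0 (r / real CARD('d))) (\<lambda>k. walk ((t - r) / real CARD('d)) (n - (k + y $ e)))
      = measure_pmf.expectation (ctrw_pmf 0 (r / real CARD('d))) (\<lambda>k. walk ((t - r) / real CARD('d)) (n - y $ e - k))"
      by (simp add: algebra_simps)
    also have "\<dots> = walk (r / real CARD('d) + (t - r) / real CARD('d)) (n - y $ e)"
      using r by (intro expectation_walk) auto
    also have "\<dots> = walk (t / real CARD('d)) (n - y $ e)" by (simp add: add_divide_distrib[symmetric])
    finally show "((\<lambda>u. heat r (u - y) * walk ((t - r) / real CARD('d)) (n - u $ e)) has_sum walk (t / real CARD('d)) (n - y $ e)) UNIV"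
      using heat_has_sum[of "\<lambda>k. walk ((t - r) / real CARD('d)) (n - k)" 1 r y e] by simp
  qed
  then show ?thesis
    unfolding occ_prob_finite[OF fin r(1)] layer_mass_def sum_distrib_right .
qed

lemma occ_prob_has_sum_reach:
  assumes fin: "finite {y. \<eta> y}" and t: "0 \<le> t"
  shows "((\<lambda>u. of_bool (k \<le> u $ e) * occ_prob \<eta> t u) has_sum (\<Sum>y\<in>{y. \<eta> y}. reach e k t y)) UNIV"
proof -
  have "((\<lambda>u. \<Sum>y\<in>{y. \<eta> y}. heat t (u - y) * indicator {k..} (u $ e)) has_sum (\<Sum>y\<in>{y. \<eta> y}. reach e k t y)) UNIV"
  proof (rule has_sum_sum_finite[OF fin])
    fix y :: "'d site"
    have "(\<lambda>j. indicator {k..} (j + y $ e) :: real) = indicator {k - y $ e..}"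
      by (auto simp: indicator_def fun_eq_iff)
    then have "measure_pmf.expectation (ctrw_pmf 0 (t / real CARD('d))) (\<lambda>j. indicator {k..} (j + y $ e)) = reach e k t y"
      by (simp only: reach_def tail_def)
    then show "((\<lambda>u. heat t (u - y) * indicator {k..} (u $ e)) has_sum reach e k t y) UNIV"
      using heat_has_sum[of "indicator {k..}" 1 t y e] by simp
  qed
  then show ?thesis
    unfolding occ_prob_finite[OF fin t] by (simp add: sum_distrib_left indicator_def of_bool_def mult.commute)
qed

lemma occ_prob_summable:
  assumes fin: "finite {y. \<eta> y}" and t: "0 \<le> t"
  shows "occ_prob \<eta> t summable_on UNIV"
proof -
  have "((\<lambda>u. \<Sum>y\<in>{y. \<eta> y}. heat t (u - y) * 1) has_sum (\<Sum>y\<in>{y. \<eta> y}. 1)) UNIV"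
    using heat_has_sum[of "\<lambda>_. 1" 1 t] by (intro has_sum_sum_finite[OF fin]) auto
  then show ?thesis
    unfolding occ_prob_finite[OF fin t] by (auto intro: has_sum_imp_summable)
qed

text \<open>The error made when the pair function, extended by 0 to the diagonal, is treated as a
  solution of the equation for two independent walks. At adjacent sites that equation also counts
  the two forbidden jumps, which is undone; on the diagonal it lets mass flow in from the
  neighbours, which is removed.\<close>

definition pair_defect :: "'d config \<Rightarrow> real \<Rightarrow> 'd site \<Rightarrow> 'd site \<Rightarrow> real" where
  "pair_defect \<eta> t u v = 1 / (2 * real CARD('d)) *
     ((if v \<in> nbrs u then 2 * pair_prob \<eta> t u v else 0)
      - (if u = v then (\<Sum>y\<in>nbrs u. pair_prob \<eta> t y v) + (\<Sum>y\<in>nbrs v. pair_prob \<eta> t u y) else 0))"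

lemma pair_prob_has_derivative':
  assumes t: "0 \<le> t"
  shows "((\<lambda>t. pair_prob \<eta> t u v) has_real_derivative
     1 / (2 * real CARD('d)) *
       ((\<Sum>y\<in>nbrs u. pair_prob \<eta> t y v - pair_prob \<eta> t u v) + (\<Sum>y\<in>nbrs v. pair_prob \<eta> t u y - pair_prob \<eta> t u v))
     + pair_defect \<eta> t u v) (at t within {0..})"
proof (cases "u = v")
  case True
  then show ?thesis by (simp add: pair_defect_def algebra_simps)
next
  case False
  have "1 / (2 * real CARD('d)) *
       ((\<Sum>y\<in>nbrs u - {v}. pair_prob \<eta> t y v - pair_prob \<eta> t u v) + (\<Sum>y\<in>nbrs v - {u}. pair_prob \<eta> t u y - pair_prob \<eta> t u v))
    = 1 / (2 * real CARD('d)) *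
       ((\<Sum>y\<in>nbrs u. pair_prob \<eta> t y v - pair_prob \<eta> t u v) + (\<Sum>y\<in>nbrs v. pair_prob \<eta> t u y - pair_prob \<eta> t u v))
     + pair_defect \<eta> t u v"
    unfolding sum_nbrs_remove[of _ u v] sum_nbrs_remove[of _ v u] pair_defect_def distrib_left[symmetric]
    using False by (auto simp: nbrs_sym[of u v])
  then show ?thesis using pair_prob_has_derivative[OF t False, of \<eta>] by simp
qed

end

section \<open>Dissipation and the time derivative of the pair functional\<close>

context exclusion
begin

lemma pair_prob_le_exp:
  assumes "0 \<le> r" "r \<le> t"
  shows "pair_prob \<eta> r u v \<le> (exp t * occ_prob \<eta> t u) * (exp t * occ_prob \<eta> t v)"
proof -
  have 1: "occ_prob \<eta> r x \<le> exp t * occ_prob \<eta> t x" for x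
  proof -
    have "occ_prob \<eta> r x \<le> exp (t - r) * occ_prob \<eta> t x" by (rule occ_prob_growth[OF assms])
    also have "\<dots> \<le> exp t * occ_prob \<eta> t x"
      using assms occ_prob_bounds[of t] by (intro mult_right_mono) auto
    finally show ?thesis .
  qed
  have "pair_prob \<eta> r u v \<le> occ_prob \<eta> r u * occ_prob \<eta> r v" by (rule negative_correlation[OF assms(1)])
  also have "\<dots> \<le> (exp t * occ_prob \<eta> t u) * (exp t * occ_prob \<eta> t v)"
    using 1 occ_prob_bounds[of r] occ_prob_bounds[of t] assms by (intro mult_mono) auto
  finally show ?thesis .
qed

text \<open>Up to the factor \<open>1 / (2 d)\<close>, the rate at which the pair functional
  \<open>\<Sum>u v. reach u * reach v * P(u and v occupied)\<close> decreases.\<close>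

definition dissipation :: "'d config \<Rightarrow> 'd \<Rightarrow> int \<Rightarrow> real \<Rightarrow> real \<Rightarrow> 'd site \<Rightarrow> real" where
  "dissipation \<eta> e k t r u =
     (\<Sum>y\<in>nbrs u. pair_prob \<eta> r u y * (reach e k (t - r) u - reach e k (t - r) y)\<^sup>2)"

text \<open>After \<open>negative_correlation\<close> each bond carries two occupation probabilities
  and two kernel values. One product is bounded pointwise by \<open>key\<close>, as spatial decay
  times a layer mass at time \<open>t\<close>; the other is summed exactly to
  \<open>layer_mass e \<eta> t k\<close>. The two orientations of a bond give the factor 2.\<close>

lemma dissipation_bound:
  fixes e :: 'd
  assumes fin: "finite {y. \<eta> y}" and r: "0 \<le> r" "r \<le> t"
  shows "dissipation \<eta> e k t r summable_on UNIV"
    and "infsum (dissipation \<eta> e k t r) UNIV \<le>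
      2 * (2 / sqrt (1 + r / real CARD('d))) ^ (CARD('d) - 1) * layer_mass e \<eta> t (k - 1) * layer_mass e \<eta> t k"
proof -
  define P where "P = (2 / sqrt (1 + r / real CARD('d))) ^ (CARD('d) - 1)"
  define w where "w = walk ((t - r) / real CARD('d))"
  define L where "L = layer_mass e \<eta> t (k - 1)"
  define a where "a = (axis e 1 :: 'd site)"
  define \<rho> where "\<rho> = occ_prob \<eta> r"
  define h where "h u = \<rho> u * w (k - u $ e)" for u
  have P0: "0 \<le> P" using r by (simp add: P_def)
  have \<rho>0: "0 \<le> \<rho> u" for u using occ_prob_bounds[OF r(1)] by (simp add: \<rho>_def)
  have w0: "0 \<le> w n" for n by (simp add: w_def)
  have q: "0 \<le> pair_prob \<eta> r u y" "pair_prob \<eta> r u y \<le> \<rho> u * \<rho> y" for u y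
    using pair_prob_bounds(1)[OF r(1)] negative_correlation[OF r(1)] by (auto simp: \<rho>_def)
  have key: "\<rho> u * w (k - 1 - u $ e) \<le> P * L" for u
  proof -
    have "\<rho> u * w (k - 1 - u $ e) \<le> P * layer_mass e \<eta> r (u $ e) * w (k - 1 - u $ e)"
      using occ_prob_layer_le[OF fin r(1), of u e] by (intro mult_right_mono) (auto simp: \<rho>_def P_def w_def)
    also have "\<dots> \<le> P * L"
      using layer_mass_walk_le[OF r, of e \<eta> "u $ e" "k - 1"] P0
      by (simp only: mult.assoc w_def L_def mult_left_mono)
    finally show ?thesis .
  qed
  have le: "dissipation \<eta> e k t r u \<le> P * L * (h (u + a) + h u)" for u
  proof -
    have "dissipation \<eta> e k t r u = (\<Sum>i\<in>UNIV. if i = e then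
        pair_prob \<eta> r u (u + a) * (w (k - 1 - u $ e))\<^sup>2 + pair_prob \<eta> r u (u - a) * (w (k - u $ e))\<^sup>2 else 0)"
      unfolding dissipation_def sum_nbrs
    proof (intro sum.cong refl)
      fix i
      have "reach e k (t - r) (u + axis i 1) - reach e k (t - r) u = (if i = e then w (k - 1 - u $ e) else 0)"
        unfolding reach_step w_def by simp
      moreover have "reach e k (t - r) u - reach e k (t - r) (u - axis i 1) = (if i = e then w (k - u $ e) else 0)"
        using reach_step[of e k "t - r" "u - axis i 1" i] unfolding w_def by (auto simp: axis_def)
      ultimately show "pair_prob \<eta> r u (u + axis i 1) * (reach e k (t - r) u - reach e k (t - r) (u + axis i 1))\<^sup>2 +
         pair_prob \<eta> r u (u - axis i 1) * (reach e k (t - r) u - reach e k (t - r) (u - axis i 1))\<^sup>2 =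
         (if i = e then pair_prob \<eta> r u (u + a) * (w (k - 1 - u $ e))\<^sup>2 + pair_prob \<eta> r u (u - a) * (w (k - u $ e))\<^sup>2 else 0)"
        by (auto simp: a_def power2_commute[of "reach e k (t - r) u" "reach e k (t - r) (u + _)"])
    qed
    also have "\<dots> = pair_prob \<eta> r u (u + a) * (w (k - 1 - u $ e))\<^sup>2 + pair_prob \<eta> r u (u - a) * (w (k - u $ e))\<^sup>2"
      by simp
    also have "\<dots> \<le> P * L * h (u + a) + P * L * h u"
    proof (rule add_mono)
      \<comment> \<open>Across a bond in direction \<open>e\<close> the increment of
        \<open>reach\<close> is one kernel value, which can be written with the coordinate of either
        endpoint. One copy goes with the lower endpoint into \<open>key\<close>, the other with the
        upper endpoint into \<open>h\<close>.\<close>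
      have n: "(u + a) $ e = u $ e + 1" "(u - a) $ e = u $ e - 1" by (auto simp: a_def axis_def)
      have "pair_prob \<eta> r u (u + a) * (w (k - 1 - u $ e))\<^sup>2 \<le> (\<rho> u * \<rho> (u + a)) * (w (k - 1 - u $ e))\<^sup>2"
        by (intro mult_right_mono q) auto
      also have "\<dots> = (\<rho> u * w (k - 1 - u $ e)) * h (u + a)"
        unfolding h_def n power2_eq_square by (simp add: algebra_simps)
      also have "\<dots> \<le> P * L * h (u + a)"
        by (intro mult_right_mono key) (simp add: h_def \<rho>0 w0)
      finally show "pair_prob \<eta> r u (u + a) * (w (k - 1 - u $ e))\<^sup>2 \<le> P * L * h (u + a)" .
      have "pair_prob \<eta> r u (u - a) * (w (k - u $ e))\<^sup>2 \<le> (\<rho> u * \<rho> (u - a)) * (w (k - u $ e))\<^sup>2"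
        by (intro mult_right_mono q) auto
      also have "\<dots> = (\<rho> (u - a) * w (k - 1 - (u - a) $ e)) * h u"
        unfolding h_def n power2_eq_square by (simp add: algebra_simps)
      also have "\<dots> \<le> P * L * h u"
        by (intro mult_right_mono key) (simp add: h_def \<rho>0 w0)
      finally show "pair_prob \<eta> r u (u - a) * (w (k - u $ e))\<^sup>2 \<le> P * L * h u" .
    qed
    finally show ?thesis by (simp add: distrib_left)
  qed
  have h: "(h has_sum layer_mass e \<eta> t k) UNIV"
    unfolding h_def \<rho>_def w_def by (rule occ_prob_has_sum_walk[OF fin r])
  then have "((\<lambda>u. h (u + a)) has_sum layer_mass e \<eta> t k) UNIV"
    using has_sum_reindex_bij_betw[OF bij_add_right[of a], of h] by simp
  then have bnd: "((\<lambda>u. P * L * (h (u + a) + h u)) has_sum P * L * (layer_mass e \<eta> t k + layer_mass e \<eta> t k)) UNIV"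
    by (intro has_sum_cmult_right has_sum_add h)
  have nonneg: "0 \<le> dissipation \<eta> e k t r u" for u
    unfolding dissipation_def by (intro sum_nonneg mult_nonneg_nonneg q) auto
  show s: "dissipation \<eta> e k t r summable_on UNIV"
    by (rule summable_on_bound[OF has_sum_imp_summable[OF bnd]]) (use le nonneg in auto)
  have "infsum (dissipation \<eta> e k t r) UNIV \<le> P * L * (layer_mass e \<eta> t k + layer_mass e \<eta> t k)"
    by (rule has_sum_mono[OF has_sum_infsum[OF s] bnd]) (rule le)
  then show "infsum (dissipation \<eta> e k t r) UNIV \<le> 2 * P * L * layer_mass e \<eta> t k"
    by (simp add: algebra_simps)
qed

text \<open>In the remaining time \<open>t - r\<close> the weights solve the equation of a free
  walk, so the free parts \<open>A1\<close> and \<open>A2\<close> of the derivative sum to 0 by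
  discrete integration by parts. Only the defect part \<open>A3\<close> survives.\<close>

theorem pair_functional_has_derivative:
  fixes e :: 'd
  assumes fin: "finite {y. \<eta> y}" and r: "0 \<le> r" "r \<le> t"
  shows "((\<lambda>r. \<Sum>\<^sub>\<infinity>p. reach e k (t - r) (fst p) * reach e k (t - r) (snd p) * pair_prob \<eta> r (fst p) (snd p))
     has_real_derivative - (1 / (2 * real CARD('d)) * infsum (dissipation \<eta> e k t r) UNIV)) (at r within {0..t})"
proof -
  define \<alpha> where "\<alpha> r u = reach e k (t - r) u" for r u
  define q where "q r u v = pair_prob \<eta> r u v" for r u v
  define c where "c = 1 / (2 * real CARD('d))"
  \<comment> \<open>By \<open>pair_prob_le_exp\<close> the product \<open>G u * G v\<close>
    dominates the pair function at all times up to \<open>t\<close>, and it is summable because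
    there are finitely many particles.\<close>
  define G where "G u = exp t * occ_prob \<eta> t u" for u
  have t: "0 \<le> t" using r by simp
  have c: "0 < c" "2 * c \<le> 1" "c * real (card (nbrs u)) = 1" for u :: "'d site"
    by (auto simp: c_def card_nbrs field_simps)
  have \<alpha>: "0 \<le> \<alpha> r u" "\<alpha> r u \<le> 1" for r u by (simp_all add: \<alpha>_def reach_bounds)
  have \<alpha>2: "0 \<le> \<alpha> r u * \<alpha> r v" "\<alpha> r u * \<alpha> r v \<le> 1" for r u v
    using \<alpha> by (auto intro: mult_le_one)
  have G0: "0 \<le> G u" for u using occ_prob_bounds[OF t] by (simp add: G_def)
  have Gs: "G summable_on UNIV" unfolding G_def by (intro summable_on_cmult_right occ_prob_summable fin t)
  have q0: "0 \<le> q r u v" if "0 \<le> r" for r u v using pair_prob_bounds(1)[OF that] by (simp add: q_def)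
  have qG: "q r u v \<le> G u * G v" if "0 \<le> r" "r \<le> t" for r u v
    unfolding q_def G_def by (rule pair_prob_le_exp[OF that])
  have \<alpha>q: "0 \<le> \<alpha> r x * \<alpha> r y * q r u v" "\<alpha> r x * \<alpha> r y * q r u v \<le> G u * G v"
    if "0 \<le> r" "r \<le> t" for r x y u v
  proof -
    show "0 \<le> \<alpha> r x * \<alpha> r y * q r u v" using that by (intro mult_nonneg_nonneg[OF \<alpha>2(1) q0])
    have "\<alpha> r x * \<alpha> r y * q r u v \<le> 1 * q r u v" using \<alpha>2 q0 that by (intro mult_right_mono) auto
    then show "\<alpha> r x * \<alpha> r y * q r u v \<le> G u * G v" using qG[OF that, of u v] by simp
  qed
  define W where "W = (\<lambda>p. G (fst p) * G (snd p))"
  have W: "W summable_on UNIV"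
    using has_sum_product_nonneg[OF has_sum_infsum[OF Gs] G0 has_sum_infsum[OF Gs] G0]
    by (simp add: W_def case_prod_unfold has_sum_imp_summable)
  have W1: "(\<lambda>p. W (fst p + a, snd p)) summable_on UNIV" for a
    using summable_on_bij[OF W bij_add_fst] .
  have W2: "(\<lambda>p. W (fst p, snd p + a)) summable_on UNIV" for a
    using summable_on_bij[OF W bij_add_snd] .
  \<comment> \<open>The coefficients are those of the bounds \<open>A1b\<close>, \<open>A2b\<close>
    and \<open>A3b\<close> added together.\<close>
  define M where "M p = 3 * W p + 2 * (\<Sum>a\<in>nbrs 0. W (fst p + a, snd p)) + 2 * (\<Sum>a\<in>nbrs 0. W (fst p, snd p + a))" for p
  have M: "M summable_on UNIV"
    unfolding M_def by (intro summable_on_add summable_on_cmult_right summable_on_sum_finite finite_nbrs W W1 W2)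
  define f where "f p r = \<alpha> r (fst p) * \<alpha> r (snd p) * q r (fst p) (snd p)" for p r
  define A1 where "A1 r u v = c * (\<Sum>y\<in>nbrs u. \<alpha> r u * \<alpha> r v * q r y v - \<alpha> r y * \<alpha> r v * q r u v)" for r u v
  define A2 where "A2 r u v = c * (\<Sum>y\<in>nbrs v. \<alpha> r u * \<alpha> r v * q r u y - \<alpha> r u * \<alpha> r y * q r u v)" for r u v
  define A3 where "A3 r u v = \<alpha> r u * \<alpha> r v * pair_defect \<eta> r u v" for r u v
  define f' where "f' p r = A1 r (fst p) (snd p) + A2 r (fst p) (snd p) + A3 r (fst p) (snd p)" for p r
  have d\<alpha>: "((\<lambda>r. \<alpha> r u) has_real_derivative - (c * (\<Sum>y\<in>nbrs u. \<alpha> r y - \<alpha> r u))) (at r within {0..t})"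
    if "0 \<le> r" "r \<le> t" for r u
  proof -
    have "((\<lambda>s. reach e k s u) has_real_derivative c * (\<Sum>y\<in>nbrs u. \<alpha> r y - \<alpha> r u)) (at (t - r) within (\<lambda>r. t - r) ` {0..t})"
      unfolding c_def \<alpha>_def using that by (intro DERIV_subset[OF reach_has_derivative]) auto
    moreover have "((\<lambda>r. t - r) has_real_derivative -1) (at r within {0..t})"
      by (auto intro!: derivative_eq_intros)
    ultimately have "((\<lambda>r. reach e k (t - r) u) has_real_derivative (c * (\<Sum>y\<in>nbrs u. \<alpha> r y - \<alpha> r u)) * -1) (at r within {0..t})"
      using DERIV_image_chain[of "\<lambda>s. reach e k s u" _ "\<lambda>r. t - r" r "{0..t}" "-1"] by (simp add: o_def)
    then show ?thesis by (simp add: \<alpha>_def)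
  qed
  have df: "(f p has_real_derivative f' p r) (at r within {0..t})" if rr: "0 \<le> r" "r \<le> t" for p r
  proof -
    obtain u v where p: "p = (u, v)" by (cases p)
    let ?a = "\<Sum>y\<in>nbrs u. \<alpha> r y - \<alpha> r u" and ?b = "\<Sum>y\<in>nbrs v. \<alpha> r y - \<alpha> r v"
    let ?Q1 = "\<Sum>y\<in>nbrs u. q r y v - q r u v" and ?Q2 = "\<Sum>y\<in>nbrs v. q r u y - q r u v"
    have dq: "((\<lambda>r. q r u v) has_real_derivative c * (?Q1 + ?Q2) + pair_defect \<eta> r u v) (at r within {0..t})"
      unfolding q_def c_def by (rule DERIV_subset[OF pair_prob_has_derivative'[OF rr(1)]]) auto
    have "((\<lambda>r. \<alpha> r u * \<alpha> r v * q r u v) has_real_derivative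
        (- (c * ?a) * \<alpha> r v + - (c * ?b) * \<alpha> r u) * q r u v + (c * (?Q1 + ?Q2) + pair_defect \<eta> r u v) * (\<alpha> r u * \<alpha> r v))
        (at r within {0..t})"
      by (intro DERIV_mult d\<alpha> rr dq)
    moreover have "A1 r u v = c * (\<alpha> r u * \<alpha> r v * ?Q1 - \<alpha> r v * q r u v * ?a)"
      unfolding A1_def sum_distrib_left sum_subtractf[symmetric]
      by (intro sum.cong refl) (simp add: algebra_simps)
    moreover have "A2 r u v = c * (\<alpha> r u * \<alpha> r v * ?Q2 - \<alpha> r u * q r u v * ?b)"
      unfolding A2_def sum_distrib_left sum_subtractf[symmetric]
      by (intro sum.cong refl) (simp add: algebra_simps)
    moreover have "(- (c * a) * y + - (c * b) * x) * z + (c * (Q1 + Q2) + g) * (x * y) =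
        c * (x * y * Q1 - y * z * a) + c * (x * y * Q2 - x * z * b) + x * y * g" for a b x y z Q1 Q2 g :: real
      by (simp add: algebra_simps)
    ultimately show ?thesis
      unfolding f_def[abs_def] f'_def p fst_conv snd_conv A3_def by (simp only:)
  qed
  have sum_le: "c * (\<Sum>y\<in>nbrs u. x y) \<le> (\<Sum>y\<in>nbrs u. x y)" if "\<And>y. 0 \<le> x y" for u and x :: "'d site \<Rightarrow> real"
    using c that by (intro mult_left_le_one_le sum_nonneg) auto
  have shift: "(\<Sum>a\<in>nbrs 0. W (u + a, v)) = (\<Sum>y\<in>nbrs u. G y * G v)" "(\<Sum>a\<in>nbrs 0. W (u, v + a)) = (\<Sum>y\<in>nbrs v. G u * G y)" for u v
    unfolding sum_nbrs_shift[of _ u] sum_nbrs_shift[of _ v] W_def by simp_all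
  have A1b: "\<bar>A1 r u v\<bar> \<le> (\<Sum>y\<in>nbrs u. G y * G v) + G u * G v" if rr: "0 \<le> r" "r \<le> t" for r u v
  proof -
    have "\<bar>A1 r u v\<bar> \<le> c * (\<Sum>y\<in>nbrs u. \<bar>\<alpha> r u * \<alpha> r v * q r y v - \<alpha> r y * \<alpha> r v * q r u v\<bar>)"
      unfolding A1_def abs_mult using c(1) by (simp add: mult_left_mono sum_abs)
    also have "\<dots> \<le> c * (\<Sum>y\<in>nbrs u. G y * G v + G u * G v)"
    proof (intro mult_left_mono sum_mono)
      fix y
      show "\<bar>\<alpha> r u * \<alpha> r v * q r y v - \<alpha> r y * \<alpha> r v * q r u v\<bar> \<le> G y * G v + G u * G v"
        using \<alpha>q[OF rr, of u v y v] \<alpha>q[OF rr, of y v u v] by linarith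
    qed (use c in auto)
    also have "\<dots> = c * (\<Sum>y\<in>nbrs u. G y * G v) + (c * real (card (nbrs u))) * (G u * G v)"
      by (simp add: sum.distrib algebra_simps)
    also have "\<dots> \<le> (\<Sum>y\<in>nbrs u. G y * G v) + G u * G v"
      using sum_le[of "\<lambda>y. G y * G v" u] G0 by (simp add: c(3))
    finally show ?thesis .
  qed
  have A2b: "\<bar>A2 r u v\<bar> \<le> (\<Sum>y\<in>nbrs v. G u * G y) + G u * G v" if rr: "0 \<le> r" "r \<le> t" for r u v
  proof -
    have "\<bar>A2 r u v\<bar> \<le> c * (\<Sum>y\<in>nbrs v. \<bar>\<alpha> r u * \<alpha> r v * q r u y - \<alpha> r u * \<alpha> r y * q r u v\<bar>)"
      unfolding A2_def abs_mult using c(1) by (simp add: mult_left_mono sum_abs)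
    also have "\<dots> \<le> c * (\<Sum>y\<in>nbrs v. G u * G y + G u * G v)"
    proof (intro mult_left_mono sum_mono)
      fix y
      show "\<bar>\<alpha> r u * \<alpha> r v * q r u y - \<alpha> r u * \<alpha> r y * q r u v\<bar> \<le> G u * G y + G u * G v"
        using \<alpha>q[OF rr, of u v u y] \<alpha>q[OF rr, of u y u v] by linarith
    qed (use c in auto)
    also have "\<dots> = c * (\<Sum>y\<in>nbrs v. G u * G y) + (c * real (card (nbrs v))) * (G u * G v)"
      by (simp add: sum.distrib algebra_simps)
    also have "\<dots> \<le> (\<Sum>y\<in>nbrs v. G u * G y) + G u * G v"
      using sum_le[of "\<lambda>y. G u * G y" v] G0 by (simp add: c(3))
    finally show ?thesis .
  qed
  have A3b: "\<bar>A3 r u v\<bar> \<le> G u * G v + (\<Sum>y\<in>nbrs u. G y * G v) + (\<Sum>y\<in>nbrs v. G u * G y)" if rr: "0 \<le> r" "r \<le> t" for r u v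
  proof -
    have s1: "0 \<le> (\<Sum>y\<in>nbrs u. q r y v)" "(\<Sum>y\<in>nbrs u. q r y v) \<le> (\<Sum>y\<in>nbrs u. G y * G v)"
      using q0 qG rr by (auto intro!: sum_nonneg sum_mono)
    have s2: "0 \<le> (\<Sum>y\<in>nbrs v. q r u y)" "(\<Sum>y\<in>nbrs v. q r u y) \<le> (\<Sum>y\<in>nbrs v. G u * G y)"
      using q0 qG rr by (auto intro!: sum_nonneg sum_mono)
    have s3: "0 \<le> q r u v" "q r u v \<le> G u * G v" using q0 qG rr by auto
    have "\<bar>A3 r u v\<bar> = \<alpha> r u * \<alpha> r v * \<bar>pair_defect \<eta> r u v\<bar>"
      unfolding A3_def abs_mult using \<alpha> by simp
    also have "\<dots> \<le> 1 * \<bar>pair_defect \<eta> r u v\<bar>" using \<alpha>2 by (intro mult_right_mono) auto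
    also have "1 * \<bar>pair_defect \<eta> r u v\<bar> = c * \<bar>(if v \<in> nbrs u then 2 * q r u v else 0)
      - (if u = v then (\<Sum>y\<in>nbrs u. q r y v) + (\<Sum>y\<in>nbrs v. q r u y) else 0)\<bar>"
      using c(1) by (simp add: pair_defect_def abs_mult q_def c_def del: if_distrib)
    also have "\<dots> \<le> c * (2 * (G u * G v + (\<Sum>y\<in>nbrs u. G y * G v) + (\<Sum>y\<in>nbrs v. G u * G y)))"
      using s1 s2 s3 c(1) by (intro mult_left_mono) auto
    also have "\<dots> = (2 * c) * (G u * G v + (\<Sum>y\<in>nbrs u. G y * G v) + (\<Sum>y\<in>nbrs v. G u * G y))" by simp
    also have "\<dots> \<le> G u * G v + (\<Sum>y\<in>nbrs u. G y * G v) + (\<Sum>y\<in>nbrs v. G u * G y)"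
      using c s1 s2 s3 by (intro mult_left_le_one_le) auto
    finally show ?thesis .
  qed
  have f'M: "\<bar>f' p r\<bar> \<le> M p" if rr: "0 \<le> r" "r \<le> t" for p r
  proof -
    obtain u v where p: "p = (u, v)" by (cases p)
    have "M p = 3 * (G u * G v) + 2 * (\<Sum>y\<in>nbrs u. G y * G v) + 2 * (\<Sum>y\<in>nbrs v. G u * G y)"
      unfolding M_def p fst_conv snd_conv shift by (simp add: W_def)
    moreover have "\<bar>f' p r\<bar> \<le> \<bar>A1 r u v\<bar> + \<bar>A2 r u v\<bar> + \<bar>A3 r u v\<bar>"
      unfolding f'_def p fst_conv snd_conv by linarith
    ultimately show ?thesis using A1b[OF rr, of u v] A2b[OF rr, of u v] A3b[OF rr, of u v] by linarith
  qed
  have A3s: "(\<lambda>p. A3 r (fst p) (snd p)) summable_on UNIV"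
  proof (rule summable_on_bound[OF M])
    fix p :: "'d site \<times> 'd site"
    obtain u v where p: "p = (u, v)" by (cases p)
    have "M p = 3 * (G u * G v) + 2 * (\<Sum>y\<in>nbrs u. G y * G v) + 2 * (\<Sum>y\<in>nbrs v. G u * G y)"
      unfolding M_def p fst_conv snd_conv shift by (simp add: W_def)
    moreover have "0 \<le> G u * G v" "0 \<le> (\<Sum>y\<in>nbrs u. G y * G v)" "0 \<le> (\<Sum>y\<in>nbrs v. G u * G y)"
      using G0 by (auto intro: sum_nonneg)
    ultimately show "\<bar>A3 r (fst p) (snd p)\<bar> \<le> M p"
      using A3b[OF r, of u v] unfolding p fst_conv snd_conv by linarith
  qed
  have f: "(\<lambda>p. f p r) summable_on UNIV" if "0 \<le> r" "r \<le> t" for r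
    by (rule summable_on_bound[OF W]) (use \<alpha>q[OF that] in \<open>auto simp: f_def W_def\<close>)
  have inf: "infinite (UNIV :: ('d site \<times> 'd site) set)"
  proof -
    have "inj (\<lambda>n::int. ((\<chi> i. n) :: 'd site, 0 :: 'd site))" by (auto simp: inj_def vec_eq_iff)
    then show ?thesis
      using infinite_UNIV_int by (meson finite_imageD finite_subset subset_UNIV)
  qed
  have der: "((\<lambda>r. \<Sum>\<^sub>\<infinity>p. f p r) has_real_derivative (\<Sum>\<^sub>\<infinity>p. f' p r)) (at r within {0..t})"
    by (rule has_real_derivative_infsum[OF inf _ _ _ _ M]) (use df f f'M r in auto)
  have A1sum: "((\<lambda>p. A1 r (fst p) (snd p)) has_sum 0) UNIV"
  proof -
    define K where "K p a = \<alpha> r (fst p) * \<alpha> r (snd p) * q r (fst p + a) (snd p)" for p :: "'d site \<times> 'd site" and a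
    have "((\<lambda>p. \<Sum>a\<in>nbrs 0. K p a - K (fst p + a, snd p) (- a)) has_sum 0) UNIV"
    proof (rule has_sum_nbrs_exchange[OF bij_add_fst])
      show "(\<lambda>p. K p a) summable_on UNIV" for a
        by (rule summable_on_bound[OF W1[of a]]) (use \<alpha>q[OF r] in \<open>auto simp: K_def W_def\<close>)
    qed
    from has_sum_cmult_right[OF this, of c] show ?thesis
      unfolding A1_def sum_nbrs_shift[of _ "fst _"] K_def by simp
  qed
  have A2sum: "((\<lambda>p. A2 r (fst p) (snd p)) has_sum 0) UNIV"
  proof -
    define K where "K p a = \<alpha> r (fst p) * \<alpha> r (snd p) * q r (fst p) (snd p + a)" for p :: "'d site \<times> 'd site" and a
    have "((\<lambda>p. \<Sum>a\<in>nbrs 0. K p a - K (fst p, snd p + a) (- a)) has_sum 0) UNIV"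
    proof (rule has_sum_nbrs_exchange[OF bij_add_snd])
      show "(\<lambda>p. K p a) summable_on UNIV" for a
        by (rule summable_on_bound[OF W2[of a]]) (use \<alpha>q[OF r] in \<open>auto simp: K_def W_def\<close>)
    qed
    from has_sum_cmult_right[OF this, of c] show ?thesis
      unfolding A2_def sum_nbrs_shift[of _ "snd _"] K_def by simp
  qed
  \<comment> \<open>\<open>H u y - H y u\<close> sums to 0 over all neighbouring pairs, and
    \<open>2 * H u y\<close> is this difference minus \<open>q r u y\<close> times the squared
    increment of \<open>\<alpha>\<close>. This is how the defect turns into a sum of
    squares.\<close>
  define H where "H u y = q r u y * \<alpha> r u * (\<alpha> r y - \<alpha> r u)" for u y
  define X where "X u = 2 * c * (\<Sum>y\<in>nbrs u. H u y)" for u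
  have qc: "q r u v = q r v u" for u v by (simp add: q_def pair_prob_commute[of \<eta> r u v])
  have "(\<Sum>\<^sub>\<infinity>p. A3 r (fst p) (snd p)) = (\<Sum>\<^sub>\<infinity>u. \<Sum>\<^sub>\<infinity>v. A3 r u v)"
    using infsum_Sigma_banach[of "\<lambda>p. A3 r (fst p) (snd p)" UNIV "\<lambda>_. UNIV"] A3s by simp
  also have "\<dots> = (\<Sum>\<^sub>\<infinity>u. X u)"
  proof (rule infsum_cong)
    fix u
    have "(\<Sum>\<^sub>\<infinity>v. A3 r u v) = (\<Sum>\<^sub>\<infinity>v\<in>insert u (nbrs u). A3 r u v)"
      by (rule infsum_cong_neutral) (auto simp: A3_def pair_defect_def)
    also have "\<dots> = A3 r u u + (\<Sum>v\<in>nbrs u. A3 r u v)" by simp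
    also have "A3 r u u = - (\<alpha> r u * \<alpha> r u * (c * (2 * (\<Sum>y\<in>nbrs u. q r u y))))"
      unfolding A3_def pair_defect_def q_def[symmetric] c_def[symmetric] by (simp add: qc[of _ u])
    also have "(\<Sum>v\<in>nbrs u. A3 r u v) = (\<Sum>v\<in>nbrs u. \<alpha> r u * \<alpha> r v * (c * (2 * q r u v)))"
      unfolding A3_def pair_defect_def q_def[symmetric] c_def[symmetric] by (intro sum.cong) auto
    also have "- (\<alpha> r u * \<alpha> r u * (c * (2 * (\<Sum>y\<in>nbrs u. q r u y)))) + (\<Sum>v\<in>nbrs u. \<alpha> r u * \<alpha> r v * (c * (2 * q r u v))) = X u"
      unfolding X_def H_def sum_distrib_left sum_negf[symmetric] sum.distrib[symmetric]
      by (intro sum.cong refl) (simp add: algebra_simps)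
    finally show "(\<Sum>\<^sub>\<infinity>v. A3 r u v) = X u" .
  qed
  also have "\<dots> = - (c * infsum (dissipation \<eta> e k t r) UNIV)"
  proof -
    have E: "((\<lambda>u. \<Sum>y\<in>nbrs u. H u y - H y u) has_sum 0) UNIV"
    proof -
      have "((\<lambda>u. \<Sum>a\<in>nbrs 0. H u (u + a) - H (u + a) (u + a + - a)) has_sum 0) UNIV"
      proof (rule has_sum_nbrs_exchange[OF bij_add_right, where f="\<lambda>u a. H u (u + a)"])
        fix a :: "'d site"
        show "(\<lambda>u. H u (u + a)) summable_on UNIV"
        proof (rule summable_on_bound)
          show "(\<lambda>u. exp t * G u) summable_on UNIV" using Gs by (rule summable_on_cmult_right)
          fix u
          have "\<bar>H u (u + a)\<bar> = q r u (u + a) * (\<alpha> r u * \<bar>\<alpha> r (u + a) - \<alpha> r u\<bar>)"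
            using \<alpha>[of r] q0[OF r(1)] by (simp add: H_def abs_mult)
          also have "\<dots> \<le> q r u (u + a) * 1"
            using \<alpha>[of r u] \<alpha>[of r "u + a"] q0[OF r(1)] by (intro mult_left_mono mult_le_one) auto
          also have "\<dots> \<le> G u * G (u + a)" using qG[OF r] by simp
          also have "\<dots> \<le> G u * exp t"
            using G0 occ_prob_bounds[OF t] by (intro mult_left_mono) (auto simp: G_def)
          finally show "\<bar>H u (u + a)\<bar> \<le> exp t * G u" by (simp add: mult.commute)
        qed
      qed
      moreover have "(\<Sum>y\<in>nbrs u. H u y - H y u) = (\<Sum>a\<in>nbrs 0. H u (u + a) - H (u + a) (u + a + - a))" for u
        using sum_nbrs_shift[of "\<lambda>y. H u y - H y u" u] by simp
      ultimately show ?thesis by (simp only:)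
    qed
    have X: "X u = c * (\<Sum>y\<in>nbrs u. H u y - H y u) + - c * dissipation \<eta> e k t r u" for u
    proof -
      have "c * (\<Sum>y\<in>nbrs u. H u y - H y u) + - c * dissipation \<eta> e k t r u =
        (\<Sum>y\<in>nbrs u. c * (H u y - H y u) + - c * (q r u y * (\<alpha> r u - \<alpha> r y)\<^sup>2))"
        unfolding dissipation_def sum.distrib sum_distrib_left q_def \<alpha>_def ..
      also have "\<dots> = (\<Sum>y\<in>nbrs u. 2 * c * H u y)"
      proof (intro sum.cong refl)
        fix y
        show "c * (H u y - H y u) + - c * (q r u y * (\<alpha> r u - \<alpha> r y)\<^sup>2) = 2 * c * H u y"
          unfolding H_def qc[of y u] by (simp add: power2_eq_square algebra_simps)
      qed
      finally show ?thesis by (simp add: X_def sum_distrib_left)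
    qed
    have "(X has_sum (c * 0 + - c * infsum (dissipation \<eta> e k t r) UNIV)) UNIV"
      unfolding X[abs_def]
      by (intro has_sum_add has_sum_cmult_right E has_sum_infsum dissipation_bound(1)[OF fin r])
    then show ?thesis by (simp add: infsumI)
  qed
  finally have A3v: "(\<Sum>\<^sub>\<infinity>p. A3 r (fst p) (snd p)) = - (c * infsum (dissipation \<eta> e k t r) UNIV)" .
  have "((\<lambda>p. f' p r) has_sum (0 + 0 + (\<Sum>\<^sub>\<infinity>p. A3 r (fst p) (snd p)))) UNIV"
    unfolding f'_def by (intro has_sum_add A1sum A2sum has_sum_infsum A3s)
  then have "(\<Sum>\<^sub>\<infinity>p. f' p r) = - (c * infsum (dissipation \<eta> e k t r) UNIV)"
    using A3v by (simp add: infsumI)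
  then show ?thesis using der by (simp add: f_def \<alpha>_def q_def c_def)
qed

text \<open>\<open>H\<close> only has to grow at least as fast as the integral of the spatial decay
  factor. The dissipation bound then makes \<open>\<Psi> r + H r * R\<close> nondecreasing, so no
  integral has to be formed.\<close>

theorem energy_bound_finite:
  fixes e :: 'd
  assumes fin: "finite {y. \<eta> y}" and t: "0 \<le> t"
    and H: "\<And>r. 0 \<le> r \<Longrightarrow> r \<le> t \<Longrightarrow> (H has_real_derivative H' r) (at r within {0..t})"
    and H': "\<And>r. 0 \<le> r \<Longrightarrow> r \<le> t \<Longrightarrow> (2 / sqrt (1 + r / real CARD('d))) ^ (CARD('d) - 1) \<le> H' r"
    and F: "finite F" "\<And>x. x \<in> F \<Longrightarrow> k \<le> x $ e"
  shows "(\<Sum>x\<in>F. \<Sum>y\<in>F. neg_cov \<eta> t x y) \<le>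
     (\<Sum>y\<in>{y. \<eta> y}. (reach e k t y)\<^sup>2) + (H t - H 0) * layer_mass e \<eta> t (k - 1) * layer_mass e \<eta> t k"
proof -
  define \<Psi> where "\<Psi> r = (\<Sum>\<^sub>\<infinity>p. reach e k (t - r) (fst p) * reach e k (t - r) (snd p) * pair_prob \<eta> r (fst p) (snd p))" for r
  define R where "R = layer_mass e \<eta> t (k - 1) * layer_mass e \<eta> t k"
  define S where "S = {y. \<eta> y}"
  define Z where "Z = (\<Sum>y\<in>S. reach e k t y)"
  have S: "finite S" using fin by (simp add: S_def)
  have "\<Psi> 0 + H 0 * R \<le> \<Psi> t + H t * R"
  proof (rule nondecreasing_from_derivative[where T=t and f="\<lambda>r. \<Psi> r + H r * R"
      and f'="\<lambda>r. - (1 / (2 * real CARD('d)) * infsum (dissipation \<eta> e k t r) UNIV) + H' r * R"])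
    fix r assume r: "0 \<le> r" "r \<le> t"
    show "((\<lambda>r. \<Psi> r + H r * R) has_real_derivative
      - (1 / (2 * real CARD('d)) * infsum (dissipation \<eta> e k t r) UNIV) + H' r * R) (at r within {0..t})"
      unfolding \<Psi>_def by (intro DERIV_add pair_functional_has_derivative[OF fin r] DERIV_cmult_right H r)
    define P where "P = (2 / sqrt (1 + r / real CARD('d))) ^ (CARD('d) - 1)"
    have P0: "0 \<le> P" using r by (simp add: P_def)
    have R0: "0 \<le> R" by (simp add: R_def)
    have "1 / (2 * real CARD('d)) * infsum (dissipation \<eta> e k t r) UNIV \<le> 1 / (2 * real CARD('d)) * (2 * P * R)"
      using dissipation_bound(2)[OF fin r, of e k] by (intro mult_left_mono) (simp_all add: P_def R_def mult.assoc)
    also have "\<dots> = 1 / real CARD('d) * (P * R)" by simp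
    also have "\<dots> \<le> 1 * (P * R)" using P0 R0 by (intro mult_right_mono) auto
    also have "\<dots> \<le> H' r * R" using H'[OF r] R0 by (simp add: P_def mult_right_mono)
    finally show "0 \<le> - (1 / (2 * real CARD('d)) * infsum (dissipation \<eta> e k t r) UNIV) + H' r * R" by simp
  qed (use t in auto)
  moreover have "\<Psi> 0 = Z\<^sup>2 - (\<Sum>y\<in>S. (reach e k t y)\<^sup>2)"
  proof -
    have "\<Psi> 0 = (\<Sum>\<^sub>\<infinity>p\<in>S \<times> S. reach e k t (fst p) * reach e k t (snd p) * of_bool (fst p \<noteq> snd p))"
      unfolding \<Psi>_def by (rule infsum_cong_neutral) (auto simp: pair_prob_0 S_def)
    also have "\<dots> = (\<Sum>u\<in>S. \<Sum>v\<in>S. reach e k t u * reach e k t v * of_bool (u \<noteq> v))"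
      using S by (subst infsum_finite) (simp_all only: sum.cartesian_product case_prod_unfold finite_cartesian_product)
    also have "\<dots> = (\<Sum>u\<in>S. \<Sum>v\<in>S. reach e k t u * reach e k t v - (if u = v then (reach e k t u)\<^sup>2 else 0))"
      by (intro sum.cong) (auto simp: power2_eq_square)
    also have "\<dots> = Z\<^sup>2 - (\<Sum>y\<in>S. (reach e k t y)\<^sup>2)"
      using S by (simp add: sum_subtractf power2_eq_square Z_def sum_product)
    finally show ?thesis .
  qed
  \<comment> \<open>Here \<open>Z\<close> is read as the expected count at time \<open>t\<close>,
    while the formula for \<open>\<Psi> 0\<close> reads it as a sum over initial sites. Restricting
    to \<open>F\<close> drops nonnegative terms only, by
    \<open>negative_correlation\<close>.\<close>
  moreover have "(\<Sum>x\<in>F. \<Sum>y\<in>F. neg_cov \<eta> t x y) \<le> Z\<^sup>2 - \<Psi> t"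
  proof -
    let ?b = "\<lambda>u. of_bool (k \<le> u $ e) :: real"
    have "((\<lambda>u. ?b u * occ_prob \<eta> t u) has_sum Z) UNIV"
      using occ_prob_has_sum_reach[OF fin t, of k e] by (simp add: Z_def S_def)
    from has_sum_product_nonneg[OF this _ this]
    have h1: "((\<lambda>p. (?b (fst p) * occ_prob \<eta> t (fst p)) * (?b (snd p) * occ_prob \<eta> t (snd p))) has_sum Z\<^sup>2) UNIV"
      using occ_prob_bounds[OF t] by (simp add: case_prod_unfold power2_eq_square)
    have \<Psi>t: "\<Psi> t = (\<Sum>\<^sub>\<infinity>p. ?b (fst p) * ?b (snd p) * pair_prob \<eta> t (fst p) (snd p))"
      by (simp add: \<Psi>_def reach_0)
    have s2: "(\<lambda>p. ?b (fst p) * ?b (snd p) * pair_prob \<eta> t (fst p) (snd p)) summable_on UNIV"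
      by (rule summable_on_bound[OF has_sum_imp_summable[OF h1]])
         (use pair_prob_bounds[OF t] negative_correlation[OF t] in \<open>auto simp: of_bool_def\<close>)
    have "((\<lambda>p. (?b (fst p) * occ_prob \<eta> t (fst p)) * (?b (snd p) * occ_prob \<eta> t (snd p))
       + - (?b (fst p) * ?b (snd p) * pair_prob \<eta> t (fst p) (snd p))) has_sum Z\<^sup>2 + - \<Psi> t) UNIV"
      unfolding \<Psi>t using has_sum_infsum[OF s2] by (intro has_sum_add h1) (simp add: has_sum_uminus)
    from finite_sum_le_has_sum[OF this, of "F \<times> F"]
    have "(\<Sum>p\<in>F \<times> F. (?b (fst p) * occ_prob \<eta> t (fst p)) * (?b (snd p) * occ_prob \<eta> t (snd p))
       + - (?b (fst p) * ?b (snd p) * pair_prob \<eta> t (fst p) (snd p))) \<le> Z\<^sup>2 + - \<Psi> t"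
      using F(1) negative_correlation[OF t] by (auto simp: of_bool_def)
    moreover have "(\<Sum>p\<in>F \<times> F. (?b (fst p) * occ_prob \<eta> t (fst p)) * (?b (snd p) * occ_prob \<eta> t (snd p))
       + - (?b (fst p) * ?b (snd p) * pair_prob \<eta> t (fst p) (snd p))) =
       (\<Sum>x\<in>F. \<Sum>y\<in>F. neg_cov \<eta> t x y)"
      unfolding sum.cartesian_product using F(2) by (intro sum.cong) auto
    ultimately show ?thesis by simp
  qed
  ultimately show ?thesis by (simp add: R_def S_def algebra_simps)
qed

end

section \<open>Slowly growing profiles\<close>

text \<open>Eventually \<open>g' \<le> \<epsilon> * g\<close>, which makes
  \<open>(2 * g x + 1) * exp (- \<epsilon> * x)\<close> nonincreasing. A function vanishing on the
  half-line is treated apart, because multiplying out the quotient needs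
  \<open>g > 0\<close>.\<close>

lemma cond_C_growth:
  assumes nonneg: "\<And>u. 0 \<le> u \<Longrightarrow> 0 \<le> g u" and A: "cond_A g" and C: "cond_C g" and eps: "0 < \<epsilon>"
  shows "\<forall>\<^sub>F u in at_top. \<forall>h\<ge>0. 2 * g (u + h) + 1 \<le> exp (\<epsilon> * h) * (2 * g u + 1)"
proof (cases "\<exists>u\<ge>0. g u \<noteq> 0")
  case False
  have "\<forall>\<^sub>F u in at_top. (0::real) \<le> u" by (rule eventually_ge_at_top)
  then show ?thesis
  proof eventually_elim
    case (elim u)
    show ?case
    proof (intro allI impI)
      fix h :: real assume h: "0 \<le> h"
      have "g u = 0" "g (u + h) = 0" using False elim h by auto
      then show "2 * g (u + h) + 1 \<le> exp (\<epsilon> * h) * (2 * g u + 1)" using h eps by simp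
    qed
  qed
next
  case True
  then obtain u1 where "0 \<le> u1" "g u1 \<noteq> 0" by blast
  then have u1: "0 \<le> u1" "0 < g u1" using nonneg[of u1] by auto
  obtain g' where g': "C1_with_deriv g g'" "((\<lambda>u. g' u / g u) \<longlongrightarrow> 0) at_top"
    using C by (auto simp: cond_C_def)
  from tendstoD[OF g'(2) eps] have "\<forall>\<^sub>F u in at_top. \<bar>g' u / g u\<bar> < \<epsilon>"
    by (simp only: dist_real_def diff_0_right)
  then obtain N where N: "\<And>u. N \<le> u \<Longrightarrow> \<bar>g' u / g u\<bar> < \<epsilon>" unfolding eventually_at_top_linorder by blast
  define u0 where "u0 = max 1 (max u1 N)"
  have pos: "0 < g u" if "u0 \<le> u" for u
  proof -
    have "g u1 \<le> g u"
      using A u1 that unfolding cond_A_def u0_def by (intro mono_onD[of "{0..}" g]) auto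
    then show ?thesis using u1 by simp
  qed
  have der: "(g has_real_derivative g' u) (at u)" if "u0 \<le> u" for u
  proof -
    have "(g has_real_derivative g' u) (at u within {0..})"
      using g'(1) that by (auto simp: C1_with_deriv_def u0_def)
    moreover have "at u within {0..} = at u" using that by (intro at_within_interior) (auto simp: u0_def)
    ultimately show ?thesis by simp
  qed
  have "2 * g (u + h) + 1 \<le> exp (\<epsilon> * h) * (2 * g u + 1)" if u: "u0 \<le> u" and h: "0 \<le> h" for u h
  proof -
    define f where "f x = (2 * g x + 1) * exp (- \<epsilon> * x)" for x
    have "f (u + h) \<le> f u"
    proof (rule DERIV_nonpos_imp_nonincreasing[where f=f and a=u and b="u + h"])
      fix x assume x: "u \<le> x" "x \<le> u + h"
      have "(f has_real_derivative (2 * g' x * exp (- \<epsilon> * x) + exp (- \<epsilon> * x) * (- \<epsilon>) * (2 * g x + 1))) (at x)"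
      proof -
        have "((\<lambda>x. 2 * g x + 1) has_real_derivative 2 * g' x) (at x)"
          using der[of x] x u by (auto intro!: derivative_eq_intros)
        moreover have "((\<lambda>x. exp (- \<epsilon> * x)) has_real_derivative exp (- \<epsilon> * x) * (- \<epsilon>)) (at x)"
          by (auto intro!: derivative_eq_intros)
        ultimately show ?thesis unfolding f_def by (rule DERIV_mult)
      qed
      moreover have "g' x \<le> \<epsilon> * g x"
      proof -
        have "\<bar>g' x / g x\<bar> < \<epsilon>" by (rule N) (use x u in \<open>simp add: u0_def\<close>)
        then have "g' x / g x < \<epsilon>" by linarith
        then show ?thesis using pos[of x] x u by (simp add: field_simps)
      qed
      then have "exp (- \<epsilon> * x) * (2 * g' x - \<epsilon> * (2 * g x + 1)) \<le> 0"
        using eps by (intro mult_nonneg_nonpos) (simp_all add: algebra_simps)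
      then have "2 * g' x * exp (- \<epsilon> * x) + exp (- \<epsilon> * x) * (- \<epsilon>) * (2 * g x + 1) \<le> 0"
        by (simp add: algebra_simps)
      ultimately show "\<exists>y. (f has_real_derivative y) (at x) \<and> y \<le> 0" by blast
    qed (use h in simp)
    then have "f (u + h) * exp (\<epsilon> * (u + h)) \<le> f u * exp (\<epsilon> * (u + h))"
      by (intro mult_right_mono) auto
    moreover have "f (u + h) * exp (\<epsilon> * (u + h)) = 2 * g (u + h) + 1"
      unfolding f_def mult.assoc by (simp add: mult_exp_exp)
    moreover have "f u * exp (\<epsilon> * (u + h)) = exp (\<epsilon> * h) * (2 * g u + 1)"
    proof -
      have "exp (- \<epsilon> * u) * exp (\<epsilon> * (u + h)) = exp (\<epsilon> * h)"
        by (simp add: mult_exp_exp algebra_simps)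
      then show ?thesis unfolding f_def mult.assoc by (simp only: mult.commute)
    qed
    ultimately show ?thesis by simp
  qed
  then show ?thesis unfolding eventually_at_top_linorder by blast
qed

text \<open>With \<open>k\<close> the floor of \<open>b\<close> the count is
  \<open>2 * k + 1\<close>; the 3 comes from
  \<open>2 * b + 1 < 2 * k + 3 \<le> 3 * (2 * k + 1)\<close>.\<close>

lemma card_int_abs_le:
  fixes b :: real
  assumes "0 \<le> b"
  shows "finite {n::int. \<bar>real_of_int n\<bar> \<le> b}"
    and "real (card {n::int. \<bar>real_of_int n\<bar> \<le> b}) \<le> 2 * b + 1"
    and "2 * b + 1 \<le> 3 * real (card {n::int. \<bar>real_of_int n\<bar> \<le> b})"
proof -
  define k where "k = \<lfloor>b\<rfloor>"
  have k: "0 \<le> k" "real_of_int k \<le> b" "b < real_of_int k + 1" using assms by (simp_all add: k_def)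
  have iff: "\<bar>real_of_int n\<bar> \<le> b \<longleftrightarrow> \<bar>n\<bar> \<le> k" for n
    by (simp only: k_def le_floor_iff of_int_abs)
  have eq: "{n::int. \<bar>real_of_int n\<bar> \<le> b} = {- k..k}"
    unfolding iff by (auto simp: abs_le_iff)
  have c: "real (card {- k..k}) = 2 * real_of_int k + 1"
    using k(1) by simp
  show "finite {n::int. \<bar>real_of_int n\<bar> \<le> b}" unfolding eq by simp
  show "real (card {n::int. \<bar>real_of_int n\<bar> \<le> b}) \<le> 2 * b + 1"
    unfolding eq c using k by simp
  have "0 \<le> real_of_int k" using k(1) by simp
  then show "2 * b + 1 \<le> 3 * real (card {n::int. \<bar>real_of_int n\<bar> \<le> b})"
    unfolding eq c using k(3) by simp
qed

section \<open>Growth of the cross-section and of the layer sizes\<close>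

locale profile_functions =
  fixes e :: "'d::finite" and g :: "'d \<Rightarrow> real \<Rightarrow> real"
  assumes g_nonneg: "\<And>i u. i \<noteq> e \<Longrightarrow> 0 \<le> u \<Longrightarrow> 0 \<le> g i u"
    and g_mono: "\<And>i. i \<noteq> e \<Longrightarrow> cond_A (g i)"
    and g_slow: "\<And>i. i \<noteq> e \<Longrightarrow> cond_C (g i)"
begin

abbreviation G :: "real \<Rightarrow> real" where
  "G \<equiv> cross_section e g"

lemma G_ge_1: "0 \<le> u \<Longrightarrow> 1 \<le> G u"
  unfolding cross_section_def by (intro prod_ge_1) (simp add: g_nonneg)

lemma G_mono: "0 \<le> u \<Longrightarrow> u \<le> v \<Longrightarrow> G u \<le> G v"
  unfolding cross_section_def
proof (intro prod_mono conjI)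
  fix i assume uv: "0 \<le> u" "u \<le> v" and i: "i \<in> UNIV - {e}"
  show "0 \<le> 2 * g i u + 1" using g_nonneg[of i u] i uv by simp
  have "g i u \<le> g i v" using g_mono[of i] i uv unfolding cond_A_def by (intro mono_onD[of "{0..}" "g i"]) auto
  then show "2 * g i u + 1 \<le> 2 * g i v + 1" by simp
qed

lemma G_growth:
  assumes "0 < \<epsilon>"
  shows "\<forall>\<^sub>F u in at_top. \<forall>h\<ge>0. G (u + h) \<le> exp (\<epsilon> * h) * G u"
proof -
  define \<delta> where "\<delta> = \<epsilon> / real CARD('d)"
  have \<delta>: "0 < \<delta>" using assms by (simp add: \<delta>_def)
  have "\<forall>\<^sub>F u in at_top. \<forall>i\<in>UNIV - {e}. \<forall>h\<ge>0. 2 * g i (u + h) + 1 \<le> exp (\<delta> * h) * (2 * g i u + 1)"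
  proof (intro eventually_ball_finite ballI)
    fix i assume "i \<in> UNIV - {e}"
    then have i: "i \<noteq> e" by simp
    show "\<forall>\<^sub>F u in at_top. \<forall>h\<ge>0. 2 * g i (u + h) + 1 \<le> exp (\<delta> * h) * (2 * g i u + 1)"
      by (rule cond_C_growth[OF g_nonneg[OF i] g_mono[OF i] g_slow[OF i] \<delta>])
  qed simp
  moreover have "\<forall>\<^sub>F u in at_top. (0::real) \<le> u" by (rule eventually_ge_at_top)
  ultimately show ?thesis
  proof eventually_elim
    case (elim u)
    show ?case
    proof (intro allI impI)
      fix h :: real assume h: "0 \<le> h"
      have "G (u + h) \<le> (\<Prod>i\<in>UNIV - {e}. exp (\<delta> * h) * (2 * g i u + 1))"
        unfolding cross_section_def
      proof (intro prod_mono conjI)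
        fix i assume i: "i \<in> UNIV - {e}"
        show "0 \<le> 2 * g i (u + h) + 1" using g_nonneg[of i "u + h"] i h elim(2) by simp
        show "2 * g i (u + h) + 1 \<le> exp (\<delta> * h) * (2 * g i u + 1)" using elim(1) i h by blast
      qed
      also have "\<dots> = exp (\<delta> * h) ^ (CARD('d) - 1) * G u"
        by (simp add: prod.distrib cross_section_def card_Diff_singleton)
      also have "\<dots> \<le> exp (\<epsilon> * h) * G u"
      proof (rule mult_right_mono)
        have "exp (\<delta> * h) ^ (CARD('d) - 1) \<le> exp (\<delta> * h) ^ CARD('d)"
          using \<delta> h by (intro power_increasing) auto
        also have "\<dots> = exp (\<epsilon> * h)" by (simp add: exp_of_nat_mult[symmetric] \<delta>_def)
        finally show "exp (\<delta> * h) ^ (CARD('d) - 1) \<le> exp (\<epsilon> * h)" .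
      qed (use G_ge_1[of u] elim in auto)
      finally show "G (u + h) \<le> exp (\<epsilon> * h) * G u" .
    qed
  qed
qed

text \<open>Far out this is slow growth; on the remaining bounded range monotonicity bounds the left
  side and \<open>G \<ge> 1\<close> the right side.\<close>

lemma G_step: "\<exists>C\<ge>0. \<forall>u\<ge>0. G (u + 1) \<le> C * G u"
proof -
  from G_growth[of 1] obtain u0 where u0: "\<And>u. u0 \<le> u \<Longrightarrow> G (u + 1) \<le> exp 1 * G u"
    by (force simp: eventually_at_top_linorder)
  have "G (u + 1) \<le> (exp 1 + G (max 0 u0 + 1)) * G u" if u: "0 \<le> u" for u
  proof (cases "u0 \<le> u")
    case True
    have "exp 1 * G u \<le> (exp 1 + G (max 0 u0 + 1)) * G u"
      using G_ge_1[OF u] G_ge_1[of "max 0 u0 + 1"] by (intro mult_right_mono) auto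
    then show ?thesis using u0[OF True] by simp
  next
    case False
    have "G (u + 1) \<le> G (max 0 u0 + 1) * 1" using False u by (simp add: G_mono)
    also have "\<dots> \<le> (exp 1 + G (max 0 u0 + 1)) * G u"
      using G_ge_1[OF u] G_ge_1[of "max 0 u0 + 1"] by (intro mult_mono) auto
    finally show ?thesis .
  qed
  moreover have "0 \<le> exp 1 + G (max 0 u0 + 1)"
    using G_ge_1[of "max 0 u0 + 1"] by (intro add_nonneg_nonneg) auto
  ultimately show ?thesis by blast
qed

definition layer :: "nat \<Rightarrow> 'd site set" where
  "layer m = {y \<in> profile_region e g. y $ e = - int m}"

definition L :: "nat \<Rightarrow> real" where
  "L m = real (card (layer m))"

lemma layer_eq:
  "layer m = vec_lambda ` (\<Pi>\<^sub>E i\<in>UNIV. if i = e then {- int m} else {n::int. \<bar>real_of_int n\<bar> \<le> g i (real m)})"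
proof (intro set_eqI iffI)
  fix y assume "y \<in> layer m"
  then have "vec_nth y \<in> (\<Pi>\<^sub>E i\<in>UNIV. if i = e then {- int m} else {n::int. \<bar>real_of_int n\<bar> \<le> g i (real m)})"
    by (auto simp: layer_def profile_region_def)
  then show "y \<in> vec_lambda ` (\<Pi>\<^sub>E i\<in>UNIV. if i = e then {- int m} else {n::int. \<bar>real_of_int n\<bar> \<le> g i (real m)})"
    by (intro image_eqI[of _ _ "vec_nth y"]) auto
next
  fix y assume "y \<in> vec_lambda ` (\<Pi>\<^sub>E i\<in>UNIV. if i = e then {- int m} else {n::int. \<bar>real_of_int n\<bar> \<le> g i (real m)})"
  then obtain f where y: "y = vec_lambda f"
    and f: "\<And>i. f i \<in> (if i = e then {- int m} else {n::int. \<bar>real_of_int n\<bar> \<le> g i (real m)})"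
    by (auto simp: PiE_iff)
  have "f e = - int m" using f[of e] by simp
  moreover have "\<bar>real_of_int (f i)\<bar> \<le> g i (real m)" if "i \<noteq> e" for i using f[of i] that by simp
  ultimately show "y \<in> layer m" by (simp add: y layer_def profile_region_def)
qed

lemma finite_layer: "finite (layer m)"
  unfolding layer_eq using g_nonneg by (intro finite_imageI finite_PiE) (auto intro: card_int_abs_le)

lemma L_eq: "L m = (\<Prod>i\<in>UNIV - {e}. real (card {n::int. \<bar>real_of_int n\<bar> \<le> g i (real m)}))"
proof -
  have "card (layer m) = (\<Prod>i\<in>UNIV. card (if i = e then {- int m} else {n::int. \<bar>real_of_int n\<bar> \<le> g i (real m)}))"
    unfolding layer_eq by (subst card_image) (auto simp: inj_on_def vec_lambda_inject card_PiE)
  also have "\<dots> = (\<Prod>i\<in>UNIV - {e}. card {n::int. \<bar>real_of_int n\<bar> \<le> g i (real m)})"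
    by (subst prod.remove[of _ e]) (auto intro!: prod.cong)
  finally show ?thesis by (simp add: L_def)
qed

lemma L_le_G: "L m \<le> G (real m)"
  unfolding L_eq cross_section_def using g_nonneg by (intro prod_mono) (auto intro: card_int_abs_le)

lemma G_le_L: "G (real m) \<le> 3 ^ CARD('d) * L m"
proof -
  have "G (real m) \<le> (\<Prod>i\<in>UNIV - {e}. 3 * real (card {n::int. \<bar>real_of_int n\<bar> \<le> g i (real m)}))"
    unfolding cross_section_def using g_nonneg by (intro prod_mono) (auto intro: card_int_abs_le)
  also have "\<dots> = 3 ^ (CARD('d) - 1) * L m" by (simp add: prod.distrib L_eq card_Diff_singleton)
  also have "\<dots> \<le> 3 ^ CARD('d) * L m" by (intro mult_right_mono power_increasing) (auto simp: L_def)
  finally show ?thesis .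
qed

lemma L_ge_1: "1 \<le> L m"
proof -
  have "(\<chi> i. if i = e then - int m else 0) \<in> layer m"
    using g_nonneg by (auto simp: layer_def profile_region_def)
  then have "card (layer m) \<noteq> 0" using finite_layer by auto
  then show ?thesis by (simp add: L_def)
qed

lemma L_step: "\<exists>C\<ge>0. \<forall>m. L (Suc m) \<le> C * L m"
proof -
  from G_step obtain C where C0: "0 \<le> C" and C: "\<And>u. 0 \<le> u \<Longrightarrow> G (u + 1) \<le> C * G u" by blast
  have "L (Suc m) \<le> (C * 3 ^ CARD('d)) * L m" for m
  proof -
    have "L (Suc m) \<le> G (real m + 1)" using L_le_G[of "Suc m"] by (simp add: add.commute)
    also have "\<dots> \<le> C * G (real m)" by (rule C) simp
    also have "\<dots> \<le> C * (3 ^ CARD('d) * L m)" by (rule mult_left_mono[OF G_le_L C0])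
    finally show ?thesis by simp
  qed
  then show ?thesis using C0 by (intro exI[of _ "C * 3 ^ CARD('d)"]) auto
qed

text \<open>Growth at rate \<open>1 / J\<close> costs at most a factor \<open>exp 1\<close> over
  fewer than \<open>J\<close> layers; \<open>3 ^ CARD('d)\<close> pays for passing from
  \<open>G\<close> back to the integer count. Since \<open>m0 \<ge> J\<close>, the difference
  \<open>m - j\<close> is never truncated.\<close>

lemma L_slow:
  assumes "0 < J"
  shows "\<exists>m0\<ge>J. \<forall>m\<ge>m0. \<forall>j<J. L m \<le> exp 1 * 3 ^ CARD('d) * L (m - j)"
proof -
  from G_growth[of "1 / real J"] assms
  obtain u0 where u0: "\<And>u h. u0 \<le> u \<Longrightarrow> 0 \<le> h \<Longrightarrow> G (u + h) \<le> exp (1 / real J * h) * G u"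
    by (force simp: eventually_at_top_linorder)
  show ?thesis
  proof (intro exI[of _ "J + nat \<lceil>u0\<rceil>"] conjI allI impI)
    fix m j assume m: "J + nat \<lceil>u0\<rceil> \<le> m" and j: "j < J"
    have "u0 \<le> real (nat \<lceil>u0\<rceil>)" by linarith
    also have "\<dots> \<le> real (m - j)" using m j by simp
    finally have "G (real (m - j) + real j) \<le> exp (1 / real J * real j) * G (real (m - j))"
      by (intro u0) auto
    also have "\<dots> \<le> exp 1 * G (real (m - j))"
      using j G_ge_1[of "real (m - j)"] by (intro mult_right_mono) auto
    also have "\<dots> \<le> exp 1 * (3 ^ CARD('d) * L (m - j))" by (intro mult_left_mono G_le_L) auto
    finally have "G (real (m - j) + real j) \<le> exp 1 * 3 ^ CARD('d) * L (m - j)" by simp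
    moreover have "real (m - j) + real j = real m" using m j by simp
    ultimately show "L m \<le> exp 1 * 3 ^ CARD('d) * L (m - j)" using L_le_G[of m] by simp
  qed simp
qed

section \<open>Finite truncations by whole layers, and the particle density at the front\<close>

definition truncated :: "nat \<Rightarrow> 'd config" where
  "truncated M y \<longleftrightarrow> profile e g y \<and> - int M \<le> y $ e"

lemma truncated_eq: "{y. truncated M y} = (\<Union>m\<in>{..M}. layer m)"
proof (intro set_eqI iffI)
  fix y assume "y \<in> {y. truncated M y}"
  then have y: "y \<in> profile_region e g" "- int M \<le> y $ e" "y $ e \<le> 0"
    by (auto simp: truncated_def profile_def profile_region_def)
  then have "y \<in> layer (nat (- (y $ e)))" "nat (- (y $ e)) \<le> M" by (auto simp: layer_def)
  then show "y \<in> (\<Union>m\<in>{..M}. layer m)" by blast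
qed (auto simp: truncated_def profile_def layer_def)

lemma finite_truncated: "finite {y. truncated M y}"
  unfolding truncated_eq using finite_layer by auto

lemma sum_truncated:
  fixes f :: "int \<Rightarrow> real"
  shows "(\<Sum>y\<in>{y. truncated M y}. f (y $ e)) = (\<Sum>m\<le>M. L m * f (- int m))"
proof -
  have "(\<Sum>y\<in>{y. truncated M y}. f (y $ e)) = (\<Sum>m\<le>M. \<Sum>y\<in>layer m. f (y $ e))"
    unfolding truncated_eq using finite_layer by (subst sum.UNION_disjoint) (auto simp: layer_def)
  also have "\<dots> = (\<Sum>m\<le>M. L m * f (- int m))"
    by (intro sum.cong refl) (simp add: L_def layer_def)
  finally show ?thesis .
qed

lemma layer_mass_truncated:
  "layer_mass e (truncated M) t k = (\<Sum>m\<le>M. L m * walk (t / real CARD('d)) (k + int m))"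
  unfolding layer_mass_def using sum_truncated[of "\<lambda>n. walk (t / real CARD('d)) (k - n)" M] by simp

lemma reach_truncated:
  "(\<Sum>y\<in>{y. truncated M y}. reach e k t y) = (\<Sum>m\<le>M. L m * tail (t / real CARD('d)) (k + int m))"
  unfolding reach_def using sum_truncated[of "\<lambda>n. tail (t / real CARD('d)) (k - n)" M] by simp

text \<open>The expected number of particles of the full profile in the layer \<open>{x. x $ e = k}\<close>.\<close>

definition front_density :: "real \<Rightarrow> int \<Rightarrow> real" where
  "front_density s k = (\<Sum>m. L m * walk s (k + int m))"

lemma tail_antimono: "tail s (n + int j) \<le> tail s n"
proof (induction j)
  case (Suc j)
  have "tail s (n + int j + 1) \<le> tail s (n + int j)"
    using tail_diff[of s "n + int j"] walk_nonneg[of s "n + int j"] by linarith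
  moreover have "n + int (Suc j) = n + int j + 1" by simp
  ultimately show ?case using Suc by (simp only:)
qed simp

lemma sum_walk_eq_tail: "(\<Sum>j<J. walk s (n + int j)) = tail s n - tail s (n + int J)"
proof (induction J)
  case (Suc J)
  then show ?case using tail_diff[of s "n + int J"] by (simp add: algebra_simps)
qed simp

lemma walk_le_tail: "walk s n \<le> tail s n"
  using tail_diff[of s n] tail_bounds[of s "n + 1"] by linarith

lemma front_density_sums:
  assumes K: "\<And>M. (\<Sum>m\<le>M. L m * tail s (k + int m)) \<le> K"
  shows "(\<lambda>m. L m * walk s (k + int m)) sums front_density s k"
proof -
  have "summable (\<lambda>m. L m * walk s (k + int m))"
  proof (rule summableI_nonneg_bounded)
    show "0 \<le> L m * walk s (k + int m)" for m by (simp add: L_def)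
    fix n
    have "(\<Sum>m<n. L m * walk s (k + int m)) \<le> (\<Sum>m\<le>n. L m * tail s (k + int m))"
      by (rule order_trans[OF sum_mono sum_mono2]) (auto intro!: mult_left_mono walk_le_tail simp: L_def tail_bounds)
    also have "\<dots> \<le> K" by (rule K)
    finally show "(\<Sum>m<n. L m * walk s (k + int m)) \<le> K" .
  qed
  then show ?thesis unfolding front_density_def by (rule summable_sums)
qed

lemma partial_sum_le_front_density:
  assumes K: "\<And>M. (\<Sum>m\<le>M. L m * tail s (k + int m)) \<le> K"
  shows "(\<Sum>m\<le>M. L m * walk s (k + int m)) \<le> front_density s k"
  unfolding front_density_def
  by (rule sum_le_suminf[OF sums_summable[OF front_density_sums[OF K]]]) (auto simp: L_def)

text \<open>Every layer of the profile contains a site, so one particle per layer already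
  contributes the kernel values that add up to the tail. In the energy bound this makes the largest
  reaching probability as small as the front density.\<close>

lemma tail_le_front_density:
  assumes K: "\<And>M. (\<Sum>m\<le>M. L m * tail s (k + int m)) \<le> K"
  shows "tail s k \<le> front_density s k"
proof -
  have "((\<lambda>n. pmf (ctrw_pmf 0 s) n * indicator {k..} n) has_sum tail s k) UNIV"
    unfolding tail_def by (rule pmf_has_sum[of _ 1]) (auto simp: indicator_def)
  then show ?thesis
  proof (rule has_sum_le_finite_sums)
    fix F :: "int set" assume F: "finite F"
    have "\<exists>J. F \<inter> {k..} \<subseteq> (\<lambda>j. k + int j) ` {..J}"
    proof -
      obtain N where N: "\<And>n. n \<in> F \<Longrightarrow> n \<le> N" using F by (metis Max_ge)
      have "F \<inter> {k..} \<subseteq> (\<lambda>j. k + int j) ` {..nat (N - k)}"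
      proof
        fix n assume "n \<in> F \<inter> {k..}"
        then have "n = k + int (nat (n - k))" "nat (n - k) \<le> nat (N - k)" using N by (auto intro!: nat_mono)
        then show "n \<in> (\<lambda>j. k + int j) ` {..nat (N - k)}" by blast
      qed
      then show ?thesis by blast
    qed
    then obtain J where J: "F \<inter> {k..} \<subseteq> (\<lambda>j. k + int j) ` {..J}" by blast
    have "(\<Sum>n\<in>F. pmf (ctrw_pmf 0 s) n * indicator {k..} n) = (\<Sum>n\<in>F \<inter> {k..}. walk s n)"
      using F by (simp add: walk_def sum.If_cases indicator_def Int_def)
    also have "\<dots> \<le> (\<Sum>n\<in>(\<lambda>j. k + int j) ` {..J}. walk s n)"
      using J by (intro sum_mono2) auto
    also have "\<dots> = (\<Sum>j\<le>J. 1 * walk s (k + int j))"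
      by (subst sum.reindex) (auto simp: inj_on_def)
    also have "\<dots> \<le> (\<Sum>j\<le>J. L j * walk s (k + int j))"
      by (intro sum_mono mult_right_mono L_ge_1) auto
    also have "\<dots> \<le> front_density s k" by (rule partial_sum_le_front_density[OF K])
    finally show "(\<Sum>n\<in>F. pmf (ctrw_pmf 0 s) n * indicator {k..} n) \<le> front_density s k" .
  qed
qed

text \<open>Slow growth makes the expected layer counts nearly constant over \<open>J\<close> consecutive layers,
  so a bound \<open>K\<close> on the total forces each of them to be of order \<open>K / J\<close>.\<close>

lemma front_density_le:
  assumes J: "0 < J"
  obtains B where "\<And>s k K. 0 \<le> s \<Longrightarrow> (\<And>M. (\<Sum>m\<le>M. L m * tail s (k + int m)) \<le> K) \<Longrightarrow>
     front_density s k \<le> B * (2 / sqrt (1 + s)) + exp 1 * 3 ^ CARD('d) * K / real J"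
proof -
  obtain m0 where m0: "J \<le> m0" "\<And>m j. m0 \<le> m \<Longrightarrow> j < J \<Longrightarrow> L m \<le> exp 1 * 3 ^ CARD('d) * L (m - j)"
    using L_slow[OF J] by blast
  define C :: real where "C = exp 1 * 3 ^ CARD('d)"
  have C0: "0 < C" by (simp add: C_def)
  show ?thesis
  proof (rule that[of "\<Sum>m<m0. L m"])
    fix s :: real and k K assume s: "0 \<le> s" and K: "\<And>M. (\<Sum>m\<le>M. L m * tail s (k + int m)) \<le> K"
    have "(\<Sum>m<n. L m * walk s (k + int m)) \<le> (\<Sum>m<m0. L m) * (2 / sqrt (1 + s)) + C * K / real J" for n
    proof -
      have "(\<Sum>m<n. L m * walk s (k + int m)) \<le> (\<Sum>m<m0 + n. L m * walk s (k + int m))"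
        by (intro sum_mono2) (auto simp: L_def)
      also have "\<dots> = (\<Sum>m<m0. L m * walk s (k + int m)) + (\<Sum>m=m0..<m0 + n. L m * walk s (k + int m))"
        by (simp add: lessThan_atLeast0 sum.atLeastLessThan_concat)
      \<comment> \<open>For depths below \<open>m0\<close> slow growth is not yet available, but
        these are finitely many layers, each with a kernel value of order
        \<open>1 / sqrt (1 + s)\<close>.\<close>
      also have "(\<Sum>m<m0. L m * walk s (k + int m)) \<le> (\<Sum>m<m0. L m * (2 / sqrt (1 + s)))"
        using s by (intro sum_mono mult_left_mono walk_le) (auto simp: L_def)
      also have "\<dots> = (\<Sum>m<m0. L m) * (2 / sqrt (1 + s))" by (rule sum_distrib_right[symmetric])
      also have "(\<Sum>m=m0..<m0 + n. L m * walk s (k + int m)) \<le> C * K / real J"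
      proof -
        \<comment> \<open>Each deep layer is compared with the layers at depth \<open>m - j\<close>
          for \<open>j < J\<close>. After renaming the depth, the kernel values for the various
          \<open>j\<close> sit at consecutive points, so their sum is at most the tail there and the
          bound \<open>K\<close> applies once.\<close>
        have "real J * (\<Sum>m=m0..<m0 + n. L m * walk s (k + int m)) =
           (\<Sum>j<J. \<Sum>m=m0..<m0 + n. L m * walk s (k + int m))" by simp
        also have "\<dots> \<le> (\<Sum>j<J. \<Sum>m=m0..<m0 + n. C * (L (m - j) * walk s (k + int m)))"
        proof (intro sum_mono)
          fix j m assume "j \<in> {..<J}" "m \<in> {m0..<m0 + n}"
          then have "L m \<le> C * L (m - j)" using m0(2) by (auto simp: C_def)
          then have "L m * walk s (k + int m) \<le> C * L (m - j) * walk s (k + int m)" by (intro mult_right_mono) auto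
          then show "L m * walk s (k + int m) \<le> C * (L (m - j) * walk s (k + int m))" by (simp add: mult.assoc)
        qed
        also have "\<dots> = C * (\<Sum>j<J. \<Sum>m=m0..<m0 + n. L (m - j) * walk s (k + int m))"
          by (simp add: sum_distrib_left)
        also have "\<dots> \<le> C * (\<Sum>j<J. \<Sum>m\<le>m0 + n. L m * walk s (k + int m + int j))"
        proof (intro mult_left_mono sum_mono)
          fix j assume j: "j \<in> {..<J}"
          have "(\<Sum>m=m0..<m0 + n. L (m - j) * walk s (k + int m)) =
              (\<Sum>m\<in>(\<lambda>m. m - j) ` {m0..<m0 + n}. L m * walk s (k + int m + int j))"
            using j m0(1) by (subst sum.reindex) (auto simp: inj_on_def of_nat_diff intro!: sum.cong)
          also have "\<dots> \<le> (\<Sum>m\<le>m0 + n. L m * walk s (k + int m + int j))"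
            by (intro sum_mono2) (auto simp: L_def)
          finally show "(\<Sum>m=m0..<m0 + n. L (m - j) * walk s (k + int m)) \<le> (\<Sum>m\<le>m0 + n. L m * walk s (k + int m + int j))" .
        qed (use C0 in auto)
        also have "(\<Sum>j<J. \<Sum>m\<le>m0 + n. L m * walk s (k + int m + int j)) =
            (\<Sum>m\<le>m0 + n. L m * (\<Sum>j<J. walk s (k + int m + int j)))"
          by (subst sum.swap) (simp add: sum_distrib_left)
        also have "\<dots> \<le> (\<Sum>m\<le>m0 + n. L m * tail s (k + int m))"
          using tail_bounds by (intro sum_mono mult_left_mono) (auto simp: sum_walk_eq_tail L_def)
        also have "\<dots> \<le> K" by (rule K)
        finally have "real J * (\<Sum>m=m0..<m0 + n. L m * walk s (k + int m)) \<le> C * K" using C0 by simp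
        then show ?thesis using J by (simp add: field_simps)
      qed
      finally show ?thesis by simp
    qed
    moreover have "(\<lambda>n. \<Sum>m<n. L m * walk s (k + int m)) \<longlonglongrightarrow> front_density s k"
      using front_density_sums[OF K] by (simp add: sums_def)
    ultimately show "front_density s k \<le> (\<Sum>m<m0. L m) * (2 / sqrt (1 + s)) + exp 1 * 3 ^ CARD('d) * K / real J"
      unfolding C_def by (intro LIMSEQ_le_const2) auto
  qed
qed

text \<open>At the point \<open>k + m\<close> the argument of \<open>G\<close> lies between
  \<open>m\<close> and \<open>m + 1\<close>, so the integrand of the tail moment is at least
  \<open>L m\<close> there.\<close>

lemma front_density_le_walk_tail_moment:
  assumes K: "\<And>M. (\<Sum>m\<le>M. L m * tail s (\<lfloor>a\<rfloor> + 1 + int m)) \<le> K"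
  shows "front_density s (\<lfloor>a\<rfloor> + 1) \<le> walk_tail_moment e g a s"
proof -
  define k where "k = \<lfloor>a\<rfloor> + 1"
  define f where "f n = G (real_of_int n - a) * of_bool (real_of_int n > a)" for n
  have k: "a < real_of_int k" "real_of_int k \<le> a + 1" by (simp_all add: k_def)
  have f0: "f n = 0" if "n < k" for n
  proof -
    have "n \<le> \<lfloor>a\<rfloor>" using that by (simp add: k_def)
    then have "real_of_int n \<le> a" by (simp only: le_floor_iff)
    then show ?thesis by (simp add: f_def)
  qed
  have f1: "f n = G (real_of_int n - a)" "real m \<le> real_of_int n - a" "real_of_int n - a \<le> real m + 1"
    if "n = k + int m" for n m
    using that k by (auto simp: f_def)
  obtain C where C0: "0 \<le> C" and C: "\<And>u. 0 \<le> u \<Longrightarrow> G (u + 1) \<le> C * G u" using G_step by blast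
  \<comment> \<open>The upper bound secures integrability: a non-integrable integrand would have
    expectation 0 by default, and no lower bound on the tail moment could follow.\<close>
  have f_le: "f (k + int m) \<le> C * 3 ^ CARD('d) * L m" for m
  proof -
    have "f (k + int m) \<le> G (real m + 1)"
      using f1[of "k + int m" m] by (simp add: G_mono)
    also have "\<dots> \<le> C * G (real m)" by (rule C) simp
    also have "\<dots> \<le> C * (3 ^ CARD('d) * L m)" by (rule mult_left_mono[OF G_le_L C0])
    finally show ?thesis by simp
  qed
  have f_ge: "L m \<le> f (k + int m)" for m
    using L_le_G[of m] f1[of "k + int m" m] G_mono[of "real m" "real_of_int (k + int m) - a"] by simp
  have fnn: "0 \<le> f n" for n
  proof (cases "n < k")
    case False
    then have "n = k + int (nat (n - k))" by simp
    then show ?thesis using f_ge[of "nat (n - k)"] L_ge_1[of "nat (n - k)"] by simp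
  qed (simp add: f0)
  have sums: "(\<lambda>m. L m * walk s (k + int m)) sums front_density s k"
    using front_density_sums[OF K] by (simp add: k_def)
  have "((\<lambda>m. walk s (k + int m) * f (k + int m))) summable_on UNIV"
  proof (rule summable_on_bound)
    have "summable (\<lambda>m. C * 3 ^ CARD('d) * (L m * walk s (k + int m)))"
      using sums by (intro summable_mult) (rule sums_summable)
    then show "(\<lambda>m. C * 3 ^ CARD('d) * (L m * walk s (k + int m))) summable_on UNIV"
      using C0 by (subst summable_on_UNIV_nonneg_real_iff) (auto simp: L_def)
    fix m
    have "walk s (k + int m) * f (k + int m) \<le> walk s (k + int m) * (C * 3 ^ CARD('d) * L m)"
      by (intro mult_left_mono f_le) simp
    then show "\<bar>walk s (k + int m) * f (k + int m)\<bar> \<le> C * 3 ^ CARD('d) * (L m * walk s (k + int m))"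
      using fnn by (simp add: mult_ac)
  qed
  then have "(\<lambda>n. walk s n * f n) summable_on (\<lambda>m. k + int m) ` UNIV"
    by (subst summable_on_reindex) (auto simp: inj_on_def o_def)
  moreover have "(\<lambda>n. walk s n * f n) summable_on (\<lambda>m. k + int m) ` UNIV \<longleftrightarrow> (\<lambda>n. walk s n * f n) summable_on UNIV"
  proof (rule summable_on_cong_neutral)
    fix n assume "n \<in> UNIV - (\<lambda>m. k + int m) ` UNIV"
    have "n < k"
    proof (rule ccontr)
      assume "\<not> n < k"
      then have "n = k + int (nat (n - k))" by simp
      then show False using \<open>n \<in> UNIV - _\<close> by blast
    qed
    then show "walk s n * f n = 0" by (simp add: f0)
  qed auto
  ultimately have summ: "(\<lambda>n. walk s n * f n) summable_on UNIV" by simp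
  have "walk_tail_moment e g a s = infsum (\<lambda>n. walk s n * f n) UNIV"
  proof -
    have "Infinite_Sum.abs_summable_on (\<lambda>n. walk s n * f n) UNIV"
      using summ fnn by simp
    then have "Infinite_Set_Sum.abs_summable_on (\<lambda>n. walk s n * f n) UNIV"
      by (simp only: abs_summable_equivalent)
    then have "infsetsum (\<lambda>n. walk s n * f n) UNIV = infsum (\<lambda>n. walk s n * f n) UNIV"
      by (rule infsetsum_infsum)
    then show ?thesis
      unfolding walk_tail_moment_def f_def[symmetric] pmf_expectation_eq_infsetsum walk_def by simp
  qed
  then have hs: "((\<lambda>n. walk s n * f n) has_sum walk_tail_moment e g a s) UNIV"
    using summ by simp
  have "(\<Sum>m<N. L m * walk s (k + int m)) \<le> walk_tail_moment e g a s" for N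
  proof -
    have "(\<Sum>m<N. L m * walk s (k + int m)) \<le> (\<Sum>m<N. walk s (k + int m) * f (k + int m))"
      using f_ge by (intro sum_mono) (simp add: mult.commute mult_right_mono)
    also have "\<dots> = (\<Sum>n\<in>(\<lambda>m. k + int m) ` {..<N}. walk s n * f n)"
      by (subst sum.reindex) (auto simp: inj_on_def)
    also have "\<dots> \<le> walk_tail_moment e g a s"
      by (rule finite_sum_le_has_sum[OF hs]) (auto simp: fnn)
    finally show ?thesis .
  qed
  moreover have "(\<lambda>N. \<Sum>m<N. L m * walk s (k + int m)) \<longlonglongrightarrow> front_density s k"
    using sums by (simp add: sums_def)
  ultimately show ?thesis unfolding k_def by (intro LIMSEQ_le_const2) auto
qed

end

section \<open>Convergence of the energy\<close>

abbreviation (input) energy :: "'d::finite \<Rightarrow> real \<Rightarrow> 'w measure \<Rightarrow> ('w \<Rightarrow> 'd config) \<Rightarrow> real" where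
  "energy e a M Y \<equiv> square_sum e a M Y + cov_sum e a M Y"

section \<open>The energy as one double sum of negated covariances\<close>

context exclusion
begin

lemma covariance_occupation:
  assumes t: "0 \<le> t" and xy: "x \<noteq> y"
  shows "covariance (Pr \<eta>) (\<lambda>\<omega>. of_bool (X t \<omega> x)) (\<lambda>\<omega>. of_bool (X t \<omega> y)) =
    pair_prob \<eta> t x y - occ_prob \<eta> t x * occ_prob \<eta> t y"
proof -
  interpret prob_space "Pr \<eta>" by (rule prob_space_Pr)
  have s: "of_bool (X t \<omega> x) = occupied {x} (X t \<omega>)" for \<omega> x by (simp add: occupied_def)
  have i: "integrable (Pr \<eta>) (\<lambda>\<omega>. occupied B (X t \<omega>))" if "finite B" for B
    by (rule integrable_occupied[OF that t])
  define a b where "a = occ_prob \<eta> t x" and "b = occ_prob \<eta> t y"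
  have E: "(\<integral>\<omega>. occupied {x} (X t \<omega>) \<partial>Pr \<eta>) = a" "(\<integral>\<omega>. occupied {y} (X t \<omega>) \<partial>Pr \<eta>) = b"
    "(\<integral>\<omega>. occupied {x, y} (X t \<omega>) \<partial>Pr \<eta>) = pair_prob \<eta> t x y"
    using xy by (simp_all add: a_def b_def occ_prob_def pair_prob_def corr_def)
  have "(occupied {x} (X t \<omega>) - a) * (occupied {y} (X t \<omega>) - b) =
      occupied {x, y} (X t \<omega>) - b * occupied {x} (X t \<omega>) - a * occupied {y} (X t \<omega>) + a * b" for \<omega>
    by (auto simp: occupied_def algebra_simps)
  then have "covariance (Pr \<eta>) (\<lambda>\<omega>. of_bool (X t \<omega> x)) (\<lambda>\<omega>. of_bool (X t \<omega> y)) =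
     (\<integral>\<omega>. occupied {x, y} (X t \<omega>) - b * occupied {x} (X t \<omega>) - a * occupied {y} (X t \<omega>) + a * b \<partial>Pr \<eta>)"
    unfolding covariance_def s E by simp
  also have "\<dots> = pair_prob \<eta> t x y - b * a - a * b + a * b"
    using i E by (simp add: prob_space)
  finally show ?thesis by (simp add: a_def b_def)
qed

text \<open>The terms are nonnegative by \<open>negative_correlation\<close>, so a uniform bound on
  finite sums makes the square and covariance series summable. Their \<open>infsum\<close> values
  are then genuine and not the default 0; the first conclusion relies on this as well.\<close>

lemma energy_le:
  assumes t: "0 \<le> t"
    and B: "\<And>F. finite F \<Longrightarrow> F \<subseteq> half_space e a \<Longrightarrow>
      (\<Sum>x\<in>F. \<Sum>y\<in>F. neg_cov \<eta> t x y) \<le> B"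
  shows "0 \<le> energy e a (Pr \<eta>) (X t)"
    and "energy e a (Pr \<eta>) (X t) \<le> B"
proof -
  define A where "A = half_space e a"
  define D where "D = (\<lambda>(x, y). neg_cov \<eta> t x y)"
  define off where "off = {(x, y). x \<in> A \<and> y \<in> A \<and> x \<noteq> y}"
  have D0: "0 \<le> D p" for p
    using negative_correlation[OF t] by (cases p) (simp add: D_def)
  have fin: "sum D P \<le> B" if P: "finite P" "P \<subseteq> A \<times> A" for P
  proof -
    define F where "F = fst ` P \<union> snd ` P"
    have F: "finite F" "F \<subseteq> A" "P \<subseteq> F \<times> F" using P by (force simp: F_def)+
    have "sum D P \<le> sum D (F \<times> F)" using F D0 by (intro sum_mono2) auto
    also have "\<dots> = (\<Sum>x\<in>F. \<Sum>y\<in>F. neg_cov \<eta> t x y)"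
      by (simp add: D_def sum.cartesian_product)
    also have "\<dots> \<le> B" using B F by (simp add: A_def)
    finally show ?thesis .
  qed
  have summ: "D summable_on A \<times> A"
    by (rule nonneg_bdd_above_summable_on) (use D0 fin in \<open>auto intro!: bdd_aboveI2[where M=B]\<close>)
  have split: "A \<times> A = (\<lambda>x. (x, x)) ` A \<union> off" by (auto simp: off_def)
  have sub: "D summable_on (\<lambda>x. (x, x)) ` A" "D summable_on off"
    by (rule summable_on_subset_banach[OF summ]; auto simp: off_def)+
  have sq: "square_sum e a (Pr \<eta>) (X t) = infsum D ((\<lambda>x. (x, x)) ` A)"
  proof -
    have "infsum D ((\<lambda>x. (x, x)) ` A) = infsum (\<lambda>x. D (x, x)) A"
      by (subst infsum_reindex) (auto simp: inj_on_def o_def)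
    also have "\<dots> = square_sum e a (Pr \<eta>) (X t)"
      unfolding square_sum_def A_def
      by (rule infsum_cong) (simp add: D_def power2_eq_square occ_prob_def corr_def occupied_def)
    finally show ?thesis by simp
  qed
  have cv: "cov_sum e a (Pr \<eta>) (X t) = infsum D off"
  proof -
    have "cov_sum e a (Pr \<eta>) (X t) = - infsum (\<lambda>p. - D p) off"
      unfolding cov_sum_def off_def A_def
      by (intro arg_cong[where f=uminus] infsum_cong) (auto simp: D_def covariance_occupation[OF t])
    then show ?thesis by (simp add: infsum_uminus)
  qed
  have eq: "energy e a (Pr \<eta>) (X t) = infsum D (A \<times> A)"
    unfolding sq cv split by (rule infsum_Un_disjoint[symmetric, OF sub]) (auto simp: off_def)
  show "0 \<le> energy e a (Pr \<eta>) (X t)"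
    unfolding eq using D0 by (intro infsum_nonneg) auto
  show "energy e a (Pr \<eta>) (X t) \<le> B"
    unfolding eq by (rule infsum_le_finite_sums[OF summ fin])
qed

lemma sum_occ_prob_le_expected_count:
  assumes t: "0 \<le> t" and F: "finite F" "F \<subseteq> half_space e a"
  shows "ennreal (\<Sum>x\<in>F. occ_prob \<eta> t x) \<le> (\<integral>\<^sup>+\<omega>. particle_count e a (X t \<omega>) \<partial>Pr \<eta>)"
proof -
  have i: "integrable (Pr \<eta>) (\<lambda>\<omega>. \<Sum>x\<in>F. occupied {x} (X t \<omega>))"
    using t by (intro Bochner_Integration.integrable_sum integrable_occupied) auto
  have "(\<Sum>x\<in>F. occ_prob \<eta> t x) = (\<integral>\<omega>. (\<Sum>x\<in>F. occupied {x} (X t \<omega>)) \<partial>Pr \<eta>)"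
    using t by (simp add: occ_prob_def corr_def integrable_occupied)
  also have "ennreal \<dots> = (\<integral>\<^sup>+\<omega>. ennreal (\<Sum>x\<in>F. occupied {x} (X t \<omega>)) \<partial>Pr \<eta>)"
    by (rule nn_integral_eq_integral[symmetric, OF i]) (auto intro: sum_nonneg occupied_bounds)
  also have "\<dots> \<le> (\<integral>\<^sup>+\<omega>. particle_count e a (X t \<omega>) \<partial>Pr \<eta>)"
  proof (rule nn_integral_mono)
    fix \<omega>
    have "ennreal (\<Sum>x\<in>F. occupied {x} (X t \<omega>)) = (\<Sum>\<^sub>\<infinity>x\<in>F. of_bool (X t \<omega> x))"
    proof -
      have "ennreal (occupied {x} (X t \<omega>)) = of_bool (X t \<omega> x)" for x
        by (simp add: occupied_def)
      then show ?thesis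
        using F(1) by (simp add: sum_ennreal[symmetric] occupied_bounds)
    qed
    also have "\<dots> \<le> (\<Sum>\<^sub>\<infinity>x\<in>half_space e a. of_bool (X t \<omega> x))"
      using F(2) by (intro infsum_mono_neutral nonneg_summable_on_complete) auto
    finally show "ennreal (\<Sum>x\<in>F. occupied {x} (X t \<omega>)) \<le> particle_count e a (X t \<omega>)"
      by (simp add: particle_count_def)
  qed
  finally show ?thesis .
qed

end

section \<open>Passage to the infinite profile and the limit in time\<close>

locale exclusion_profile = exclusion Pr X + profile_functions e g
  for Pr :: "'d::finite config \<Rightarrow> 'w measure" and X :: "real \<Rightarrow> 'w \<Rightarrow> 'd config"
    and e :: 'd and g :: "'d \<Rightarrow> real \<Rightarrow> real"
begin

abbreviation (input) front :: "(real \<Rightarrow> real) \<Rightarrow> real \<Rightarrow> real" where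
  "front z t \<equiv> front_density (t / real CARD('d)) (\<lfloor>z t\<rfloor> + 1)"

text \<open>At any given site the truncations agree with the profile from some index on, which is
  convergence in the product topology.\<close>

lemma corr_truncated_tendsto:
  assumes B: "finite B" and t: "0 \<le> t"
  shows "(\<lambda>M. corr (truncated M) t B) \<longlonglongrightarrow> corr (profile e g) t B"
proof -
  have "(\<lambda>M. truncated M y) \<longlonglongrightarrow> profile e g y" for y
  proof (rule tendsto_eventually)
    have "\<forall>\<^sub>F M in sequentially. nat (- (y $ e)) \<le> M" by (rule eventually_ge_at_top)
    then show "\<forall>\<^sub>F M in sequentially. truncated M y = profile e g y"
      by eventually_elim (auto simp: truncated_def)
  qed
  then have "limitin (product_topology (\<lambda>_. euclidean) UNIV) truncated (profile e g) sequentially"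
    unfolding limitin_componentwise by simp
  then have "truncated \<longlonglongrightarrow> profile e g"
    by (simp add: euclidean_product_topology)
  then show ?thesis
    by (rule continuous_on_tendsto_compose[OF continuous_corr[OF B t]]) auto
qed

text \<open>Monotonicity in the set of initial particles is read off from the explicit heat-kernel
  sum for finite configurations and passes to the limit.\<close>

lemma occ_prob_truncated_le:
  assumes t: "0 \<le> t"
  shows "occ_prob (truncated M) t x \<le> occ_prob (profile e g) t x"
proof (rule incseq_le)
  show "incseq (\<lambda>M. occ_prob (truncated M) t x)"
  proof (rule incseq_SucI)
    fix M
    show "occ_prob (truncated M) t x \<le> occ_prob (truncated (Suc M)) t x"
      unfolding occ_prob_finite[OF finite_truncated t]
      by (rule sum_mono2[OF finite_truncated]) (auto simp: truncated_def)
  qed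
  show "(\<lambda>M. occ_prob (truncated M) t x) \<longlonglongrightarrow> occ_prob (profile e g) t x"
    unfolding occ_prob_def by (rule corr_truncated_tendsto) (use t in auto)
qed

lemma half_space_eq: "half_space e a = {x. \<lfloor>a\<rfloor> + 1 \<le> x $ e}"
  by (simp only: half_space_def add1_zle_eq floor_less_iff)

text \<open>The expected count in the half-space equals the sum of reaching probabilities over the
  initial sites, so the bound \<open>K\<close> becomes a statement about tails of the
  one-dimensional walk.\<close>

lemma expected_count_truncated:
  assumes t: "0 \<le> t"
    and K: "\<And>F. finite F \<Longrightarrow> F \<subseteq> half_space e a \<Longrightarrow> (\<Sum>x\<in>F. occ_prob (profile e g) t x) \<le> K"
  shows "(\<Sum>m\<le>M. L m * tail (t / real CARD('d)) (\<lfloor>a\<rfloor> + 1 + int m)) \<le> K"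
  unfolding reach_truncated[symmetric]
proof (rule has_sum_le_finite_sums[OF occ_prob_has_sum_reach[OF finite_truncated t]])
  fix F :: "'d site set" assume F: "finite F"
  have "(\<Sum>u\<in>F. of_bool (\<lfloor>a\<rfloor> + 1 \<le> u $ e) * occ_prob (truncated M) t u) =
     (\<Sum>u\<in>F \<inter> half_space e a. occ_prob (truncated M) t u)"
    using F by (intro sum.mono_neutral_cong_right) (auto simp: half_space_eq)
  also have "\<dots> \<le> (\<Sum>u\<in>F \<inter> half_space e a. occ_prob (profile e g) t u)"
    by (intro sum_mono occ_prob_truncated_le t)
  also have "\<dots> \<le> K" using F by (intro K) auto
  finally show "(\<Sum>u\<in>F. of_bool (\<lfloor>a\<rfloor> + 1 \<le> u $ e) * occ_prob (truncated M) t u) \<le> K" .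
qed

theorem energy_profile_le:
  assumes t: "0 \<le> t"
    and K: "\<And>F. finite F \<Longrightarrow> F \<subseteq> half_space e a \<Longrightarrow> (\<Sum>x\<in>F. occ_prob (profile e g) t x) \<le> K"
    and H: "\<And>r. 0 \<le> r \<Longrightarrow> (H has_real_derivative H' r) (at r within {0..})"
    and H': "\<And>r. 0 \<le> r \<Longrightarrow> (2 / sqrt (1 + r / real CARD('d))) ^ (CARD('d) - 1) \<le> H' r"
    and C: "0 \<le> C" "\<And>m. L (Suc m) \<le> C * L m"
    and F: "finite F" "F \<subseteq> half_space e a"
  defines "Q \<equiv> front_density (t / real CARD('d)) (\<lfloor>a\<rfloor> + 1)"
  shows "(\<Sum>x\<in>F. \<Sum>y\<in>F. neg_cov (profile e g) t x y) \<le>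
     Q * K + (H t - H 0) * (L 0 * (2 / sqrt (1 + t / real CARD('d))) + C * Q) * Q"
proof -
  define s where "s = t / real CARD('d)"
  define k where "k = \<lfloor>a\<rfloor> + 1"
  have s: "0 \<le> s" using t by (simp add: s_def)
  have KM: "(\<Sum>m\<le>M. L m * tail s (k + int m)) \<le> K" for M
    unfolding s_def k_def by (rule expected_count_truncated[OF t K])
  have Q: "(\<Sum>m\<le>M. L m * walk s (k + int m)) \<le> Q" for M
    unfolding Q_def s_def[symmetric] k_def[symmetric] by (rule partial_sum_le_front_density[OF KM])
  have tQ: "tail s k \<le> Q"
    unfolding Q_def s_def[symmetric] k_def[symmetric] by (rule tail_le_front_density[OF KM])
  have Q0: "0 \<le> Q" using tQ tail_bounds(1)[of s k] by linarith
  have Hmono: "H 0 \<le> H t"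
  proof (rule nondecreasing_from_derivative[where T=t and f'=H'])
    fix r assume r: "0 \<le> r" "r \<le> t"
    show "(H has_real_derivative H' r) (at r within {0..t})" by (rule DERIV_subset[OF H[OF r(1)]]) auto
    have "0 \<le> (2 / sqrt (1 + r / real CARD('d))) ^ (CARD('d) - 1)" using r by simp
    then show "0 \<le> H' r" using H'[OF r(1)] by linarith
  qed (use t in auto)
  have main: "(\<Sum>x\<in>F. \<Sum>y\<in>F. neg_cov (truncated M) t x y) \<le>
     Q * K + (H t - H 0) * (L 0 * (2 / sqrt (1 + s)) + C * Q) * Q" for M
  proof -
    have "(\<Sum>x\<in>F. \<Sum>y\<in>F. neg_cov (truncated M) t x y) \<le>
      (\<Sum>y\<in>{y. truncated M y}. (reach e k t y)\<^sup>2) + (H t - H 0) * layer_mass e (truncated M) t (k - 1) * layer_mass e (truncated M) t k"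
    proof (rule energy_bound_finite[OF finite_truncated t _ H' F(1)])
      show "(H has_real_derivative H' r) (at r within {0..t})" if "0 \<le> r" "r \<le> t" for r
        by (rule DERIV_subset[OF H[OF that(1)]]) auto
      show "k \<le> x $ e" if "x \<in> F" for x using F(2) that by (auto simp: half_space_eq k_def)
    qed
    \<comment> \<open>All initial particles have first coordinate at most 0, so none reaches the
      half-space with probability above \<open>tail s k \<le> Q\<close>. One factor of the square is
      bounded by \<open>Q\<close>; the other sums to at most \<open>K\<close>.\<close>
    also have "(\<Sum>y\<in>{y. truncated M y}. (reach e k t y)\<^sup>2) \<le> Q * K"
    proof -
      have "(\<Sum>y\<in>{y. truncated M y}. (reach e k t y)\<^sup>2) \<le> (\<Sum>y\<in>{y. truncated M y}. Q * reach e k t y)"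
      proof (rule sum_mono)
        fix y assume "y \<in> {y. truncated M y}"
        then have "y $ e \<le> 0" by (auto simp: truncated_def profile_def profile_region_def)
        then have "reach e k t y \<le> tail s k"
          using tail_antimono[of s k "nat (- (y $ e))"] by (simp add: reach_def s_def)
        then show "(reach e k t y)\<^sup>2 \<le> Q * reach e k t y"
          unfolding power2_eq_square using tQ by (intro mult_right_mono reach_bounds) linarith
      qed
      also have "\<dots> = Q * (\<Sum>m\<le>M. L m * tail s (k + int m))"
        by (simp add: sum_distrib_left[symmetric] reach_truncated s_def)
      also have "\<dots> \<le> Q * K" by (rule mult_left_mono[OF KM Q0])
      finally show ?thesis .
    qed
    also have "(H t - H 0) * layer_mass e (truncated M) t (k - 1) * layer_mass e (truncated M) t k \<le>
        (H t - H 0) * (L 0 * (2 / sqrt (1 + s)) + C * Q) * Q"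
    proof (intro mult_mono mult_nonneg_nonneg)
      show "layer_mass e (truncated M) t k \<le> Q"
        unfolding layer_mass_truncated s_def[symmetric] by (rule Q)
      \<comment> \<open>The layer \<open>k - 1\<close> is outside the half-space. Shifting the depth
        by one expresses its mass through kernel values at layer \<open>k\<close>, at the cost of
        the ratio \<open>C\<close> of consecutive layer sizes and of one extra term from depth
        0.\<close>
      have "layer_mass e (truncated M) t (k - 1) = L 0 * walk s (k - 1) + (\<Sum>m<M. L (Suc m) * walk s (k + int m))"
        unfolding layer_mass_truncated s_def[symmetric] by (subst sum.atMost_shift) simp
      also have "L 0 * walk s (k - 1) \<le> L 0 * (2 / sqrt (1 + s))"
        by (intro mult_left_mono walk_le s) (simp add: L_def)
      also have "(\<Sum>m<M. L (Suc m) * walk s (k + int m)) \<le> (\<Sum>m<M. C * (L m * walk s (k + int m)))"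
        using C(2) by (intro sum_mono) (simp add: mult.assoc[symmetric] mult_right_mono)
      also have "\<dots> \<le> C * (\<Sum>m\<le>M. L m * walk s (k + int m))"
        unfolding sum_distrib_left[symmetric]
        by (intro mult_left_mono sum_mono2 C(1)) (auto simp: L_def)
      also have "\<dots> \<le> C * Q" by (rule mult_left_mono[OF Q C(1)])
      finally show "layer_mass e (truncated M) t (k - 1) \<le> L 0 * (2 / sqrt (1 + s)) + C * Q" by simp
    qed (use Hmono Q0 C s in \<open>auto simp: L_def\<close>)
    finally show ?thesis by simp
  qed
  have "(\<lambda>M. \<Sum>x\<in>F. \<Sum>y\<in>F. neg_cov (truncated M) t x y)
    \<longlonglongrightarrow> (\<Sum>x\<in>F. \<Sum>y\<in>F. neg_cov (profile e g) t x y)"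
  proof -
    have "(\<lambda>M. occ_prob (truncated M) t x) \<longlonglongrightarrow> occ_prob (profile e g) t x" for x
      unfolding occ_prob_def by (rule corr_truncated_tendsto) (use t in auto)
    moreover have "(\<lambda>M. pair_prob (truncated M) t x y) \<longlonglongrightarrow> pair_prob (profile e g) t x y" for x y
      unfolding pair_prob_def using corr_truncated_tendsto[of "{x, y}" t] t by simp
    ultimately show ?thesis by (intro tendsto_sum tendsto_diff tendsto_mult)
  qed
  then show ?thesis
    using main unfolding s_def by (intro LIMSEQ_le_const2) auto
qed

text \<open>\<open>h\<close> is a rate for which \<open>(H t - H 0) * (h t)^2\<close> still
  converges. Writing the squared front density as \<open>(q / h)^2 * h^2\<close> separates the
  growth of \<open>H\<close> from the decay at the front. The term from depth 0 has only one factor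
  \<open>q\<close>; there the kernel bound \<open>v\<close> compensates \<open>H\<close>.\<close>

theorem energy_tendsto_0:
  fixes z :: "real \<Rightarrow> real"
  assumes K: "\<And>t F. 0 \<le> t \<Longrightarrow> finite F \<Longrightarrow> F \<subseteq> half_space e (z t) \<Longrightarrow> (\<Sum>x\<in>F. occ_prob (profile e g) t x) \<le> K"
    and H: "\<And>r. 0 \<le> r \<Longrightarrow> (H has_real_derivative H' r) (at r within {0..})"
    and H': "\<And>r. 0 \<le> r \<Longrightarrow> (2 / sqrt (1 + r / real CARD('d))) ^ (CARD('d) - 1) \<le> H' r"
    and w: "((\<lambda>t. (H t - H 0) * (2 / sqrt (1 + t / real CARD('d)))) \<longlongrightarrow> a) at_top"
    and h: "((\<lambda>t. (H t - H 0) * (h t)\<^sup>2) \<longlongrightarrow> b') at_top" "\<forall>\<^sub>F t in at_top. h t \<noteq> 0"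
    and Qh: "((\<lambda>t. front z t / h t) \<longlongrightarrow> 0) at_top"
    and Q: "((\<lambda>t. front z t) \<longlongrightarrow> 0) at_top"
  shows "((\<lambda>t. energy e (z t) (Pr (profile e g)) (X t)) \<longlongrightarrow> 0) at_top"
proof -
  define q where "q t = front z t" for t
  define v where "v t = 2 / sqrt (1 + t / real CARD('d))" for t
  obtain C where C: "0 \<le> C" "\<And>m. L (Suc m) \<le> C * L m" using L_step by blast
  define b where "b t = q t * K + (H t - H 0) * (L 0 * v t + C * q t) * q t" for t
  have bnd: "(\<Sum>x\<in>F. \<Sum>y\<in>F. neg_cov (profile e g) t x y) \<le> b t"
    if "0 \<le> t" "finite F" "F \<subseteq> half_space e (z t)" for t F
    unfolding b_def q_def v_def by (rule energy_profile_le[OF that(1) K[OF that(1)] H H' C that(2,3)])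
  have "((\<lambda>t. q t * K + L 0 * ((H t - H 0) * v t) * q t + C * ((H t - H 0) * (h t)\<^sup>2) * (q t / h t)\<^sup>2) \<longlongrightarrow>
      0 * K + L 0 * a * 0 + C * b' * 0\<^sup>2) at_top"
    unfolding q_def v_def by (intro tendsto_intros w h Qh Q)
  moreover have "\<forall>\<^sub>F t in at_top. q t * K + L 0 * ((H t - H 0) * v t) * q t + C * ((H t - H 0) * (h t)\<^sup>2) * (q t / h t)\<^sup>2 = b t"
    using h(2)
  proof eventually_elim
    case (elim t)
    have alg: "x * K + l * (d * y) * x + C * (d * hh) * r = x * K + d * (l * y + C * x) * x"
      if "hh * r = x * x" for x l d y hh r :: real
    proof -
      have "C * (d * hh) * r = C * d * (x * x)" unfolding that[symmetric] by (simp only: mult.assoc)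
      then show ?thesis by (simp add: algebra_simps)
    qed
    have "(h t)\<^sup>2 * (q t / h t)\<^sup>2 = q t * q t"
      using elim by (simp add: power2_eq_square)
    then show ?case unfolding b_def by (rule alg)
  qed
  ultimately have b: "(b \<longlongrightarrow> 0) at_top"
    by (simp add: tendsto_cong)
  have ge0: "\<forall>\<^sub>F t in at_top. (0::real) \<le> t" by (rule eventually_ge_at_top)
  show ?thesis
  proof (rule tendsto_sandwich[OF _ _ tendsto_const b])
    show "\<forall>\<^sub>F t in at_top. 0 \<le> energy e (z t) (Pr (profile e g)) (X t)"
      using ge0
    proof eventually_elim
      case (elim t)
      show ?case by (rule energy_le(1)[OF elim bnd[OF elim]])
    qed
    show "\<forall>\<^sub>F t in at_top. energy e (z t) (Pr (profile e g)) (X t) \<le> b t"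
      using ge0
    proof eventually_elim
      case (elim t)
      show ?case by (rule energy_le(2)[OF elim bnd[OF elim]])
    qed
  qed
qed

lemma front_density_tendsto_0:
  fixes z :: "real \<Rightarrow> real"
  assumes K: "\<And>t F. 0 \<le> t \<Longrightarrow> finite F \<Longrightarrow> F \<subseteq> half_space e (z t) \<Longrightarrow> (\<Sum>x\<in>F. occ_prob (profile e g) t x) \<le> K"
  shows "((\<lambda>t. front z t) \<longlongrightarrow> 0) at_top"
proof (rule order_tendstoI)
  fix a :: real assume a: "a < 0"
  show "\<forall>\<^sub>F t in at_top. a < front z t"
    using eventually_ge_at_top[of 0]
  proof eventually_elim
    case (elim t)
    have "tail (t / real CARD('d)) (\<lfloor>z t\<rfloor> + 1) \<le> front z t"
      by (rule tail_le_front_density[OF expected_count_truncated[OF elim K[OF elim]]])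
    then show ?case using a tail_bounds(1)[of "t / real CARD('d)" "\<lfloor>z t\<rfloor> + 1"] by linarith
  qed
next
  fix a :: real assume a: "0 < a"
  define c where "c = exp 1 * 3 ^ CARD('d) * K"
  \<comment> \<open>\<open>J\<close> is fixed before \<open>t\<close>: the term with
    \<open>K / J\<close> does not shrink in time, whereas the other term vanishes for any fixed
    \<open>B\<close>, and \<open>B\<close> depends on \<open>J\<close>.\<close>
  obtain J :: nat where J: "max 1 (2 * c / a) < real J" using reals_Archimedean2 by blast
  then have J0: "0 < J" by simp
  have cJ: "c / real J < a / 2"
    using J a J0 by (simp add: field_simps)
  obtain B where B: "\<And>s k K. 0 \<le> s \<Longrightarrow> (\<And>M. (\<Sum>m\<le>M. L m * tail s (k + int m)) \<le> K) \<Longrightarrow>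
     front_density s k \<le> B * (2 / sqrt (1 + s)) + exp 1 * 3 ^ CARD('d) * K / real J"
    using front_density_le[OF J0] by blast
  have "((\<lambda>s::real. B * (2 / sqrt (1 + s))) \<longlongrightarrow> B * 0) at_top"
    by (intro tendsto_mult tendsto_const) real_asymp
  moreover have "filterlim (\<lambda>t::real. t / real CARD('d)) at_top at_top"
    unfolding divide_inverse by (rule filterlim_at_top_mult_tendsto_pos[OF tendsto_const _ filterlim_ident]) auto
  ultimately have "((\<lambda>t. B * (2 / sqrt (1 + t / real CARD('d)))) \<longlongrightarrow> B * 0) at_top"
    by (rule filterlim_compose)
  then have "\<forall>\<^sub>F t in at_top. B * (2 / sqrt (1 + t / real CARD('d))) < a / 2"
    using a by (intro order_tendstoD(2)) auto
  then show "\<forall>\<^sub>F t in at_top. front z t < a"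
    using eventually_ge_at_top[of 0]
  proof eventually_elim
    case (elim t)
    have "front z t \<le> B * (2 / sqrt (1 + t / real CARD('d))) + exp 1 * 3 ^ CARD('d) * K / real J"
      by (rule B[OF _ expected_count_truncated[OF elim(2) K[OF elim(2)]]]) (use elim in simp)
    then show ?case using elim(1) cJ unfolding c_def by linarith
  qed
qed

lemma front_density_smallo:
  fixes z :: "real \<Rightarrow> real"
  assumes K: "\<And>t F. 0 \<le> t \<Longrightarrow> finite F \<Longrightarrow> F \<subseteq> half_space e (z t) \<Longrightarrow> (\<Sum>x\<in>F. occ_prob (profile e g) t x) \<le> K"
    and o: "(\<lambda>t. walk_tail_moment e g (z t) (t / real CARD('d))) \<in> o[at_top](h)"
  shows "((\<lambda>t. front z t / h t) \<longlongrightarrow> 0) at_top"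
proof -
  have "(\<lambda>t. front z t) \<in> O[at_top](\<lambda>t. walk_tail_moment e g (z t) (t / real CARD('d)))"
  proof (rule bigoI[where c=1])
    show "\<forall>\<^sub>F t in at_top. norm (front z t) \<le> 1 * norm (walk_tail_moment e g (z t) (t / real CARD('d)))"
      using eventually_ge_at_top[of 0]
    proof eventually_elim
      case (elim t)
      note KM = expected_count_truncated[OF elim K[OF elim]]
      have "front z t \<le> walk_tail_moment e g (z t) (t / real CARD('d))"
        by (rule front_density_le_walk_tail_moment[OF KM])
      moreover have "0 \<le> front z t"
        using tail_le_front_density[OF KM] tail_bounds(1) by (rule order_trans[rotated])
      ultimately show ?case by simp
    qed
  qed
  from landau_o.big_small_trans[OF this o] show ?thesis by (rule smalloD_tendsto)
qed

end

theorem theorem4p1: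
  fixes Pr :: "'d::finite config \<Rightarrow> 'w measure"
    and X :: "real \<Rightarrow> 'w \<Rightarrow> 'd config"
    and e :: 'd
    and g :: "'d \<Rightarrow> real \<Rightarrow> real"
    and z :: "real \<Rightarrow> real"
  assumes "CARD('d) \<ge> 2"
    and "symmetric_exclusion Pr X"
    and "\<And>i u. i \<noteq> e \<Longrightarrow> u \<ge> 0 \<Longrightarrow> g i u \<ge> 0"
    and "\<And>i. i \<noteq> e \<Longrightarrow> cond_A (g i) \<and> cond_B (g i) \<and> cond_C (g i)"
    and "(SUP t\<in>{0..}. \<integral>\<^sup>+\<omega>. particle_count e (z t) (X t \<omega>) \<partial>Pr (profile e g)) < \<infinity>"
  shows "(CARD('d) \<ge> 4 \<longrightarrow>
           ((\<lambda>t. square_sum e (z t) (Pr (profile e g)) (X t)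
               + cov_sum e (z t) (Pr (profile e g)) (X t)) \<longlongrightarrow> 0) at_top) \<and>
         (CARD('d) \<in> {2, 3} \<and>
          (CARD('d) = 3 \<longrightarrow>
             (\<lambda>t. walk_tail_moment e g (z t) (t / real CARD('d)))
               \<in> o[at_top](\<lambda>t. ln t powr (- 1 / 2))) \<and>
          (CARD('d) = 2 \<longrightarrow>
             (\<lambda>t. walk_tail_moment e g (z t) (t / real CARD('d)))
               \<in> o[at_top](\<lambda>t. t powr (- 1 / 4))) \<longrightarrow>
           ((\<lambda>t. square_sum e (z t) (Pr (profile e g)) (X t)
               + cov_sum e (z t) (Pr (profile e g)) (X t)) \<longlongrightarrow> 0) at_top)"
proof -
  interpret exclusion_profile Pr X e g
    using assms(2-4) by unfold_locales auto
  define S where "S = (SUP t\<in>{0..}. \<integral>\<^sup>+\<omega>. particle_count e (z t) (X t \<omega>) \<partial>Pr (profile e g))"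
  have K: "(\<Sum>x\<in>F. occ_prob (profile e g) t x) \<le> enn2real S"
    if t: "0 \<le> t" and F: "finite F" "F \<subseteq> half_space e (z t)" for t F
  proof -
    have "ennreal (\<Sum>x\<in>F. occ_prob (profile e g) t x) \<le> S"
      unfolding S_def
      by (rule order_trans[OF sum_occ_prob_le_expected_count[OF t F]]) (use t in \<open>auto intro: SUP_upper\<close>)
    also have "S = ennreal (enn2real S)" using assms(5) by (simp add: S_def)
    finally show ?thesis by (simp add: ennreal_le_iff)
  qed
  note Q = front_density_tendsto_0[OF K]
  let ?E = "\<lambda>t. energy e (z t) (Pr (profile e g)) (X t)"
  have "(?E \<longlongrightarrow> 0) at_top" if d: "CARD('d) \<ge> 4"
  proof -
    define d where "d = real CARD('d)"
    define c where "c = (2::real) ^ (CARD('d) - 1)"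
    \<comment> \<open>An antiderivative of \<open>c * (1 + r / d) powr (- 3 / 2)\<close>. The
      exponent is that of dimension 4; in higher dimensions the decay factor is smaller, as
      \<open>1 / sqrt (1 + r / d) \<le> 1\<close>. Since \<open>H\<close> is bounded, the constant
      rate 1 serves as \<open>h\<close>.\<close>
    define H where "H r = - (2 * d * c / sqrt (1 + r / d))" for r
    have d0: "0 < d" and c0: "0 < c" by (simp_all add: d_def c_def)
    have lim: "filterlim (\<lambda>t. t / d) at_top at_top"
      unfolding divide_inverse using d0
      by (intro filterlim_at_top_mult_tendsto_pos[OF tendsto_const _ filterlim_ident]) auto
    have inv: "((\<lambda>t. 1 / sqrt (1 + t / d)) \<longlongrightarrow> 0) at_top"
      by (rule filterlim_compose[OF _ lim, where g="\<lambda>s. 1 / sqrt (1 + s)"]) real_asymp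
    have Hdiff: "H t - H 0 = 2 * d * c * (1 - 1 / sqrt (1 + t / d))" for t
      by (simp add: H_def algebra_simps)
    show ?thesis
    proof (rule energy_tendsto_0[where K="enn2real S" and H=H and h="\<lambda>_. 1" and a=0 and b'="2 * d * c"
        and H'="\<lambda>r. c / ((1 + r / d) * sqrt (1 + r / d))"])
      fix r :: real assume r: "0 \<le> r"
      define x where "x = 1 + r / d"
      have x: "1 \<le> x" using r d0 by (simp add: x_def)
      have "((\<lambda>r. 1 + r / d) has_real_derivative 1 / d) (at r within {0..})"
        using d0 by (auto intro!: derivative_eq_intros)
      moreover have "((\<lambda>x. - (2 * d * c / sqrt x)) has_real_derivative d * c / (x * sqrt x)) (at (1 + r / d))"
      proof -
        have "((\<lambda>x. - (2 * d * c / sqrt x)) has_real_derivative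
            - ((0 * sqrt x - 2 * d * c * (inverse (sqrt x) / 2)) / (sqrt x * sqrt x))) (at x)"
          using x by (intro DERIV_minus DERIV_divide DERIV_const DERIV_real_sqrt) auto
        also have "- ((0 * sqrt x - 2 * d * c * (inverse (sqrt x) / 2)) / (sqrt x * sqrt x)) = d * c / (x * sqrt x)"
          using x by (simp add: field_simps)
        finally show ?thesis by (simp only: x_def)
      qed
      ultimately have "(H has_real_derivative d * c / (x * sqrt x) * (1 / d)) (at r within {0..})"
        unfolding H_def[abs_def]
        by (rule DERIV_chain2[where g="\<lambda>r. 1 + r / d" and f="\<lambda>x. - (2 * d * c / sqrt x)", rotated])
      then show "(H has_real_derivative c / ((1 + r / d) * sqrt (1 + r / d))) (at r within {0..})"
        using d0 by (simp add: x_def)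
      have "(2 / sqrt x) ^ (CARD('d) - 1) = c * (1 / sqrt x) ^ (CARD('d) - 1)"
        by (simp add: c_def power_divide)
      also have "\<dots> \<le> c * (1 / sqrt x) ^ 3"
        using x d c0 by (intro mult_left_mono power_decreasing) auto
      also have "\<dots> = c / (x * sqrt x)"
        using x by (simp add: power3_eq_cube power_divide)
      finally show "(2 / sqrt (1 + r / real CARD('d))) ^ (CARD('d) - 1) \<le> c / ((1 + r / d) * sqrt (1 + r / d))"
        by (simp add: x_def d_def)
    next
      have "((\<lambda>t. 2 * d * c * (1 - 1 / sqrt (1 + t / d)) * (2 * (1 / sqrt (1 + t / d)))) \<longlongrightarrow> 2 * d * c * (1 - 0) * (2 * 0)) at_top"
        by (intro tendsto_intros inv)
      then show "((\<lambda>t. (H t - H 0) * (2 / sqrt (1 + t / real CARD('d)))) \<longlongrightarrow> 0) at_top"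
        unfolding Hdiff by (simp add: d_def)
      have "((\<lambda>t. 2 * d * c * (1 - 1 / sqrt (1 + t / d))) \<longlongrightarrow> 2 * d * c * (1 - 0)) at_top"
        by (intro tendsto_intros inv)
      then show "((\<lambda>t. (H t - H 0) * 1\<^sup>2) \<longlongrightarrow> 2 * d * c) at_top"
        unfolding Hdiff by simp
    qed (use K Q in auto)
  qed
  moreover have "(?E \<longlongrightarrow> 0) at_top"
    if d: "CARD('d) = 3" and o: "(\<lambda>t. walk_tail_moment e g (z t) (t / real CARD('d))) \<in> o[at_top](\<lambda>t. ln t powr (- 1 / 2))"
  \<comment> \<open>The decay factor is exactly \<open>4 / (1 + r / 3)\<close>, with antiderivative
    \<open>12 * ln (1 + r / 3)\<close>. The square of \<open>h\<close> is \<open>1 / ln t\<close>,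
    which leaves the limit 12.\<close>
  proof (rule energy_tendsto_0[where K="enn2real S" and H="\<lambda>r. 12 * ln (1 + r / 3)" and h="\<lambda>t. ln t powr (- 1 / 2)"
        and a=0 and b'=12 and H'="\<lambda>r. 4 / (1 + r / 3)"])
    fix r :: real assume r: "0 \<le> r"
    show "((\<lambda>r. 12 * ln (1 + r / 3)) has_real_derivative 4 / (1 + r / 3)) (at r within {0..})"
      using r by (auto intro!: derivative_eq_intros simp: field_simps)
    show "(2 / sqrt (1 + r / real CARD('d))) ^ (CARD('d) - 1) \<le> 4 / (1 + r / 3)"
      using r by (simp add: d power_divide)
  next
    show "((\<lambda>t::real. (12 * ln (1 + t / 3) - 12 * ln (1 + 0 / 3)) * (2 / sqrt (1 + t / real CARD('d)))) \<longlongrightarrow> 0) at_top"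
      unfolding d by real_asymp
    show "((\<lambda>t::real. (12 * ln (1 + t / 3) - 12 * ln (1 + 0 / 3)) * (ln t powr (- 1 / 2))\<^sup>2) \<longlongrightarrow> 12) at_top"
      by real_asymp
    show "\<forall>\<^sub>F t::real in at_top. ln t powr (- 1 / 2) \<noteq> 0"
      using eventually_gt_at_top[of 1] by eventually_elim simp
    show "((\<lambda>t. front z t / ln t powr (- 1 / 2)) \<longlongrightarrow> 0) at_top"
      by (rule front_density_smallo[OF K o])
  qed (use K Q in auto)
  moreover have "(?E \<longlongrightarrow> 0) at_top"
    if d: "CARD('d) = 2" and o: "(\<lambda>t. walk_tail_moment e g (z t) (t / real CARD('d))) \<in> o[at_top](\<lambda>t. t powr (- 1 / 4))"
  \<comment> \<open>Here \<open>H\<close> grows like \<open>8 * sqrt (t / 2)\<close>. Multiplied by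
    the kernel bound \<open>2 / sqrt (1 + t / 2)\<close> it tends to 16, and multiplied by
    \<open>1 / sqrt t\<close>, the square of \<open>h\<close>, to
    \<open>8 * sqrt (1 / 2)\<close>.\<close>
  proof (rule energy_tendsto_0[where K="enn2real S" and H="\<lambda>r. 8 * sqrt (1 + r / 2)" and h="\<lambda>t. t powr (- 1 / 4)"
        and a=16 and b'="8 * (1 / 2) powr (1 / 2)" and H'="\<lambda>r. 2 / sqrt (1 + r / 2)"])
    fix r :: real assume r: "0 \<le> r"
    show "((\<lambda>r. 8 * sqrt (1 + r / 2)) has_real_derivative 2 / sqrt (1 + r / 2)) (at r within {0..})"
      using r by (auto intro!: derivative_eq_intros simp: field_simps)
    show "(2 / sqrt (1 + r / real CARD('d))) ^ (CARD('d) - 1) \<le> 2 / sqrt (1 + r / 2)"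
      by (simp add: d)
  next
    show "((\<lambda>t::real. (8 * sqrt (1 + t / 2) - 8 * sqrt (1 + 0 / 2)) * (2 / sqrt (1 + t / real CARD('d)))) \<longlongrightarrow> 16) at_top"
      unfolding d by real_asymp
    show "((\<lambda>t::real. (8 * sqrt (1 + t / 2) - 8 * sqrt (1 + 0 / 2)) * (t powr (- 1 / 4))\<^sup>2) \<longlongrightarrow> 8 * (1 / 2) powr (1 / 2)) at_top"
      by real_asymp
    show "\<forall>\<^sub>F t::real in at_top. t powr (- 1 / 4) \<noteq> 0"
      using eventually_gt_at_top[of 0] by eventually_elim simp
    show "((\<lambda>t. front z t / t powr (- 1 / 4)) \<longlongrightarrow> 0) at_top"
      by (rule front_density_smallo[OF K o])
  qed (use K Q in auto)
  ultimately show ?thesis by auto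
qed

end
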